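(* Let $p$ be a prime. The transcendence degree of the field $\mathbb{F}_p(x)\big(\overline{E}_p(cx)\big)_{c\in\mathbb{F}_p^\times}$ over $\mathbb{F}_p(x)$ equals $\phi(p-1)$, where $\phi$ is Euler's totient function.
   Context: $\overline{E}_p(x)\in\mathbb{F}_p[[x]]$ denotes the reduction modulo $p$ of the Artin–Hasse exponential $E_p(x)=\exp\left(\sum_{n\ge0}x^{p^n}/p^n\right)\in\mathbb{Z}_{(p)}[[x]]$, and $\overline{E}_p(cx)$ is obtained by substituting $cx$ for $x$. The field $\mathbb{F}_p(x)\big(\overline{E}_p(cx)\big)_{c\in\mathbb{F}_p^\times}$ is the subfield of $\mathbb{F}_p((x))$ generated over $\mathbb{F}_p(x)$ by these series. *)

theory Defs
  imports
    "HOL-Computational_Algebra.Formal_Laurent_Series"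
    "HOL-Library.Poly_Mapping"
    "HOL-Library.Extended_Nat"
    "HOL-Number_Theory.Totient"
    "Berlekamp_Zassenhaus.Finite_Field"
begin

section \<open>Generated subfields and transcendence degree inside an ambient field\<close>

definition is_subfield :: "'a::field set \<Rightarrow> bool" where
  "is_subfield F \<longleftrightarrow>
     0 \<in> F \<and> 1 \<in> F \<and>
     (\<forall>x\<in>F. \<forall>y\<in>F. x + y \<in> F \<and> x * y \<in> F) \<and>
     (\<forall>x\<in>F. - x \<in> F \<and> inverse x \<in> F)"

definition generated_subfield :: "'a::field set \<Rightarrow> 'a set" where
  "generated_subfield S = \<Inter>{F. is_subfield F \<and> S \<subseteq> F}"

text \<open>
  A multivariate polynomial is a finitely supported map from monomials (finitely supported
  exponent vectors) to coefficients. The variables are named by the elements of the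
  ambient field themselves, and \<open>mpoly_eval\<close> substitutes for every variable the element naming it.
\<close>

type_synonym 'a self_mpoly = "('a \<Rightarrow>\<^sub>0 nat) \<Rightarrow>\<^sub>0 'a"

definition mpoly_eval :: "'a::field self_mpoly \<Rightarrow> 'a" where
  "mpoly_eval P =
     (\<Sum>m\<in>Poly_Mapping.keys P. Poly_Mapping.lookup P m *
        (\<Prod>v\<in>Poly_Mapping.keys m. v ^ Poly_Mapping.lookup m v))"

definition mpolys_over :: "'a::field set \<Rightarrow> 'a set \<Rightarrow> 'a self_mpoly set" where
  "mpolys_over K S =
     {P. (\<forall>m. Poly_Mapping.lookup P m \<in> K) \<and>
         (\<forall>m\<in>Poly_Mapping.keys P. Poly_Mapping.keys m \<subseteq> S)}"

definition algebraically_independent :: "'a::field set \<Rightarrow> 'a set \<Rightarrow> bool" where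
  "algebraically_independent K S \<longleftrightarrow> (\<forall>P\<in>mpolys_over K S. mpoly_eval P = 0 \<longrightarrow> P = 0)"

text \<open>
  The supremum of the cardinalities of the subsets of \<open>L\<close> that are algebraically independent
  over \<open>K\<close>; all infinite cardinalities are identified.
\<close>

definition transcendence_degree :: "'a::field set \<Rightarrow> 'a set \<Rightarrow> enat" where
  "transcendence_degree K L =
     (SUP S \<in> {S. S \<subseteq> L \<and> algebraically_independent K S}.
        if finite S then enat (card S) else \<infinity>)"

section \<open>The Artin--Hasse exponential and its reduction\<close>

definition artin_hasse :: "nat \<Rightarrow> rat fps" where
  "artin_hasse p =
     fps_compose (fps_exp 1) (Abs_fps (\<lambda>k. if \<exists>n. k = p ^ n then 1 / of_nat k else 0))"

text \<open>
  On a field of characteristic \<open>p\<close>, \<open>reduce_rat\<close> is the ring homomorphism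
  from the localization of the integers at \<open>p\<close>. It is only meaningful on that subring: if \<open>p\<close>
  divides the denominator, the value is \<open>0\<close>, because division by zero is. All coefficients of
  the Artin--Hasse exponential for \<open>p\<close> lie in the subring.
\<close>

definition reduce_rat :: "rat \<Rightarrow> 'k::field" where
  "reduce_rat r = (case quotient_of r of (a, b) \<Rightarrow> of_int a / of_int b)"

lemma reduce_rat_divide:
  assumes "(of_int b :: 'k::field) \<noteq> 0"
  shows "reduce_rat (of_int a / of_int b) = (of_int a / of_int b :: 'k)"
proof -
  obtain c d where cd: "quotient_of (of_int a / of_int b) = (c, d)" by force
  have d: "d > 0" using quotient_of_denom_pos[OF cd] .
  have b: "b \<noteq> 0" using assms by auto
  have "(of_int a / of_int b :: rat) = of_int c / of_int d" using quotient_of_div[OF cd] .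
  hence "(of_int (a * d) :: rat) = of_int (c * b)" using b d by (simp add: field_simps)
  hence eq: "a * d = c * b" by (simp only: of_int_eq_iff)
  have "coprime c d" using quotient_of_coprime[OF cd] .
  hence "d dvd b"
    using eq by (metis coprime_commute coprime_dvd_mult_right_iff dvd_triv_right)
  hence "(of_int d :: 'k) \<noteq> 0" using assms by (auto elim!: dvdE)
  moreover have "(of_int a * of_int d :: 'k) = of_int c * of_int b"
    using arg_cong[OF eq, of "of_int :: int \<Rightarrow> 'k"] by simp
  ultimately show ?thesis
    using assms unfolding reduce_rat_def cd by (simp add: frac_eq_eq)
qed

definition artin_hasse_bar :: "nat \<Rightarrow> 'k::field fps" where
  "artin_hasse_bar p = Abs_fps (\<lambda>n. reduce_rat (fps_nth (artin_hasse p) n))"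

section \<open>The fields inside the field of formal Laurent series\<close>

definition rational_functions :: "'k::field fls set" where
  "rational_functions = generated_subfield (insert fls_X (range fls_const))"

definition artin_hasse_field :: "nat \<Rightarrow> 'k::field fls set" where
  "artin_hasse_field p =
     generated_subfield (rational_functions \<union>
       {fps_to_fls (fps_compose (artin_hasse_bar p) (fps_const c * fps_X)) |c. c \<noteq> 0})"

end

(*
  For c in F_p^* with Teichmueller lift [c], the reduced series satisfy E(cx) = E(x)^[c], so
  they are powers of E with exponents in the (p-1)-st roots of unity of Z_p. These span a
  lattice of rank m = phi(p-1), with basis 1, zeta, ..., zeta^(m-1), because the cyclotomic
  polynomial is irreducible of degree m. Hence the field is generated by m of the series, and it
  remains to see that the powers E^beta, for distinct p-adic integers beta, are linearly
  independent over F_p(x).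

  For this, let D be the Euler operator, so that D E = theta E with theta = sum_n x^(p^n). The
  binomials of D applied to c E^b are polynomials in theta times E^b, and these polynomials
  can also be evaluated at theta + z for an integer z, where they describe the function
  x^(zb) E^b: the conjugates of theta in the Artin-Schreier-Witt tower are the theta + z. An
  algebraic relation holding for theta holds for all theta + z. Projecting a linear relation
  between powers of E onto residue classes of exponents modulo q = p^k gives a linear system
  over this tower. For z = p^(k-l) its terms have distinct valuations modulo q, which is absurd.
*)
theory Submission
  imports Defs "Berlekamp_Zassenhaus.Reconstruction" "HOL-Number_Theory.Residue_Primitive_Roots"
begin

hide_const (open) Module.smult up_ring.monom up_ring.coeff comm_monoid_mult_class.coprime
no_notation vec_index (infixl "$" 100)

section \<open>Rational numbers integral at a prime\<close>

text \<open>The shift from \<open>Th\<close> to \<open>Th + z\<close> cannot be made modulo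
  \<open>p\<close>, where multiples of \<open>p\<close> would be lost. It is made over the
  rationals, on polynomials in \<open>Th\<close> divided by factorials, and only values are reduced.
  So integrality is demanded of the value at every \<open>Th + of_nat z\<close>, not of the
  coefficients, and the objects are functions of the branch \<open>z\<close>, collected in the ring
  \<open>R\<close>. This ring is large enough because the binomial of order \<open>p ^ k - 1\<close>
  is, modulo \<open>p\<close>, the indicator of a residue class modulo \<open>p ^ k\<close>: up to
  the factor \<open>Eb ^ b\<close>, the projections of \<open>c * Eb ^ b\<close> onto residue
  classes of exponents are values of elements of \<open>R\<close>. On the branch \<open>z\<close>
  the exponents of the \<open>b\<close>-th term are displaced by \<open>z * b\<close>. For
  \<open>z = p ^ (k - l)\<close>, exponents \<open>b\<close> that differ modulo \<open>p ^ l\<close>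
  are displaced to different multiples of \<open>z\<close> modulo \<open>p ^ k\<close>, and a large
  \<open>k - l\<close> leaves room below \<open>z\<close> for the subdegrees of the
  coefficients.\<close>

definition p_integral :: "nat \<Rightarrow> rat \<Rightarrow> bool" where
  "p_integral p r \<longleftrightarrow> (\<exists>a b::int. \<not> int p dvd b \<and> r = of_int a / of_int b)"

locale prime_base =
  fixes p :: nat
  assumes prime_p: "prime p"
begin

lemma p_pos: "p > 0" and p_gt_1: "p > 1" and p_ne_0 [simp]: "p \<noteq> 0"
  using prime_gt_0_nat[OF prime_p] prime_gt_1_nat[OF prime_p] by auto

lemma prime_int_p: "prime (int p)"
  using prime_p by simp

abbreviation pint :: "rat \<Rightarrow> bool" where "pint \<equiv> p_integral p"

lemma pintI: "\<not> int p dvd b \<Longrightarrow> r = of_int a / of_int b \<Longrightarrow> pint r"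
  unfolding p_integral_def by blast

lemma pintE:
  assumes "pint r"
  obtains a b :: int where "\<not> int p dvd b" "b \<noteq> 0" "r = of_int a / of_int b"
  using assms unfolding p_integral_def by (metis dvd_0_right)

lemma pint_of_int [simp]: "pint (of_int a)"
  by (rule pintI[of 1 _ a]) (use p_gt_1 in auto)

lemma pint_of_nat [simp]: "pint (of_nat a)"
  using pint_of_int[of "int a"] by simp

lemma pint_0 [simp]: "pint 0" and pint_1 [simp]: "pint 1"
  using pint_of_int[of 0] pint_of_int[of 1] by simp_all

lemma pint_add [intro]:
  assumes "pint r" "pint s" shows "pint (r + s)"
proof -
  from assms obtain a b c d where *: "\<not> int p dvd b" "b \<noteq> 0" "r = of_int a / of_int b"
    "\<not> int p dvd d" "d \<noteq> 0" "s = of_int c / of_int d" by (metis pintE)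
  have "\<not> int p dvd b * d" using * prime_int_p by (simp add: prime_dvd_mult_iff)
  moreover have "r + s = of_int (a * d + c * b) / of_int (b * d)"
    using * by (simp add: field_simps)
  ultimately show ?thesis by (rule pintI)
qed

lemma pint_mult [intro]:
  assumes "pint r" "pint s" shows "pint (r * s)"
proof -
  from assms obtain a b c d where *: "\<not> int p dvd b" "b \<noteq> 0" "r = of_int a / of_int b"
    "\<not> int p dvd d" "d \<noteq> 0" "s = of_int c / of_int d" by (metis pintE)
  have "\<not> int p dvd b * d" using * prime_int_p by (simp add: prime_dvd_mult_iff)
  moreover have "r * s = of_int (a * c) / of_int (b * d)"
    using * by (simp add: field_simps)
  ultimately show ?thesis by (rule pintI)
qed

lemma pint_uminus: "pint r \<Longrightarrow> pint (- r)"
  using pint_mult[of "of_int (-1)" r, OF pint_of_int] by simp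

lemma pint_diff [intro]: "pint r \<Longrightarrow> pint s \<Longrightarrow> pint (r - s)"
  using pint_add[of r "- s"] pint_uminus[of s] by simp

lemma pint_sum [intro]: "(\<And>i. i \<in> A \<Longrightarrow> pint (f i)) \<Longrightarrow> pint (sum f A)"
  by (induction A rule: infinite_finite_induct) auto

lemma pint_div_unit:
  assumes "pint r" "\<not> p dvd u" shows "pint (r / of_nat u)"
proof -
  have "pint (1 / of_nat u)"
    by (rule pintI[of "int u" _ 1]) (use assms in auto)
  from pint_mult[OF assms(1) this] show ?thesis by simp
qed

lemma pint_mult_p:
  assumes "pint (r / of_nat p ^ N)" "M \<le> N" shows "pint (r / of_nat p ^ M)"
proof -
  have "r / of_nat p ^ M = (r / of_nat p ^ N) * of_nat (p ^ (N - M))"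
    using assms(2) by (simp add: field_simps flip: power_add)
  thus ?thesis using assms by (metis pint_mult pint_of_nat)
qed

text \<open>Of the factors in \<open>p ^ Suc N\<close>, at most
  \<open>multiplicity p m \<le> N\<close> are absorbed by \<open>m\<close>, so one is left for
  \<open>r\<close>. This is how divisibility of \<open>n * f $ n\<close> becomes vanishing of
  \<open>f $ n\<close> modulo \<open>p\<close>.\<close>

lemma pint_of_divided:
  assumes "pint (of_nat m * r / of_nat p ^ Suc N)" "\<not> p ^ Suc N dvd m"
  shows "pint (r / of_nat p)"
proof -
  have m: "m \<noteq> 0" using assms(2) by (metis dvd_0_right)
  obtain u where u: "m = p ^ multiplicity p m * u" "\<not> p dvd u"
    using multiplicity_decompose'[of m p] m prime_p by (metis not_prime_unit)
  define v where "v = multiplicity p m"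
  have v: "v \<le> N"
    using assms(2) m by (metis not_less_eq_eq multiplicity_dvd' v_def)
  have "pint (of_nat p ^ v * of_nat u * r / of_nat p ^ Suc N)"
    using assms(1) u(1) v_def by (metis of_nat_mult semiring_1_class.of_nat_power)
  hence "pint (of_nat p ^ v * of_nat u * r / of_nat p ^ Suc N / of_nat u)"
    using u(2) pint_div_unit by blast
  moreover have "of_nat p ^ v * of_nat u * r / of_nat p ^ Suc N / of_nat u
      = r / of_nat p ^ (Suc N - v)"
    using u(1) m v by (auto simp: field_simps power_diff)
  ultimately have "pint (r / of_nat p ^ (Suc N - v))" by simp
  from pint_mult_p[OF this, of 1] v show ?thesis by simp
qed

text \<open>The multiples of \<open>p\<close> up to \<open>p * m + r\<close> contribute
  \<open>p ^ m * fact m\<close>; all other factors are prime to \<open>p\<close>.\<close>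

lemma fact_mult_add:
  assumes "r < p"
  shows "\<exists>u. \<not> p dvd u \<and> fact (p * m + r) = p ^ m * fact m * (u::nat)"
proof -
  have *: "\<exists>u. \<not> p dvd u \<and> fact (p * m + r) = p ^ m * fact m * (u::nat)"
    if "\<exists>u. \<not> p dvd u \<and> fact (p * m) = p ^ m * fact m * (u::nat)" "r < p" for m r
    using that(2)
  proof (induction r)
    case (Suc r)
    then obtain u where u: "\<not> p dvd u" "fact (p * m + r) = p ^ m * fact m * (u::nat)" by auto
    have "\<not> p dvd p * m + Suc r"
      using Suc.prems by (metis dvd_add_right_iff dvd_triv_left nat_dvd_not_less zero_less_Suc)
    hence "\<not> p dvd u * (p * m + Suc r)" using u prime_p by (metis prime_dvd_mult_iff)
    moreover have "fact (p * m + Suc r) = p ^ m * fact m * (u * (p * m + Suc r))"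
      using u by (simp add: algebra_simps)
    ultimately show ?case by blast
  qed (use that(1) in simp)
  have "\<exists>u. \<not> p dvd u \<and> fact (p * m) = p ^ m * fact m * (u::nat)"
  proof (induction m)
    case (Suc m)
    from *[OF Suc, of "p - 1"] p_gt_1 obtain u where
      u: "\<not> p dvd u" "fact (p * m + (p - 1)) = p ^ m * fact m * (u::nat)" by auto
    have eq: "p * Suc m = Suc (p * m + (p - 1))" using p_gt_1 by simp
    have "fact (p * Suc m) = p * Suc m * fact (p * m + (p - 1))"
      by (subst eq, subst fact_Suc, subst eq[symmetric]) simp
    also have "\<dots> = p ^ Suc m * fact (Suc m) * u" by (subst u(2)) (simp add: algebra_simps)
    finally show ?case using u(1) by blast
  qed (use p_gt_1 in auto)
  from *[OF this assms] show ?thesis .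
qed

text \<open>These are the coefficients of \<open>exp (p * X)\<close>. With
  \<open>m = k div p\<close>, splitting the multiples of \<open>p\<close> off \<open>fact k\<close>
  leaves, up to a unit, \<open>p ^ m / fact m\<close> times \<open>p ^ (k - 2 * m)\<close>, and
  \<open>2 * m \<le> k\<close> holds even for \<open>p = 2\<close>.\<close>

lemma pint_power_div_fact:
  assumes "k > 0" shows "pint (of_nat p ^ k / fact k / of_nat p)"
  using assms
proof (induction k rule: less_induct)
  case (less k)
  define m r where "m = k div p" and "r = k mod p"
  have k: "k = p * m + r" "r < p" using p_pos by (auto simp: m_def r_def)
  obtain u where u: "\<not> p dvd u" "fact (p * m + r) = p ^ m * fact m * (u::nat)"
    using fact_mult_add[OF k(2)] by blast
  have fk: "fact k = (of_nat p ^ m * fact m * of_nat u :: rat)"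
    using arg_cong[OF u(2), of "of_nat :: nat \<Rightarrow> rat"] k by simp
  show ?case
  proof (cases "m = 0")
    case True
    have "of_nat p ^ k / fact k / of_nat p = of_nat (p ^ (k - 1)) / (of_nat u :: rat)"
      using fk True less.prems by (cases k) (simp_all add: field_simps)
    thus ?thesis using pint_div_unit[OF pint_of_nat u(1), of "p ^ (k - 1)"] by (simp only:)
  next
    case False
    have "m * 2 \<le> m * p" using p_gt_1 by (intro mult_left_mono) auto
    hence le: "m + m \<le> k" using k(1) by (simp only: mult.commute[of p m])
    hence IH: "pint (of_nat p ^ m / fact m / of_nat p)" using less.IH[of m] False by auto
    have "of_nat p ^ k / fact k / of_nat p =
       (of_nat p ^ m / fact m / of_nat p) * of_nat (p ^ (k - m - m)) / (of_nat u :: rat)"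
    proof -
      have "of_nat p ^ k = of_nat p ^ m * of_nat p ^ m * (of_nat p ^ (k - m - m) :: rat)"
        using le by (simp flip: power_add)
      thus ?thesis unfolding fk by simp
    qed
    thus ?thesis using pint_div_unit[OF pint_mult[OF IH pint_of_nat] u(1)] by (simp only:)
  qed
qed

section \<open>Power series with \<open>p\<close>-integral coefficients\<close>

definition fint :: "rat fps \<Rightarrow> bool" where "fint f \<longleftrightarrow> (\<forall>n. pint (f $ n))"

lemma fintD: "fint f \<Longrightarrow> pint (f $ n)" by (simp add: fint_def)

lemma fint_0 [simp]: "fint 0" and fint_1 [simp]: "fint 1" and fint_X [simp]: "fint fps_X"
  by (auto simp: fint_def fps_X_def)

lemma fint_const: "pint c \<Longrightarrow> fint (fps_const c)"
  by (auto simp: fint_def)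

lemma fint_of_nat [simp]: "fint (of_nat n)"
  using fint_const[of "of_nat n"] by (simp add: fps_of_nat)

lemma fint_add [intro]: "fint f \<Longrightarrow> fint g \<Longrightarrow> fint (f + g)"
  and fint_diff [intro]: "fint f \<Longrightarrow> fint g \<Longrightarrow> fint (f - g)"
  by (auto simp: fint_def)

lemma fint_mult [intro]: "fint f \<Longrightarrow> fint g \<Longrightarrow> fint (f * g)"
  by (auto simp: fint_def fps_mult_nth)

lemma fint_power [intro]: "fint f \<Longrightarrow> fint (f ^ n)"
  by (induction n) auto

lemma fint_inverse:
  assumes "fint f" "f $ 0 = 1" shows "fint (inverse f)"
proof -
  have fi: "f * inverse f = 1" using inverse_mult_eq_1'[of f] assms by simp
  have "pint (inverse f $ n)" for n
  proof (induction n rule: less_induct)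
    case (less n)
    show ?case
    proof (cases "n = 0")
      case True thus ?thesis using assms by simp
    next
      case False
      have "0 = (f * inverse f) $ n" using fi False by simp
      also have "\<dots> = f $ 0 * inverse f $ n + (\<Sum>i=1..n. f $ i * inverse f $ (n - i))"
        by (simp add: fps_mult_nth sum.atLeast_Suc_atMost)
      finally have "inverse f $ n = - (\<Sum>i=1..n. f $ i * inverse f $ (n - i))"
        using assms by simp
      moreover have "pint (\<Sum>i=1..n. f $ i * inverse f $ (n - i))"
        using False by (intro pint_sum pint_mult less fintD[OF assms(1)]) auto
      ultimately show ?thesis using pint_uminus by simp
    qed
  qed
  thus ?thesis by (simp add: fint_def)
qed

end

section \<open>Reduction modulo the prime\<close>

text \<open>Meaningful only on \<open>p\<close>-integral series, as \<open>reduce_rat\<close> is a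
  homomorphism only there; hence the integrality hypotheses of the rules below.\<close>

definition red_fps :: "rat fps \<Rightarrow> 'k::field fps" where
  "red_fps f = Abs_fps (\<lambda>n. reduce_rat (f $ n))"

lemma red_fps_nth [simp]: "red_fps f $ n = reduce_rat (f $ n)"
  by (simp add: red_fps_def)

text \<open>Elements of the prime field are fixed by the \<open>p\<close>-th power, so
  \<open>f ^ p\<close> is \<open>f\<close> at \<open>X ^ p\<close>. Additivity of Frobenius covers
  finite sums only, hence the truncation \<open>t\<close> and a tail that cannot reach the
  coefficient \<open>n\<close>.\<close>

lemma frobenius_fps:
  fixes f :: "'p::prime_card mod_ring fps"
  shows "(f ^ CARD('p)) $ n = (if CARD('p) dvd n then f $ (n div CARD('p)) else 0)"
proof -
  define q where "q = CARD('p)"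
  have q: "prime CHAR('p mod_ring fps)" "q = CHAR('p mod_ring fps)"
    using prime_card[where 'a='p] by (simp_all add: q_def)
  have q0: "q > 0" using q by (simp add: prime_gt_0_nat)
  define t where "t = (\<Sum>i\<le>n. fps_const (f $ i) * fps_X ^ i)"
  define s where "s = fps_shift (Suc n) f"
  have "t $ i = (if i \<le> n then f $ i else 0)" for i
    by (auto simp: t_def fps_sum_nth fps_X_power_iff if_distrib cong: if_cong)
  hence f: "f = t + s * fps_X ^ Suc n"
    by (intro fps_ext, simp only: fps_add_nth fps_X_power_mult_right_nth) (auto simp: s_def)
  have fq: "f ^ q = t ^ q + (s * fps_X ^ Suc n) ^ q"
    unfolding f by (rule freshmans_dream[OF q])
  have sq: "((s * fps_X ^ Suc n) ^ q) $ n = 0"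
  proof -
    have "(s * fps_X ^ Suc n) ^ q = s ^ q * fps_X ^ (Suc n * q)"
      by (simp only: power_mult_distrib power_mult)
    moreover have "Suc n * 1 \<le> Suc n * q" using q0 by (intro mult_left_mono) auto
    hence "n < Suc n * q" unfolding mult_1_right by (rule less_le_trans[rotated]) simp
    ultimately show ?thesis by (simp only: fps_X_power_mult_right_nth if_True)
  qed
  have tq: "t ^ q = (\<Sum>i\<le>n. (fps_const (f $ i) * fps_X ^ i) ^ q)"
    unfolding t_def by (rule freshmans_dream_sum[OF q])
  have mq: "((fps_const (f $ i) * fps_X ^ i) ^ q) $ n = (if i * q = n then f $ i else 0)" for i
  proof -
    have "(f $ i) ^ q = f $ i"
      using finite_field_power_card_eq_same[of "f $ i"] by (simp add: q_def)
    hence eq: "(fps_const (f $ i) * fps_X ^ i) ^ q = fps_const (f $ i) * fps_X ^ (i * q)"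
      by (simp only: power_mult_distrib power_mult fps_const_power)
    show ?thesis unfolding eq by auto
  qed
  have "(f ^ q) $ n = (\<Sum>i\<le>n. if i * q = n then f $ i else 0)"
    by (simp only: fq fps_add_nth sq tq fps_sum_nth mq add_0_right)
  also have "\<dots> = (if q dvd n then f $ (n div q) else 0)"
  proof (cases "q dvd n")
    case True
    then obtain j where j: "n = j * q" by (metis dvd_div_mult_self)
    have "(\<Sum>i\<le>n. if i * q = n then f $ i else 0) = (\<Sum>i\<le>n. if i = j then f $ i else 0)"
      using j q0 by (intro sum.cong) auto
    also have "\<dots> = f $ j" using j q0 by simp
    finally show ?thesis using j q0 by simp
  next
    case False
    hence "\<And>i. i * q \<noteq> n" by auto
    thus ?thesis using False by simp
  qed
  finally show ?thesis unfolding q_def .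
qed

locale char_p_base = prime_base p for p :: nat +
  fixes ty :: "'p::prime_card itself"
  assumes card_p: "CARD('p) = p"
begin

lemma of_int_eq_0_iff_p: "(of_int b :: 'p mod_ring) = 0 \<longleftrightarrow> int p dvd b"
  using of_int_eq_0_iff_char_dvd[where 'a = "'p mod_ring", of b] card_p by simp

abbreviation rd :: "rat \<Rightarrow> 'p mod_ring" where "rd \<equiv> reduce_rat"
abbreviation red :: "rat fps \<Rightarrow> 'p mod_ring fps" where "red \<equiv> red_fps"

lemma rd_divide: "\<not> int p dvd b \<Longrightarrow> rd (of_int a / of_int b) = of_int a / of_int b"
  by (rule reduce_rat_divide) (simp add: of_int_eq_0_iff_p)

lemma rd_add:
  assumes "pint r" "pint s" shows "rd (r + s) = rd r + rd s"
proof -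
  from assms obtain a b c d where *: "\<not> int p dvd b" "b \<noteq> 0" "r = of_int a / of_int b"
    "\<not> int p dvd d" "d \<noteq> 0" "s = of_int c / of_int d" by (metis pintE)
  have nd: "\<not> int p dvd b * d" using * prime_int_p by (simp add: prime_dvd_mult_iff)
  have "r + s = of_int (a * d + c * b) / of_int (b * d)"
    using * by (simp add: field_simps)
  hence "rd (r + s) = of_int (a * d + c * b) / of_int (b * d)" by (simp only: rd_divide[OF nd])
  moreover have "rd r = of_int a / of_int b" "rd s = of_int c / of_int d"
    unfolding *(3,6) by (rule rd_divide, fact)+
  moreover have "(of_int b :: 'p mod_ring) \<noteq> 0" "(of_int d :: 'p mod_ring) \<noteq> 0"
    using *(1,4) of_int_eq_0_iff_p by auto
  ultimately show ?thesis by (simp add: add_frac_eq)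
qed

lemma rd_mult:
  assumes "pint r" "pint s" shows "rd (r * s) = rd r * rd s"
proof -
  from assms obtain a b c d where *: "\<not> int p dvd b" "b \<noteq> 0" "r = of_int a / of_int b"
    "\<not> int p dvd d" "d \<noteq> 0" "s = of_int c / of_int d" by (metis pintE)
  have nd: "\<not> int p dvd b * d" using * prime_int_p by (simp add: prime_dvd_mult_iff)
  have "r * s = of_int (a * c) / of_int (b * d)"
    using * by (simp add: field_simps)
  hence "rd (r * s) = of_int (a * c) / of_int (b * d)" by (simp only: rd_divide[OF nd])
  moreover have "rd r = of_int a / of_int b" "rd s = of_int c / of_int d"
    unfolding *(3,6) by (rule rd_divide, fact)+
  ultimately show ?thesis by simp
qed

lemma rd_of_int [simp]: "rd (of_int a) = of_int a"
  using rd_divide[of 1 a] p_gt_1 by simp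

lemma rd_of_nat [simp]: "rd (of_nat a) = of_nat a"
  using rd_of_int[of "int a"] by simp

lemma rd_0 [simp]: "rd 0 = 0" and rd_1 [simp]: "rd 1 = 1"
  using rd_of_int[of 0] rd_of_int[of 1] by simp_all

lemma rd_uminus:
  assumes "pint r" shows "rd (- r) = - rd r"
proof -
  have "rd (of_int (-1) * r) = of_int (-1) * rd r"
    unfolding rd_mult[OF pint_of_int assms] rd_of_int ..
  thus ?thesis by simp
qed

lemma rd_diff:
  assumes "pint r" "pint s" shows "rd (r - s) = rd r - rd s"
proof -
  have "rd (r + - s) = rd r + - rd s"
    by (simp only: rd_add[OF assms(1) pint_uminus[OF assms(2)]] rd_uminus[OF assms(2)])
  thus ?thesis by simp
qed

lemma rd_sum: "(\<And>i. i \<in> A \<Longrightarrow> pint (f i)) \<Longrightarrow> rd (sum f A) = (\<Sum>i\<in>A. rd (f i))"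
proof (induction A rule: infinite_finite_induct)
  case (insert x A)
  thus ?case by (simp add: rd_add pint_sum)
qed auto

lemma rd_eq_0_iff:
  assumes "pint r" shows "rd r = 0 \<longleftrightarrow> pint (r / of_nat p)"
proof
  assume r: "rd r = 0"
  from assms obtain a b where *: "\<not> int p dvd b" "b \<noteq> 0" "r = of_int a / of_int b" by (metis pintE)
  have "int p dvd a" using r rd_divide[OF *(1), of a] * by (simp add: of_int_eq_0_iff_p)
  then obtain k where "a = int p * k" by blast
  hence "r / of_nat p = of_int k / of_int b" using * by simp
  thus "pint (r / of_nat p)" using *(1) by (auto intro: pintI)
next
  assume "pint (r / of_nat p)"
  hence "rd (of_nat p * (r / of_nat p)) = rd (of_nat p) * rd (r / of_nat p)"
    by (rule rd_mult[OF pint_of_nat])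
  moreover have "rd (of_nat p) = 0"
    unfolding rd_of_nat using of_int_eq_0_iff_p[of "int p"] by simp
  ultimately show "rd r = 0" by simp
qed

lemma red_0 [simp]: "red 0 = 0" and red_1 [simp]: "red 1 = 1" and red_X [simp]: "red fps_X = fps_X"
  by (auto simp: fps_eq_iff fps_X_def)

lemma red_const: "red (fps_const c) = fps_const (rd c)"
  by (auto simp: fps_eq_iff)

lemma red_of_nat [simp]: "red (of_nat n) = of_nat n"
  using red_const[of "of_nat n"] by (simp add: fps_of_nat)

lemma red_add: "fint f \<Longrightarrow> fint g \<Longrightarrow> red (f + g) = red f + red g"
  and red_diff: "fint f \<Longrightarrow> fint g \<Longrightarrow> red (f - g) = red f - red g"
  by (auto simp: fps_eq_iff rd_add rd_diff fint_def)

lemma red_mult: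
  assumes "fint f" "fint g" shows "red (f * g) = red f * red g"
proof (rule fps_ext)
  fix n
  have "rd (\<Sum>i=0..n. f $ i * g $ (n - i)) = (\<Sum>i=0..n. rd (f $ i * g $ (n - i)))"
    by (intro rd_sum pint_mult fintD assms)
  also have "\<dots> = (\<Sum>i=0..n. rd (f $ i) * rd (g $ (n - i)))"
    by (intro sum.cong refl rd_mult fintD assms)
  finally show "red (f * g) $ n = (red f * red g) $ n" by (simp add: fps_mult_nth)
qed

lemma red_power: "fint f \<Longrightarrow> red (f ^ n) = red f ^ n"
  by (induction n) (auto simp: red_mult fint_power)

lemma of_nat_p_fps: "(of_nat p :: 'p mod_ring fps) = 0"
  using of_nat_CHAR[where 'a = "'p mod_ring fps"] card_p by simp

lemma red_p_mult: "fint f \<Longrightarrow> red (of_nat p * f) = 0"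
  using red_mult[OF fint_of_nat, of f p] by (simp only: red_of_nat of_nat_p_fps mult_zero_left)

lemma frob_p: "((f :: 'p mod_ring fps) ^ p) $ n = (if p dvd n then f $ (n div p) else 0)"
  using frobenius_fps[of f n] card_p by simp

lemma frob_p_power:
  "((f :: 'p mod_ring fps) ^ (p ^ k)) $ n = (if p ^ k dvd n then f $ (n div p ^ k) else 0)"
proof (induction k arbitrary: n)
  case (Suc k)
  have "f ^ (p ^ Suc k) = (f ^ (p ^ k)) ^ p"
    by (simp only: power_mult[symmetric] power_Suc mult.commute)
  hence "(f ^ (p ^ Suc k)) $ n = (if p dvd n then (f ^ (p ^ k)) $ (n div p) else 0)"
    by (simp only: frob_p)
  also have "\<dots> = (if p ^ Suc k dvd n then f $ (n div p ^ Suc k) else 0)"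
  proof (cases "p dvd n")
    case True
    then obtain m where n: "n = p * m" by blast
    have "n div p = m" "n div p ^ Suc k = m div p ^ k" "p ^ Suc k dvd n \<longleftrightarrow> p ^ k dvd m"
      using p_pos by (simp_all add: n)
    thus ?thesis using True by (simp only: Suc if_True)
  next
    case False
    hence "\<not> p ^ Suc k dvd n" by (metis dvd_mult_left power_Suc)
    thus ?thesis using False by (simp only: if_False)
  qed
  finally show ?case .
qed simp

end

section \<open>The Artin--Hasse exponential\<close>

lemma fps_XD_mult: "fps_XD (f * g) = fps_XD f * g + f * fps_XD (g :: rat fps)"
  by (simp add: fps_XD_def algebra_simps)

lemma fps_XD_power_eq:
  assumes "fps_XD f = a * (f :: rat fps)"
  shows "fps_XD (f ^ n) = of_nat n * a * f ^ n"
proof (induction n)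
  case 0 show ?case by (simp add: fps_XD_def)
next
  case (Suc n)
  have "fps_XD (f ^ Suc n) = fps_XD f * f ^ n + f * fps_XD (f ^ n)"
    by (simp only: power_Suc fps_XD_mult)
  also have "\<dots> = of_nat (Suc n) * a * f ^ Suc n"
    unfolding assms Suc of_nat_Suc power_Suc by (simp only: algebra_simps mult_1_left)
  finally show ?case .
qed

lemma fps_XD_inverse_eq:
  assumes "fps_XD f = a * (f :: rat fps)" "f $ 0 = 1"
  shows "fps_XD (inverse f) = - a * inverse f"
proof -
  have f: "f * inverse f = 1" by (rule inverse_mult_eq_1') (simp add: assms)
  have "fps_XD (f * inverse f) = 0" unfolding f by (simp add: fps_XD_def)
  hence 0: "a * f * inverse f + f * fps_XD (inverse f) = 0" by (simp only: fps_XD_mult assms(1))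
  have "fps_XD (inverse f) = inverse f * (f * fps_XD (inverse f))"
    using f by (simp only: mult.assoc[symmetric] mult.commute[of "inverse f" f] mult_1_left)
  also have "f * fps_XD (inverse f) = - (a * (f * inverse f))"
    using 0 by (simp only: mult.assoc eq_neg_iff_add_eq_0 add.commute)
  also have "\<dots> = - a" by (simp only: f mult_1_right)
  finally show ?thesis by (simp only: mult.commute)
qed

section \<open>The substitutions of \<open>c * X\<close> and of \<open>X ^ p\<close> for
  \<open>X\<close>\<close>

definition dilate :: "'a::comm_ring_1 \<Rightarrow> 'a fps \<Rightarrow> 'a fps" where
  "dilate c f = Abs_fps (\<lambda>n. c ^ n * f $ n)"

lemma dilate_nth [simp]: "dilate c f $ n = c ^ n * f $ n"
  by (simp add: dilate_def)

lemma dilate_eq_compose: "fps_compose f (fps_const c * fps_X) = dilate c f"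
  unfolding dilate_def by (rule fps_compose_linear)

lemma dilate_mult: "dilate c (f * g) = dilate c f * dilate c g"
proof (rule fps_ext)
  fix n
  have "c ^ n * (f $ i * g $ (n - i)) = c ^ i * f $ i * (c ^ (n - i) * g $ (n - i))" if "i \<le> n" for i
  proof -
    have "c ^ n = c ^ i * c ^ (n - i)" using that by (simp flip: power_add)
    thus ?thesis by simp
  qed
  thus "dilate c (f * g) $ n = (dilate c f * dilate c g) $ n"
    by (simp add: fps_mult_nth sum_distrib_left)
qed

lemma fps_XD_dilate: "fps_XD (dilate c f) = dilate c (fps_XD f)"
  by (rule fps_ext) simp

definition frob_subst :: "nat \<Rightarrow> 'a::comm_ring_1 fps \<Rightarrow> 'a fps" where
  "frob_subst p f = Abs_fps (\<lambda>n. if p dvd n then f $ (n div p) else 0)"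

lemma frob_subst_nth [simp]: "frob_subst p f $ n = (if p dvd n then f $ (n div p) else 0)"
  by (simp add: frob_subst_def)

lemma frob_subst_mult:
  assumes p: "p > 0" shows "frob_subst p (f * g) = frob_subst p f * frob_subst p g"
proof (rule fps_ext)
  fix n
  define h where "h = (\<lambda>i. frob_subst p f $ i * frob_subst p g $ (n - i))"
  show "frob_subst p (f * g) $ n = (frob_subst p f * frob_subst p g) $ n"
  proof (cases "p dvd n")
    case True
    then obtain m where n: "n = p * m" by blast
    have "(\<Sum>i=0..n. h i) = (\<Sum>i\<in>(\<lambda>j. p * j) ` {0..m}. h i)"
    proof (rule sum.mono_neutral_right)
      show "(\<lambda>j. p * j) ` {0..m} \<subseteq> {0..n}" using p by (auto simp: n)
      show "\<forall>i\<in>{0..n} - (\<lambda>j. p * j) ` {0..m}. h i = 0"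
      proof
        fix i assume i: "i \<in> {0..n} - (\<lambda>j. p * j) ` {0..m}"
        have "\<not> p dvd i"
        proof
          assume "p dvd i"
          then obtain j where "i = p * j" by blast
          with i p show False by (auto simp: n)
        qed
        thus "h i = 0" by (simp add: h_def)
      qed
    qed auto
    also have "\<dots> = (\<Sum>j=0..m. h (p * j))"
      using p by (subst sum.reindex) (auto simp: inj_on_def)
    also have "\<dots> = (\<Sum>j=0..m. f $ j * g $ (m - j))"
    proof (rule sum.cong)
      fix j assume "j \<in> {0..m}"
      have "n - p * j = p * (m - j)" by (simp add: n diff_mult_distrib2)
      thus "h (p * j) = f $ j * g $ (m - j)" using p by (simp add: h_def)
    qed simp
    finally show ?thesis using p by (simp add: fps_mult_nth h_def n)
  next
    case False
    have "h i = 0" if "i \<in> {0..n}" for i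
    proof -
      have "\<not> p dvd i \<or> \<not> p dvd n - i" using False that by (metis atLeastAtMost_iff dvd_diffD)
      thus ?thesis by (auto simp: h_def)
    qed
    hence "(\<Sum>i=0..n. h i) = 0" by simp
    thus ?thesis using False by (simp add: fps_mult_nth h_def)
  qed
qed

lemma fps_XD_frob_subst:
  "fps_XD (frob_subst p f) = of_nat p * frob_subst p (fps_XD (f :: rat fps))"
proof (rule fps_ext)
  fix n
  have "(of_nat p * frob_subst p (fps_XD f)) $ n = of_nat p * frob_subst p (fps_XD f) $ n"
    by (simp flip: fps_of_nat)
  also have "\<dots> = fps_XD (frob_subst p f) $ n"
    by (auto elim!: dvdE simp flip: of_nat_mult)
  finally show "fps_XD (frob_subst p f) $ n = (of_nat p * frob_subst p (fps_XD f)) $ n" ..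
qed

definition theta_series :: "nat \<Rightarrow> 'a::zero_neq_one fps" where
  "theta_series p = Abs_fps (\<lambda>k. if \<exists>n. k = p ^ n then 1 else 0)"

lemma theta_series_nth: "theta_series p $ k = (if \<exists>n. k = p ^ n then 1 else 0)"
  by (simp add: theta_series_def)

lemma artin_hasse_0 [simp]: "artin_hasse p $ 0 = 1"
  by (simp add: artin_hasse_def)

text \<open>\<open>x ^ p - y ^ p\<close> is \<open>x - y\<close> times a sum of \<open>p\<close>
  terms, each congruent to \<open>y ^ (p - 1)\<close> modulo \<open>p\<close>; that sum supplies the
  extra factor \<open>p\<close>.\<close>

lemma cong_prime_power_lift:
  fixes x y :: int
  assumes "[x = y] (mod int p ^ Suc k)"
  shows "[x ^ p = y ^ p] (mod int p ^ Suc (Suc k))"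
proof -
  have xy: "[x = y] (mod int p)" using assms by (metis cong_dvd_modulus dvd_triv_left power_Suc)
  have "[(\<Sum>i<p. y ^ (p - Suc i) * x ^ i) = (\<Sum>i<p. y ^ (p - Suc i) * y ^ i)] (mod int p)"
    by (intro cong_sum cong_mult cong_pow cong_refl xy)
  also have "(\<Sum>i<p. y ^ (p - Suc i) * y ^ i) = (\<Sum>i<p. y ^ (p - 1))"
    by (intro sum.cong refl) (auto simp flip: power_add)
  also have "\<dots> = int p * y ^ (p - 1)" by simp
  also have "[int p * y ^ (p - 1) = 0] (mod int p)" by (simp add: cong_0_iff)
  finally have "int p dvd (\<Sum>i<p. y ^ (p - Suc i) * x ^ i)" by (simp add: cong_0_iff)
  moreover have "int p ^ Suc k dvd x - y" using assms by (simp add: cong_iff_dvd_diff)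
  ultimately have "int p ^ Suc k * int p dvd x ^ p - y ^ p"
    unfolding power_diff_sumr2 by (rule mult_dvd_mono[rotated])
  thus ?thesis by (simp add: cong_iff_dvd_diff mult.commute)
qed

context prime_base
begin

abbreviation Th :: "rat fps" where "Th \<equiv> theta_series p"
abbreviation E :: "rat fps" where "E \<equiv> artin_hasse p"

lemma theta_0 [simp]: "theta_series p $ 0 = 0"
  by (auto simp: theta_series_nth)

lemma fint_Th: "fint Th"
  by (auto simp: fint_def theta_series_nth)

lemma XD_E: "fps_XD E = Th * E"
proof -
  define L :: "rat fps" where "L = Abs_fps (\<lambda>k. if \<exists>n. k = p ^ n then 1 / of_nat k else 0)"
  have L0: "L $ 0 = 0" by (auto simp: L_def)
  have E: "E = fps_exp 1 oo L" by (simp add: artin_hasse_def L_def)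
  have XL: "fps_X * fps_deriv L = Th"
  proof -
    have "fps_XD L $ n = Th $ n" for n
      by (auto simp: L_def theta_series_nth)
    thus ?thesis by (auto simp: fps_eq_iff fps_XD_def)
  qed
  have "fps_deriv E = E * fps_deriv L"
    unfolding E fps_compose_deriv[OF L0] by simp
  hence "fps_XD E = E * (fps_X * fps_deriv L)"
    by (simp only: fps_XD_def o_apply mult.left_commute)
  thus ?thesis unfolding XL by (simp only: mult.commute)
qed

lemma frob_Th: "frob_subst p Th = Th - fps_X"
proof (rule fps_ext)
  fix n
  have "frob_subst p Th $ n = (if \<exists>k. n = p ^ Suc k then 1 else 0)"
  proof (cases "p dvd n")
    case True
    then obtain j where j: "n = p * j" by blast
    have "(\<exists>k. n = p ^ Suc k) \<longleftrightarrow> (\<exists>k. j = p ^ k)" using p_pos by (simp add: j)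
    thus ?thesis using p_pos by (simp add: j theta_series_nth)
  next
    case False
    hence "\<not> (\<exists>k. n = p ^ Suc k)" by (metis dvd_triv_left power_Suc)
    thus ?thesis using False by simp
  qed
  also have "\<dots> = (Th - fps_X) $ n"
  proof (cases "n = 1")
    case True
    have "\<not> (\<exists>k. n = p ^ Suc k)" using True p_gt_1 by auto
    moreover have "\<exists>k. n = p ^ k" using True by (intro exI[of _ 0]) simp
    ultimately show ?thesis using True by (simp add: theta_series_nth)
  next
    case False
    have "(\<exists>k. n = p ^ Suc k) \<longleftrightarrow> (\<exists>k. n = p ^ k)"
    proof
      assume "\<exists>k. n = p ^ k"
      then obtain k where "n = p ^ k" by blast
      with False show "\<exists>k. n = p ^ Suc k" by (cases k) auto
    qed blast
    thus ?thesis using False by (simp add: theta_series_nth fps_X_def)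
  qed
  finally show "frob_subst p Th $ n = (Th - fps_X) $ n" .
qed

text \<open>\<open>G\<close> is \<open>exp (p * X)\<close>: by \<open>frob_Th\<close>, the
  logarithmic Euler derivatives of \<open>E ^ p\<close> and of \<open>E\<close> at
  \<open>X ^ p\<close> differ by \<open>p * X\<close>. Integrality of \<open>E\<close> is deduced
  from this functional equation in the manner of Dwork.\<close>

lemma E_power_eq:
  obtains G where "E ^ p = frob_subst p E * G" "G $ 0 = 1" "\<And>n. n > 0 \<Longrightarrow> pint (G $ n / of_nat p)"
proof -
  define F where "F = frob_subst p E"
  have F0: "F $ 0 = 1" by (simp add: F_def)
  have XF: "fps_XD F = (of_nat p * (Th - fps_X)) * F"
    unfolding F_def fps_XD_frob_subst XD_E frob_subst_mult[OF p_pos] frob_Th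
    by (simp only: mult.assoc)
  define G where "G = E ^ p * inverse F"
  have XG: "fps_XD G = (of_nat p * fps_X) * G"
    unfolding G_def fps_XD_mult fps_XD_power_eq[OF XD_E] fps_XD_inverse_eq[OF XF F0]
    by (simp only: algebra_simps minus_diff_eq)
  have G0: "G $ 0 = 1" by (simp add: G_def F0 fps_nth_power_0)
  have "G $ n = of_nat p ^ n / fact n" for n
  proof (induction n)
    case (Suc n)
    have "of_nat (Suc n) * G $ Suc n = fps_XD G $ Suc n" by simp
    also have "\<dots> = (fps_const (of_nat p) * (fps_X * G)) $ Suc n"
      unfolding XG by (simp only: fps_of_nat mult.assoc)
    also have "\<dots> = of_nat p * G $ n" by simp
    finally have "G $ Suc n = of_nat p * G $ n / of_nat (Suc n)"
      by (simp add: field_simps del: of_nat_Suc)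
    thus ?case unfolding Suc by (simp add: field_simps)
  qed (simp add: G0)
  hence "pint (G $ n / of_nat p)" if "n > 0" for n
    using pint_power_div_fact[OF that] by simp
  moreover
  have "F * inverse F = 1" by (rule inverse_mult_eq_1') (simp add: F0)
  have "F * G = E ^ p * (F * inverse F)" by (simp only: G_def mult_ac)
  hence "E ^ p = F * G" unfolding \<open>F * inverse F = 1\<close> by (simp only: mult_1_right)
  ultimately show ?thesis using that G0 F_def by blast
qed

end

context char_p_base
begin

text \<open>The coefficient \<open>n\<close> of \<open>E ^ p\<close> is computed twice. Expansion
  around the truncation \<open>t\<close> isolates \<open>p * E $ n\<close>; the functional equation
  gives \<open>e\<close> plus \<open>p\<close> times something integral by induction. By Frobenius,
  \<open>t ^ p\<close> has the coefficient \<open>e\<close> modulo \<open>p\<close>, so everything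
  can be divided by \<open>p\<close>.\<close>

lemma fint_E: "fint E"
proof -
  obtain G where G: "E ^ p = frob_subst p E * G" "G $ 0 = 1" "\<And>n. n > 0 \<Longrightarrow> pint (G $ n / of_nat p)"
    using E_power_eq by blast
  have "pint (E $ n)" for n
  proof (induction n rule: less_induct)
    case (less n)
    show ?case
    proof (cases "n = 0")
      case False
      define t where "t = fps_cutoff n E"
      have ft: "fint t" using less by (auto simp: fint_def t_def)
      define R where "R = (\<Sum>i<p. t ^ (p - Suc i) * E ^ i)"
      have R0: "R $ 0 = of_nat p"
        using False by (simp add: R_def fps_sum_nth t_def fps_nth_power_0)
      have "E - t = fps_X ^ n * fps_shift n E"
        by (rule fps_ext) (simp add: t_def fps_X_power_mult_nth)
      hence "E ^ p - t ^ p = fps_X ^ n * (fps_shift n E * R)"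
        unfolding power_diff_sumr2[of E p t] R_def by (simp only: mult.assoc)
      hence "(E ^ p - t ^ p) $ n = (fps_X ^ n * (fps_shift n E * R)) $ n" by (simp only:)
      also have "\<dots> = E $ n * of_nat p"
        by (simp add: fps_X_power_mult_nth R0)
      finally have 1: "(E ^ p) $ n = (t ^ p) $ n + of_nat p * E $ n"
        by (simp add: algebra_simps)
      \<comment> \<open>The coefficient \<open>n\<close> of \<open>E\<close> at
        \<open>X ^ p\<close>; it involves only the earlier index \<open>n div p\<close>.\<close>
      define e where "e = (if p dvd n then E $ (n div p) else 0)"
      have lt: "p dvd n \<Longrightarrow> n div p < n" using False p_gt_1 by simp
      have pe: "pint e" using less lt by (auto simp: e_def)
      have "rd ((t ^ p) $ n) = (red t ^ p) $ n"
        using red_power[OF ft, of p] by (metis red_fps_nth)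
      also have "\<dots> = rd e" using lt by (auto simp: frob_p t_def e_def)
      finally have "rd ((t ^ p) $ n - e) = 0"
        using rd_diff[OF fintD[OF fint_power[OF ft]] pe] by simp
      hence 2: "pint (((t ^ p) $ n - e) / of_nat p)"
        using rd_eq_0_iff pint_diff[OF fintD[OF fint_power[OF ft]] pe] by blast
      have "(E ^ p) $ n = (\<Sum>i=0..n. frob_subst p E $ i * G $ (n - i))"
        unfolding G(1) fps_mult_nth ..
      also have "\<dots> = e + (\<Sum>i=0..<n. frob_subst p E $ i * G $ (n - i))"
        by (simp add: e_def G(2) atLeast0AtMost lessThan_Suc_atMost[symmetric] atLeast0LessThan)
      finally have 3: "(E ^ p) $ n = e + (\<Sum>i=0..<n. frob_subst p E $ i * G $ (n - i))" .
      have 4: "pint (\<Sum>i=0..<n. frob_subst p E $ i * (G $ (n - i) / of_nat p))"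
      proof (intro pint_sum pint_mult G(3))
        fix i assume i: "i \<in> {0..<n}"
        hence "i div p < n" using le_less_trans[OF div_le_dividend[of i p]] by auto
        thus "pint (frob_subst p E $ i)" using less by simp
      qed auto
      have "E $ n = (\<Sum>i=0..<n. frob_subst p E $ i * (G $ (n - i) / of_nat p))
           - ((t ^ p) $ n - e) / of_nat p"
        using 1 3 by (simp add: field_simps flip: sum_divide_distrib)
      thus ?thesis using pint_diff[OF 4 2] by simp
    qed simp
  qed
  thus ?thesis by (simp add: fint_def)
qed

definition Eb :: "'p mod_ring fps" where "Eb = red E"

lemma Eb_eq: "Eb = artin_hasse_bar p"
  by (simp add: Eb_def red_fps_def artin_hasse_bar_def)

lemma Eb_0 [simp]: "Eb $ 0 = 1"
  by (simp add: Eb_def)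

lemma fint_dilate:
  assumes "fint f" shows "fint (dilate (of_nat a) f)"
  unfolding fint_def dilate_nth semiring_1_class.of_nat_power[symmetric]
  by (intro allI pint_mult pint_of_nat fintD[OF assms])

lemma red_dilate:
  assumes "fint f" shows "red (dilate (of_nat a) f) = dilate (of_nat a) (red f)"
  by (rule fps_ext)
     (simp only: red_fps_nth dilate_nth semiring_1_class.of_nat_power[symmetric]
        rd_mult[OF pint_of_nat fintD[OF assms]] rd_of_nat)

lemma power_p_power [simp]: "(x :: 'p mod_ring) ^ (p ^ N) = x"
  using finite_field_power_card_power_eq_same[of "p ^ N" N x] card_p by simp

text \<open>\<open>a\<close> agrees with the Teichmueller lift of \<open>c\<close> modulo
  \<open>p ^ Suc N\<close>. The quotient \<open>f\<close> of \<open>E\<close> at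
  \<open>a * X\<close> by \<open>E ^ a\<close> has a logarithmic Euler derivative \<open>D\<close>
  with coefficients \<open>a ^ (p ^ j) - a\<close>, all divisible by \<open>p ^ Suc N\<close>. Hence
  so is \<open>n * f $ n\<close>, and \<open>f\<close> reduces to a series in
  \<open>X ^ (p ^ Suc N)\<close>.\<close>

lemma dilated_Eb:
  fixes c N :: nat
  defines "a \<equiv> c ^ (p ^ N)"
  obtains h where "dilate (of_nat c) Eb = Eb ^ a * h" "\<And>n. \<not> p ^ Suc N dvd n \<Longrightarrow> h $ n = 0"
proof -
  \<comment> \<open>Each further \<open>p\<close>-th power improves the congruence between
    \<open>c ^ p\<close> and \<open>c\<close> by one factor \<open>p\<close>.\<close>
  have cong1: "[int a ^ p = int a] (mod int p ^ Suc N)"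
  proof -
    have "[(int c ^ p) ^ (p ^ M) = int c ^ (p ^ M)] (mod int p ^ Suc M)" for M
    proof (induction M)
      case 0
      have "(of_int (int c ^ p) :: 'p mod_ring) = of_int (int c)"
        using power_p_power[of "of_int (int c)" 1] by simp
      hence "(of_int (int c ^ p - int c) :: 'p mod_ring) = 0"
        unfolding of_int_diff by (simp only: diff_self)
      hence "int p dvd int c ^ p - int c" unfolding of_int_eq_0_iff_p .
      thus ?case by (simp add: cong_iff_dvd_diff)
    next
      case (Suc M)
      from cong_prime_power_lift[OF this] show ?case
        unfolding power_Suc2[of p M] power_mult .
    qed
    from this[of N] show ?thesis
      unfolding a_def semiring_1_class.of_nat_power power_mult[symmetric] by (simp only: mult.commute)
  qed
  have cong2: "[int a ^ (p ^ j) = int a] (mod int p ^ Suc N)" for j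
  proof (induction j)
    case (Suc j)
    have "[(int a ^ (p ^ j)) ^ p = int a ^ p] (mod int p ^ Suc N)"
      by (rule cong_pow[OF Suc])
    also note cong1
    finally show ?case unfolding power_Suc2[of p j] power_mult .
  qed simp
  define f where "f = dilate (of_nat a) E * inverse (E ^ a)"
  have ff: "fint f" unfolding f_def
    by (intro fint_mult fint_dilate fint_inverse fint_power fint_E) (simp add: fps_nth_power_0)
  define D where "D = dilate (of_nat a) Th - of_nat a * Th"
  have XF: "fps_XD f = D * f"
  proof -
    have 1: "fps_XD (dilate (of_nat a) E) = dilate (of_nat a) Th * dilate (of_nat a) E"
      unfolding fps_XD_dilate XD_E by (rule dilate_mult)
    have 2: "fps_XD (inverse (E ^ a)) = - (of_nat a * Th) * inverse (E ^ a)"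
      by (rule fps_XD_inverse_eq[OF fps_XD_power_eq[OF XD_E]]) (simp add: fps_nth_power_0)
    have 3: "T * A * B + A * (- U * B) = (T - U) * (A * B)" for T U A B :: "rat fps"
      by (simp add: algebra_simps)
    show ?thesis unfolding f_def fps_XD_mult 1 2 D_def by (rule 3)
  qed
  have D: "pint (D $ n / of_nat p ^ Suc N)" for n
  proof (cases "\<exists>j. n = p ^ j")
    case False
    hence "Th $ n = 0" by (simp add: theta_series_nth)
    thus ?thesis by (simp add: D_def flip: fps_of_nat)
  next
    case True
    then obtain j where j: "n = p ^ j" by blast
    have "Th $ n = 1" using True by (simp add: theta_series_nth)
    hence Dn: "D $ n = of_int (int a ^ (p ^ j) - int a)"
      by (simp add: D_def j flip: fps_of_nat)
    obtain t where "int a ^ (p ^ j) - int a = int p ^ Suc N * t"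
      using cong2[of j] unfolding cong_iff_dvd_diff by blast
    hence "D $ n / of_nat p ^ Suc N = of_int t" unfolding Dn by simp
    thus ?thesis by (simp only: pint_of_int)
  qed
  have fn: "rd (f $ n) = 0" if "\<not> p ^ Suc N dvd n" for n
  proof -
    have "of_nat n * f $ n = fps_XD f $ n" by simp
    also have "\<dots> = (\<Sum>i=0..n. D $ i * f $ (n - i))" unfolding XF fps_mult_nth ..
    finally have "of_nat n * f $ n / of_nat p ^ Suc N
        = (\<Sum>i=0..n. D $ i / of_nat p ^ Suc N * f $ (n - i))"
      by (simp add: sum_divide_distrib)
    moreover have "pint (\<Sum>i=0..n. D $ i / of_nat p ^ Suc N * f $ (n - i))"
      by (intro pint_sum pint_mult D fintD[OF ff])
    ultimately have "pint (f $ n / of_nat p)" using pint_of_divided that by metis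
    thus ?thesis using rd_eq_0_iff[OF fintD[OF ff]] by blast
  qed
  have "E ^ a * inverse (E ^ a) = 1" by (rule inverse_mult_eq_1') (simp add: fps_nth_power_0)
  have "E ^ a * f = dilate (of_nat a) E * (E ^ a * inverse (E ^ a))"
    by (simp only: f_def mult_ac)
  hence "dilate (of_nat a) E = E ^ a * f"
    unfolding \<open>E ^ a * inverse (E ^ a) = 1\<close> by (simp only: mult_1_right)
  hence "red (dilate (of_nat a) E) = red (E ^ a) * red f"
    using red_mult[OF fint_power[OF fint_E] ff] by metis
  hence "dilate (of_nat a) Eb = Eb ^ a * red f"
    unfolding red_dilate[OF fint_E] red_power[OF fint_E] Eb_def .
  \<comment> \<open>In the residue field \<open>a\<close> and \<open>c\<close> coincide, so the
    integral dilation by \<open>a\<close> reduces to the one by \<open>c\<close>.\<close>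
  moreover have "(of_nat a :: 'p mod_ring) = of_nat c" by (simp add: a_def)
  ultimately show ?thesis using that fn by (metis red_fps_nth)
qed

end

section \<open>Functions on the branches of the Artin--Schreier--Witt tower\<close>

definition finite_fps :: "'a::zero fps \<Rightarrow> bool" where
  "finite_fps f \<longleftrightarrow> (\<exists>M. \<forall>n\<ge>M. f $ n = 0)"

context prime_base
begin

text \<open>The integral elements of the Tate algebra. Their reductions modulo \<open>p\<close> are polynomials, and unlike
  the polynomials they contain the Euler derivative of \<open>Th\<close>.\<close>
definition tate :: "rat fps \<Rightarrow> bool" where
  "tate c \<longleftrightarrow> fint c \<and> (\<forall>N. \<exists>M. \<forall>n\<ge>M. pint (c $ n / of_nat p ^ N))"

lemma tate_fint: "tate c \<Longrightarrow> fint c" by (simp add: tate_def)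

lemma tateD: "tate c \<Longrightarrow> \<exists>M. \<forall>n\<ge>M. pint (c $ n / of_nat p ^ N)" by (simp add: tate_def)

lemma tate_add:
  assumes "tate c" "tate d" shows "tate (c + d)"
  unfolding tate_def
proof (intro conjI allI)
  show "fint (c + d)" using assms by (auto intro: tate_fint)
  fix N
  obtain M M' where M: "\<forall>n\<ge>M. pint (c $ n / of_nat p ^ N)" "\<forall>n\<ge>M'. pint (d $ n / of_nat p ^ N)"
    using assms tateD by meson
  show "\<exists>M. \<forall>n\<ge>M. pint ((c + d) $ n / of_nat p ^ N)"
    using M by (intro exI[of _ "max M M'"]) (auto simp: add_divide_distrib)
qed

lemma tate_mult:
  assumes "tate c" "tate d" shows "tate (c * d)"
  unfolding tate_def
proof (intro conjI allI)
  show "fint (c * d)" using assms by (auto intro: tate_fint)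
  fix N
  obtain M M' where M: "\<forall>n\<ge>M. pint (c $ n / of_nat p ^ N)" "\<forall>n\<ge>M'. pint (d $ n / of_nat p ^ N)"
    using assms tateD by meson
  have "pint ((c * d) $ n / of_nat p ^ N)" if n: "n \<ge> M + M'" for n
  proof -
    have "pint (c $ i * d $ (n - i) / of_nat p ^ N)" for i
    proof (cases "i \<ge> M")
      case True
      hence "pint ((c $ i / of_nat p ^ N) * d $ (n - i))"
        using M(1) by (intro pint_mult fintD[OF tate_fint[OF assms(2)]]) auto
      thus ?thesis by simp
    next
      case False
      hence "n - i \<ge> M'" using n by simp
      hence "pint (c $ i * (d $ (n - i) / of_nat p ^ N))"
        using M(2) by (intro pint_mult fintD[OF tate_fint[OF assms(1)]]) auto
      thus ?thesis by simp
    qed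
    thus ?thesis by (simp add: fps_mult_nth sum_divide_distrib pint_sum)
  qed
  thus "\<exists>M. \<forall>n\<ge>M. pint ((c * d) $ n / of_nat p ^ N)" by blast
qed

lemma tate_finite:
  assumes "fint c" "finite_fps c" shows "tate c"
proof -
  obtain M where M: "\<forall>n\<ge>M. c $ n = 0" using assms(2) by (auto simp: finite_fps_def)
  show ?thesis unfolding tate_def using assms(1) M by (intro conjI allI exI[of _ M]) auto
qed

lemma tate_const: "pint r \<Longrightarrow> tate (fps_const r)"
  by (intro tate_finite fint_const) (auto simp: finite_fps_def intro!: exI[of _ 1])

lemma tate_of_nat: "tate (of_nat n)"
  using tate_const[of "of_nat n"] by (simp add: fps_of_nat)

lemma tate_0: "tate 0" and tate_1: "tate 1"
  using tate_const[of 0] tate_const[of 1] by simp_all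

lemma tate_uminus: "tate c \<Longrightarrow> tate (- c)"
  using tate_mult[OF tate_const[of "-1"], of c] pint_uminus[OF pint_1]
  by (simp flip: fps_const_neg)

lemma tate_diff: "tate c \<Longrightarrow> tate d \<Longrightarrow> tate (c - d)"
  using tate_add[OF _ tate_uminus, of c d] by simp

lemma tate_sum: "(\<And>i. i \<in> A \<Longrightarrow> tate (f i)) \<Longrightarrow> tate (sum f A)"
  by (induction A rule: infinite_finite_induct) (auto simp: tate_0 intro: tate_add)

lemma tate_XD:
  assumes "tate c" shows "tate (fps_XD c)"
  unfolding tate_def
proof (intro conjI allI)
  show "fint (fps_XD c)"
    unfolding fint_def fps_XD_nth by (intro allI pint_mult pint_of_nat fintD tate_fint assms)
  fix N
  obtain M where M: "\<forall>n\<ge>M. pint (c $ n / of_nat p ^ N)" using assms tateD by meson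
  have "pint (fps_XD c $ n / of_nat p ^ N)" if "n \<ge> M" for n
  proof -
    have "pint (of_nat n * (c $ n / of_nat p ^ N))" using M that by (intro pint_mult pint_of_nat) auto
    thus ?thesis by simp
  qed
  thus "\<exists>M. \<forall>n\<ge>M. pint (fps_XD c $ n / of_nat p ^ N)" by blast
qed

lemma tate_XD_Th: "tate (fps_XD Th)"
  unfolding tate_def
proof (intro conjI allI)
  show "fint (fps_XD Th)"
    unfolding fint_def fps_XD_nth by (intro allI pint_mult pint_of_nat fintD fint_Th)
  fix N
  have "pint (fps_XD Th $ n / of_nat p ^ N)" if n: "n \<ge> p ^ N" for n
  proof (cases "\<exists>j. n = p ^ j")
    case True
    then obtain j where j: "n = p ^ j" by blast
    have "j \<ge> N" using n j p_gt_1 by (meson power_increasing_iff)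
    have "fps_XD Th $ n / of_nat p ^ N = of_nat (p ^ j) / of_nat (p ^ N)"
      using j by (auto simp: theta_series_nth)
    also have "p ^ j = p ^ N * p ^ (j - N)" using \<open>j \<ge> N\<close> by (simp flip: power_add)
    also have "of_nat \<dots> / of_nat (p ^ N) = (of_nat (p ^ (j - N)) :: rat)"
      by simp
    finally show ?thesis by (simp only: pint_of_nat)
  qed (simp add: theta_series_nth)
  thus "\<exists>M. \<forall>n\<ge>M. pint (fps_XD Th $ n / of_nat p ^ N)" by blast
qed

text \<open>Polynomials over the Tate algebra with \<open>p\<close> inverted: a single power of
  \<open>p\<close> has to clear all coefficients. Denominators arise from the factorials in
  binomials.\<close>

definition tpoly :: "rat fps poly \<Rightarrow> bool" where
  "tpoly b \<longleftrightarrow> (\<exists>j. \<forall>i. tate (of_nat p ^ j * coeff b i))"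

lemma tpolyI: "(\<And>i. tate (coeff b i)) \<Longrightarrow> tpoly b"
  unfolding tpoly_def by (intro exI[of _ 0]) simp

lemma tate_p_power: "tate (of_nat p ^ j)"
  using tate_of_nat[of "p ^ j"] by simp

lemma tpoly_add:
  assumes "tpoly a" "tpoly b" shows "tpoly (a + b)"
proof -
  obtain j k where jk: "\<And>i. tate (of_nat p ^ j * coeff a i)" "\<And>i. tate (of_nat p ^ k * coeff b i)"
    using assms by (auto simp: tpoly_def)
  have "tate (of_nat p ^ (j + k) * coeff (a + b) i)" for i
  proof -
    have "of_nat p ^ (j + k) * coeff (a + b) i =
        of_nat p ^ k * (of_nat p ^ j * coeff a i) + of_nat p ^ j * (of_nat p ^ k * coeff b i)"
      by (simp only: coeff_add power_add distrib_left mult_ac)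
    thus ?thesis using jk tate_p_power by (simp only: tate_add tate_mult)
  qed
  thus ?thesis unfolding tpoly_def by blast
qed

lemma tpoly_mult:
  assumes "tpoly a" "tpoly b" shows "tpoly (a * b)"
proof -
  obtain j k where jk: "\<And>i. tate (of_nat p ^ j * coeff a i)" "\<And>i. tate (of_nat p ^ k * coeff b i)"
    using assms by (auto simp: tpoly_def)
  have "tate (of_nat p ^ (j + k) * coeff (a * b) i)" for i
  proof -
    have "of_nat p ^ (j + k) * coeff (a * b) i =
        (\<Sum>l\<le>i. (of_nat p ^ j * coeff a l) * (of_nat p ^ k * coeff b (i - l)))"
      by (simp only: coeff_mult power_add sum_distrib_left mult_ac)
    thus ?thesis using jk by (simp only: tate_sum tate_mult)
  qed
  thus ?thesis unfolding tpoly_def by blast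
qed

lemma tpoly_const: "tate c \<Longrightarrow> tpoly [:c:]"
  by (rule tpolyI) (auto simp: coeff_pCons tate_0 split: nat.split)

lemma tpoly_linear: "tate c \<Longrightarrow> tate d \<Longrightarrow> tpoly [:c, d:]"
  by (rule tpolyI) (auto simp: coeff_pCons tate_0 split: nat.split)

lemma tpoly_smult: "tate c \<Longrightarrow> tpoly b \<Longrightarrow> tpoly (smult c b)"
  using tpoly_mult[OF tpoly_const, of c b] by simp

lemma tpoly_diff: "tpoly a \<Longrightarrow> tpoly b \<Longrightarrow> tpoly (a - b)"
  using tpoly_add[OF _ tpoly_smult[OF tate_uminus[OF tate_1]], of a b] by simp

lemma tpoly_coeff:
  assumes "tpoly b" shows "tpoly [:coeff b i:]"
proof -
  obtain j where "\<And>i. tate (of_nat p ^ j * coeff b i)" using assms by (auto simp: tpoly_def)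
  hence "tate (of_nat p ^ j * coeff [:coeff b i:] l)" for l
    by (cases l) (auto simp: tate_0)
  thus ?thesis unfolding tpoly_def by blast
qed

lemma tpoly_rat: "tpoly [:fps_const r:]"
proof -
  obtain a b where r: "r = of_int a / of_int b" "b > 0"
    by (metis quotient_of_div quotient_of_denom_pos surj_pair)
  obtain u where u: "nat b = p ^ multiplicity p (nat b) * u" "\<not> p dvd u"
    using multiplicity_decompose'[of "nat b" p] r(2) prime_p
    by (metis not_prime_unit zero_less_nat_eq less_irrefl)
  define j where "j = multiplicity p (nat b)"
  have u0: "u \<noteq> 0" using u(2) by (metis dvd_0_right)
  have "of_int b = (of_nat (nat b) :: rat)" using r(2) by simp
  also have "\<dots> = of_nat p ^ j * of_nat u" by (subst u(1)) (simp add: j_def)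
  finally have "of_nat p ^ j * r = of_int a / of_nat u" using u0 r(1) by simp
  hence "pint (of_nat p ^ j * r)" using pint_div_unit[OF pint_of_int u(2)] by simp
  hence t: "tate (fps_const (of_nat p ^ j * r))" by (rule tate_const)
  have "of_nat p ^ j * coeff [:fps_const r:] l = (if l = 0 then fps_const (of_nat p ^ j * r) else 0)" for l
    by (cases l) (simp_all flip: fps_of_nat)
  hence "tate (of_nat p ^ j * coeff [:fps_const r:] l)" for l
    using t tate_0 by simp
  thus ?thesis unfolding tpoly_def by blast
qed

lemma tpoly_pcompose:
  assumes q: "tpoly q" shows "tpoly b \<Longrightarrow> tpoly (pcompose b q)"
proof (induction b)
  case 0 thus ?case by simp
next
  case (pCons a b)
  obtain j where j: "\<And>i. tate (of_nat p ^ j * coeff (pCons a b) i)" using pCons.prems by (auto simp: tpoly_def)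
  have "tate (of_nat p ^ j * coeff b i)" for i using j[of "Suc i"] by simp
  hence "tpoly b" by (auto simp: tpoly_def)
  moreover have "tpoly [:a:]" using tpoly_coeff[OF pCons.prems, of 0] by simp
  ultimately show ?case unfolding pcompose_pCons by (intro tpoly_add tpoly_mult q pCons.IH)
qed

text \<open>The analogue of integer-valued polynomials: binomials have integral values although
  their coefficients have denominators.\<close>

definition intval :: "rat fps poly \<Rightarrow> bool" where
  "intval b \<longleftrightarrow> (\<forall>z::nat. fint (poly b (Th + of_nat z)))"

lemma intvalD: "intval b \<Longrightarrow> fint (poly b (Th + of_nat z))"
  by (simp add: intval_def)

lemma fint_Th_add: "fint (Th + of_nat z)"
  by (intro fint_add fint_Th fint_of_nat)

section \<open>Falling factorials of the Euler operator as polynomials in \<open>Th\<close>\<close>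

lemma fps_XD_poly:
  "fps_XD (poly U x) = poly (map_poly fps_XD U) x + poly (pderiv U) x * fps_XD (x :: rat fps)"
proof (induction U)
  case 0 show ?case by (simp add: fps_XD_def)
next
  case (pCons a U)
  have 0: "fps_XD 0 = (0 :: rat fps)" by (simp add: fps_XD_def)
  have mp: "map_poly fps_XD (pCons a U) = pCons (fps_XD a) (map_poly fps_XD U)"
    by (rule poly_eqI) (simp add: coeff_map_poly[where f = fps_XD, OF 0] coeff_pCons split: nat.split)
  have "fps_XD (poly (pCons a U) x) = fps_XD a + (fps_XD x * poly U x + x * fps_XD (poly U x))"
    unfolding poly_pCons fps_XD_add fps_XD_mult ..
  also have "\<dots> = poly (map_poly fps_XD (pCons a U)) x + poly (pderiv (pCons a U)) x * fps_XD x"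
    unfolding pCons.IH mp by (simp add: pderiv_pCons algebra_simps)
  finally show ?case .
qed

text \<open>The product rule for the Euler operator on \<open>poly U x * E ^ b\<close> at
  \<open>x = Th + of_nat z\<close>: it acts on the coefficients, on \<open>x\<close>, and on
  \<open>E ^ b\<close>, where it gives the factor \<open>b * Th\<close>. Adding the shift
  \<open>z * b + s - d\<close> turns \<open>b * Th\<close> into \<open>b * x + s - d\<close>, so the
  recursion does not mention \<open>z\<close>.\<close>

fun Upoly :: "rat fps \<Rightarrow> nat \<Rightarrow> nat \<Rightarrow> nat \<Rightarrow> rat fps poly" where
  "Upoly c b s 0 = [:c:]"
| "Upoly c b s (Suc d) = map_poly fps_XD (Upoly c b s d) + smult (fps_XD Th) (pderiv (Upoly c b s d))
      + [:of_nat s - of_nat d, of_nat b:] * Upoly c b s d"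

lemma coeff_map_XD: "coeff (map_poly fps_XD U) i = fps_XD (coeff U i :: rat fps)"
  by (rule coeff_map_poly) (simp add: fps_XD_def)

lemma tate_Upoly: "tate c \<Longrightarrow> tate (coeff (Upoly c b s d) i)"
proof (induction d arbitrary: i)
  case 0 thus ?case by (auto simp: coeff_pCons tate_0 split: nat.split)
next
  case (Suc d)
  have IH: "tate (coeff (Upoly c b s d) i)" for i using Suc by blast
  have lin: "tate (coeff [:of_nat s - of_nat d, of_nat b:] l)" for l
    by (auto simp: coeff_pCons tate_0 tate_diff tate_of_nat split: nat.split)
  show ?case
    unfolding Upoly.simps coeff_add coeff_map_XD coeff_smult coeff_pderiv coeff_mult
    by (intro tate_add tate_XD IH tate_mult tate_XD_Th tate_of_nat tate_sum lin)
qed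

text \<open>These monic polynomials serve to cancel leading coefficients: divided by
  \<open>fact d\<close> they still have integral values.\<close>

lemma Upoly_monic:
  "degree (Upoly 1 1 0 d) \<le> d \<and> coeff (Upoly 1 1 0 d) d = 1"
proof (induction d)
  case (Suc d)
  define U where "U = Upoly 1 1 0 d"
  have U: "coeff U i = 0" if "i > d" for i
    using Suc that by (auto simp: U_def intro: coeff_eq_0)
  have Ud: "coeff U d = 1" using Suc by (simp add: U_def)
  have 0: "fps_XD 0 = (0 :: rat fps)" by (simp add: fps_XD_def)
  have co: "coeff (Upoly 1 1 0 (Suc d)) (Suc i) =
     fps_XD (coeff U (Suc i)) + fps_XD Th * (of_nat (Suc (Suc i)) * coeff U (Suc (Suc i)))
     + ((0 - of_nat d) * coeff U (Suc i) + coeff U i)" for i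
    unfolding Upoly.simps U_def[symmetric] coeff_add coeff_map_XD coeff_smult coeff_pderiv
    by simp
  have "coeff (Upoly 1 1 0 (Suc d)) (Suc d) = 1"
    unfolding co by (simp add: U Ud 0)
  moreover have "degree (Upoly 1 1 0 (Suc d)) \<le> Suc d"
  proof (rule degree_le, intro allI impI)
    fix i assume "i > Suc d"
    then obtain i' where "i = Suc i'" "i' > d" by (cases i) auto
    thus "coeff (Upoly 1 1 0 (Suc d)) i = 0" unfolding \<open>i = Suc i'\<close> co by (simp add: U 0)
  qed
  ultimately show ?case by blast
qed simp

text \<open>On the branch \<open>z\<close>, the power \<open>E ^ b\<close> behaves like \<open>X ^ (z * b) * E ^ b\<close>: the operators below are
  the falling factorials of the Euler operator shifted by \<open>z * b + s\<close>.\<close>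
lemma Upoly_eval:
  "(poly (Upoly c b s d) (Th + of_nat z) * E ^ b) $ n =
     fact d * of_nat ((n + z * b + s) choose d) * (c * E ^ b) $ n"
proof -
  define x where "x = Th + of_nat z"
  have Xx: "fps_XD x = fps_XD Th"
    unfolding x_def by (rule fps_ext) (simp flip: fps_of_nat)
  have XE: "fps_XD (E ^ b) = of_nat b * Th * E ^ b" by (rule fps_XD_power_eq[OF XD_E])
  define F where "F d = poly (Upoly c b s d) x * E ^ b" for d
  have F: "F (Suc d) = fps_XD (F d) + fps_const (of_nat (z * b) + of_nat s - of_nat d) * F d" for d
  proof -
    define U where "U = Upoly c b s d"
    have "F (Suc d) = (fps_XD (poly U x) + (of_nat s - of_nat d + of_nat b * x) * poly U x) * E ^ b"
      unfolding F_def Upoly.simps U_def[symmetric] fps_XD_poly Xx by (simp add: algebra_simps)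
    moreover have "fps_XD (F d) = fps_XD (poly U x) * E ^ b + poly U x * (of_nat b * Th * E ^ b)"
      unfolding F_def U_def[symmetric] fps_XD_mult XE ..
    moreover have "fps_const (of_nat (z * b) + of_nat s - of_nat d) =
        (of_nat z * of_nat b + of_nat s - of_nat d :: rat fps)"
      by (simp flip: fps_of_nat)
    ultimately show ?thesis unfolding F_def U_def[symmetric]
      by (simp only: x_def) (simp add: algebra_simps)
  qed
  have "F d $ n = (\<Prod>i=0..<d. of_nat (n + z * b + s) - of_nat i) * (c * E ^ b) $ n"
  proof (induction d)
    case 0 show ?case by (simp add: F_def)
  next
    case (Suc d)
    have "F (Suc d) $ n = (of_nat (n + z * b + s) - of_nat d) * F d $ n"
      unfolding F fps_add_nth fps_XD_nth fps_mult_left_const_nth by (simp add: algebra_simps)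
    thus ?case unfolding Suc by simp
  qed
  also have "(\<Prod>i=0..<d. of_nat (n + z * b + s) - of_nat i) = fact d * (of_nat ((n + z * b + s) choose d) :: rat)"
    unfolding binomial_gbinomial gbinomial_prod_rev by simp
  finally show ?thesis by (simp add: F_def x_def)
qed

lemma coeff_pcompose_shift:
  assumes "degree (b :: 'a::comm_ring_1 poly) \<le> Suc d"
  shows "degree (pcompose b [:1, 1:] - b) \<le> d"
    "coeff (pcompose b [:1, 1:] - b) d = of_nat (Suc d) * coeff b (Suc d)"
proof -
  have L: "coeff ([:1, 1:] ^ j) i = (of_nat (j choose i) :: 'a)" for i j
  proof (cases "i \<le> j")
    case True show ?thesis unfolding coeff_linear_poly_power[OF True] by simp
  next
    case False
    have "degree ([:1, 1:] ^ j :: 'a poly) \<le> j" using degree_power_le[of "[:1, 1:]" j] by simp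
    thus ?thesis using False by (simp add: coeff_eq_0 binomial_eq_0)
  qed
  have co: "coeff (pcompose b [:1, 1:]) i = (\<Sum>j\<le>Suc d. of_nat (j choose i) * coeff b j)" for i
  proof -
    have "b = (\<Sum>j\<le>Suc d. monom (coeff b j) j)" using poly_as_sum_of_monoms'[OF assms] ..
    hence "pcompose b [:1, 1:] = (\<Sum>j\<le>Suc d. pcompose (monom (coeff b j) j) [:1, 1:])"
      by (metis (no_types) pcompose_sum)
    also have "\<dots> = (\<Sum>j\<le>Suc d. smult (coeff b j) ([:1, 1:] ^ j))"
      by (intro sum.cong refl) (simp add: pcompose_altdef map_poly_monom poly_monom)
    finally have eq: "pcompose b [:1, 1:] = (\<Sum>j\<le>Suc d. smult (coeff b j) ([:1, 1:] ^ j))" .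
    show ?thesis unfolding eq coeff_sum coeff_smult L by (simp only: mult.commute)
  qed
  show "degree (pcompose b [:1, 1:] - b) \<le> d"
  proof (rule degree_le, intro allI impI)
    fix i assume i: "i > d"
    have "(\<Sum>j\<le>Suc d. of_nat (j choose i) * coeff b j) = (\<Sum>j\<le>Suc d. if j = i then coeff b j else 0)"
      using i by (intro sum.cong) (auto simp: binomial_eq_0)
    also have "\<dots> = coeff b i" using i assms by (auto simp: coeff_eq_0)
    finally show "coeff (pcompose b [:1, 1:] - b) i = 0"
      unfolding coeff_diff co by (simp only: diff_self)
  qed
  have "(\<Sum>j\<le>Suc d. of_nat (j choose d) * coeff b j) = (\<Sum>j\<le>d. of_nat (j choose d) * coeff b j) + of_nat (Suc d) * coeff b (Suc d)"
    by simp
  also have "(\<Sum>j\<le>d. of_nat (j choose d) * coeff b j) = (\<Sum>j\<le>d. if j = d then coeff b j else 0)"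
    by (intro sum.cong) (auto simp: binomial_eq_0)
  also have "\<dots> = coeff b d" by simp
  finally show "coeff (pcompose b [:1, 1:] - b) d = of_nat (Suc d) * coeff b (Suc d)"
    unfolding coeff_diff co by (simp only: add_diff_cancel_left')
qed

lemma poly_shift_eval: "poly (pcompose b [:1, 1:]) (Th + of_nat z) = poly b (Th + of_nat (Suc z))"
  by (simp add: poly_pcompose algebra_simps)

lemma poly_fint_diff:
  assumes x: "fint x" shows "(\<And>i. fint (coeff b i)) \<Longrightarrow> fint (poly b x) \<and> (\<exists>w. fint w \<and> poly b (x + of_nat m) = poly b x + of_nat m * w)"
proof (induction b)
  case 0 show ?case by (auto intro!: exI[of _ 0])
next
  case (pCons a b)
  have a: "fint a" using pCons.prems[of 0] by simp
  have "fint (coeff b i)" for i using pCons.prems[of "Suc i"] by simp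
  from pCons.IH[OF this] obtain w where w: "fint (poly b x)" "fint w" "poly b (x + of_nat m) = poly b x + of_nat m * w" by blast
  have "poly (pCons a b) (x + of_nat m) = poly (pCons a b) x + of_nat m * (poly b x + x * w + of_nat m * w)"
    unfolding poly_pCons w(3) by (simp add: algebra_simps)
  moreover have "fint (poly b x + x * w + of_nat m * w)" by (intro fint_add fint_mult w x fint_of_nat)
  moreover have "fint (poly (pCons a b) x)" unfolding poly_pCons by (intro fint_add fint_mult a x w)
  ultimately show ?case by blast
qed

end

section \<open>The ring of reduced functions on the branches\<close>

context char_p_base
begin

text \<open>Functions of \<open>z\<close> rather than polynomials over the residue field: a
  representing \<open>b\<close> need not have integral coefficients, so it has no reduction of its
  own.\<close>

definition R :: "(nat \<Rightarrow> 'p mod_ring fps) set" where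
  "R = {f. \<exists>b. tpoly b \<and> intval b \<and> (\<forall>z. f z = red (poly b (Th + of_nat z)))}"

lemma R_add:
  assumes "f \<in> R" "g \<in> R" shows "(\<lambda>z. f z + g z) \<in> R"
proof -
  obtain a b where ab: "tpoly a" "intval a" "\<And>z. f z = red (poly a (Th + of_nat z))"
    "tpoly b" "intval b" "\<And>z. g z = red (poly b (Th + of_nat z))" using assms unfolding R_def by blast
  have "f z + g z = red (poly (a + b) (Th + of_nat z))" for z
    unfolding poly_add ab(3,6) by (rule red_add[symmetric]) (intro intvalD ab)+
  moreover have "intval (a + b)" unfolding intval_def poly_add by (intro allI fint_add intvalD ab)
  ultimately show ?thesis using tpoly_add[OF ab(1,4)] unfolding R_def by blast
qed

lemma R_diff:
  assumes "f \<in> R" "g \<in> R" shows "(\<lambda>z. f z - g z) \<in> R"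
proof -
  obtain a b where ab: "tpoly a" "intval a" "\<And>z. f z = red (poly a (Th + of_nat z))"
    "tpoly b" "intval b" "\<And>z. g z = red (poly b (Th + of_nat z))" using assms unfolding R_def by blast
  have "f z - g z = red (poly (a - b) (Th + of_nat z))" for z
    unfolding poly_diff ab(3,6) by (rule red_diff[symmetric]) (intro intvalD ab)+
  moreover have "intval (a - b)" unfolding intval_def poly_diff by (intro allI fint_diff intvalD ab)
  ultimately show ?thesis using tpoly_diff[OF ab(1,4)] unfolding R_def by blast
qed

lemma R_mult:
  assumes "f \<in> R" "g \<in> R" shows "(\<lambda>z. f z * g z) \<in> R"
proof -
  obtain a b where ab: "tpoly a" "intval a" "\<And>z. f z = red (poly a (Th + of_nat z))"
    "tpoly b" "intval b" "\<And>z. g z = red (poly b (Th + of_nat z))" using assms unfolding R_def by blast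
  have "f z * g z = red (poly (a * b) (Th + of_nat z))" for z
    unfolding poly_mult ab(3,6) by (rule red_mult[symmetric]) (intro intvalD ab)+
  moreover have "intval (a * b)" unfolding intval_def poly_mult by (intro allI fint_mult intvalD ab)
  ultimately show ?thesis using tpoly_mult[OF ab(1,4)] unfolding R_def by blast
qed

lemma R_const:
  assumes "tate c" shows "(\<lambda>z. red c) \<in> R"
proof -
  have "intval [:c:]" using tate_fint[OF assms] by (simp add: intval_def)
  moreover have "red c = red (poly [:c:] (Th + of_nat z))" for z by simp
  ultimately show ?thesis using tpoly_const[OF assms] unfolding R_def by blast
qed

lemma R_0: "(\<lambda>z. 0) \<in> R" and R_1: "(\<lambda>z. 1) \<in> R"
  using R_const[OF tate_0] R_const[OF tate_1] by simp_all

lemma R_sum: "finite A \<Longrightarrow> (\<And>i. i \<in> A \<Longrightarrow> f i \<in> R) \<Longrightarrow> (\<lambda>z. \<Sum>i\<in>A. f i z) \<in> R"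
  by (induction A rule: finite_induct) (auto simp: R_0 R_add)

lemma R_prod: "finite A \<Longrightarrow> (\<And>i. i \<in> A \<Longrightarrow> f i \<in> R) \<Longrightarrow> (\<lambda>z. \<Prod>i\<in>A. f i z) \<in> R"
  by (induction A rule: finite_induct) (auto simp: R_1 R_mult)

lemma R_shift: "f \<in> R \<Longrightarrow> (\<lambda>z. f (z + h)) \<in> R"
proof (induction h)
  case (Suc h)
  then obtain b where b: "tpoly b" "intval b" "\<And>z. f (z + h) = red (poly b (Th + of_nat z))"
    unfolding R_def by blast
  define b' where "b' = pcompose b [:1, 1:]"
  have ev: "poly b' (Th + of_nat z) = poly b (Th + of_nat (Suc z))" for z
    unfolding b'_def by (rule poly_shift_eval)
  have "f (z + Suc h) = red (poly b' (Th + of_nat z))" for z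
    using b(3)[of "Suc z"] unfolding ev by simp
  moreover have "intval b'" unfolding intval_def ev by (intro allI intvalD b)
  moreover have "tpoly b'" unfolding b'_def by (intro tpoly_pcompose tpoly_linear tate_1 b)
  ultimately show ?case unfolding R_def by blast
qed simp

lemma red_Th: "red Th = theta_series p"
  by (rule fps_ext) (simp add: theta_series_nth)

lemma R_theta: "(\<lambda>z. theta_series p + of_nat z) \<in> R"
proof -
  have "intval [:0, 1:]" unfolding intval_def using fint_Th_add by simp
  moreover have "theta_series p + of_nat z = red (poly [:0, 1:] (Th + of_nat z))" for z
    using red_add[OF fint_Th fint_of_nat, of z] by (simp add: red_Th)
  ultimately show ?thesis using tpoly_linear[OF tate_0 tate_1] unfolding R_def by blast
qed

text \<open>If \<open>p ^ j\<close> clears the coefficients of \<open>b\<close>, a shift by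
  \<open>p ^ Suc j\<close> changes \<open>p ^ j * b\<close> by a multiple of
  \<open>p ^ Suc j\<close>, hence \<open>b\<close> by a multiple of \<open>p\<close>.\<close>

lemma R_periodic:
  assumes "f \<in> R" obtains k where "k > 0" "\<And>z. f (z + p ^ k) = f z"
proof -
  obtain b where b: "tpoly b" "intval b" "\<And>z. f z = red (poly b (Th + of_nat z))"
    using assms unfolding R_def by blast
  obtain j where j: "\<And>i. tate (of_nat p ^ j * coeff b i)" using b(1) by (auto simp: tpoly_def)
  define b' where "b' = smult (of_nat p ^ j) b"
  have fb: "fint (coeff b' i)" for i unfolding b'_def coeff_smult using j tate_fint by blast
  have "f (z + p ^ Suc j) = f z" for z
  proof -
    define x where "x = Th + of_nat z"
    obtain w where w: "fint w" "poly b' (x + of_nat (p ^ Suc j)) = poly b' x + of_nat (p ^ Suc j) * w"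
      using poly_fint_diff[OF fint_Th_add fb] unfolding x_def by blast
    have "of_nat p ^ j * poly b (x + of_nat (p ^ Suc j)) = of_nat p ^ j * (poly b x + of_nat p * w)"
      using w(2) unfolding b'_def poly_smult by (simp add: algebra_simps)
    hence "poly b (x + of_nat (p ^ Suc j)) = poly b x + of_nat p * w" by simp
    moreover have "Th + of_nat (z + p ^ Suc j) = x + of_nat (p ^ Suc j)" by (simp add: x_def)
    ultimately have "f (z + p ^ Suc j) = red (poly b x + of_nat p * w)" by (simp only: b(3))
    also have "\<dots> = red (poly b x) + red (of_nat p * w)"
      unfolding x_def by (intro red_add intvalD b fint_mult w fint_of_nat)
    also have "\<dots> = f z" unfolding red_p_mult[OF w(1)] b(3) x_def by simp
    finally show ?thesis .
  qed
  thus ?thesis using that by blast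
qed

definition Vpoly :: "rat fps \<Rightarrow> nat \<Rightarrow> nat \<Rightarrow> nat \<Rightarrow> rat fps poly" where
  "Vpoly c b s d = smult (fps_const (1 / fact d)) (Upoly c b s d)"

lemma Vpoly_eval:
  "poly (Vpoly c b s d) (Th + of_nat z) * E ^ b =
     Abs_fps (\<lambda>n. of_nat ((n + z * b + s) choose d) * (c * E ^ b) $ n)"
proof (rule fps_ext)
  fix n
  have "(poly (Vpoly c b s d) (Th + of_nat z) * E ^ b) $ n =
     1 / fact d * (poly (Upoly c b s d) (Th + of_nat z) * E ^ b) $ n"
    unfolding Vpoly_def poly_smult mult.assoc fps_mult_left_const_nth ..
  thus "(poly (Vpoly c b s d) (Th + of_nat z) * E ^ b) $ n =
      Abs_fps (\<lambda>n. of_nat ((n + z * b + s) choose d) * (c * E ^ b) $ n) $ n"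
    unfolding Upoly_eval by simp
qed

lemma tpoly_Vpoly: "tate c \<Longrightarrow> tpoly (Vpoly c b s d)"
  unfolding Vpoly_def using tpoly_mult[OF tpoly_rat tpolyI[OF tate_Upoly]] by simp

lemma E_power_inverse: "E ^ b * inverse (E ^ b) = 1"
  by (rule inverse_mult_eq_1') (simp add: fps_nth_power_0)

lemma fint_inverse_E_power: "fint (inverse (E ^ b))"
  by (rule fint_inverse[OF fint_power[OF fint_E]]) (simp add: fps_nth_power_0)

text \<open>After multiplication by \<open>E ^ b\<close> the coefficients are binomial numbers times
  integral ones, and \<open>E ^ b\<close> is invertible among integral series.\<close>

lemma intval_Vpoly:
  assumes "fint c" shows "intval (Vpoly c b s d)"
  unfolding intval_def
proof
  fix z :: nat
  define x where "x = poly (Vpoly c b s d) (Th + of_nat z)"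
  have "fint (x * E ^ b)" unfolding x_def Vpoly_eval
    unfolding fint_def fps_nth_Abs_fps
    by (intro allI pint_mult pint_of_nat fintD fint_mult assms fint_power fint_E)
  from fint_mult[OF this fint_inverse_E_power] have "fint (x * E ^ b * inverse (E ^ b))" .
  thus "fint x" unfolding mult.assoc E_power_inverse by simp
qed

lemma R_Vpoly:
  assumes "tate c"
  obtains W where "W \<in> R" "\<And>z n. (W z * Eb ^ b) $ n = of_nat ((n + z * b + s) choose d) * (red c * Eb ^ b) $ n"
proof -
  define W where "W z = red (poly (Vpoly c b s d) (Th + of_nat z))" for z
  have iv: "intval (Vpoly c b s d)" by (rule intval_Vpoly[OF tate_fint[OF assms]])
  have "W \<in> R" unfolding R_def W_def using iv tpoly_Vpoly[OF assms] by blast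
  moreover have "(W z * Eb ^ b) $ n = of_nat ((n + z * b + s) choose d) * (red c * Eb ^ b) $ n" for z n
  proof -
    have "W z * Eb ^ b = red (poly (Vpoly c b s d) (Th + of_nat z) * E ^ b)"
      unfolding W_def Eb_def red_mult[OF intvalD[OF iv] fint_power[OF fint_E]] red_power[OF fint_E] ..
    also have "\<dots> $ n = rd (of_nat ((n + z * b + s) choose d) * (c * E ^ b) $ n)"
      unfolding Vpoly_eval red_fps_nth fps_nth_Abs_fps ..
    also have "\<dots> = of_nat ((n + z * b + s) choose d) * rd ((c * E ^ b) $ n)"
      unfolding rd_mult[OF pint_of_nat fintD[OF fint_mult[OF tate_fint[OF assms] fint_power[OF fint_E]]]] rd_of_nat ..
    also have "rd ((c * E ^ b) $ n) = (red c * Eb ^ b) $ n"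
      unfolding Eb_def red_power[OF fint_E, symmetric] red_mult[OF tate_fint[OF assms] fint_power[OF fint_E], symmetric] red_fps_nth ..
    finally show ?thesis .
  qed
  ultimately show ?thesis using that by blast
qed

section \<open>Constant functions in the ring\<close>

definition shift_diff :: "rat fps poly \<Rightarrow> rat fps poly" where
  "shift_diff b = pcompose b [:1, 1:] - b"

lemma shift_diff_eval:
  "poly (shift_diff b) (Th + of_nat z) = poly b (Th + of_nat (Suc z)) - poly b (Th + of_nat z)"
  unfolding shift_diff_def poly_diff poly_shift_eval ..

lemma intval_shift_diff: "intval b \<Longrightarrow> intval (shift_diff b)"
  unfolding intval_def shift_diff_eval by (intro allI fint_diff) blast+

lemma red_shift_diff:
  assumes "intval b" "\<And>z. red (poly b (Th + of_nat z)) = c"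
  shows "red (poly (shift_diff b) (Th + of_nat z)) = 0"
  unfolding shift_diff_eval red_diff[OF intvalD[OF assms(1)] intvalD[OF assms(1)]] assms(2) by simp

text \<open>The \<open>d\<close>-th difference of \<open>b\<close> is \<open>d!\<close> times its leading coefficient.\<close>
lemma fact_lead_coeff:
  "degree b \<le> d \<Longrightarrow> intval b \<Longrightarrow> (\<And>z. red (poly b (Th + of_nat z)) = 0) \<Longrightarrow>
     fint (of_nat (fact d) * coeff b d) \<and> red (of_nat (fact d) * coeff b d) = 0"
proof (induction d arbitrary: b)
  case 0
  then obtain a where b: "b = [:a:]" by (metis degree_eq_zeroE le_zero_eq)
  show ?case using 0(2) 0(3) unfolding b intval_def by simp
next
  case (Suc d)
  note b' = coeff_pcompose_shift[OF Suc.prems(1), folded shift_diff_def]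
  have "fint (of_nat (fact d) * coeff (shift_diff b) d) \<and> red (of_nat (fact d) * coeff (shift_diff b) d) = 0"
    by (rule Suc.IH[OF b'(1) intval_shift_diff[OF Suc.prems(2)] red_shift_diff[OF Suc.prems(2,3)]])
  moreover have "of_nat (fact d) * coeff (shift_diff b) d = of_nat (fact (Suc d)) * coeff b (Suc d)"
    unfolding b'(2) fact_Suc of_nat_mult by (simp only: of_nat_id mult_ac)
  ultimately show ?case by simp
qed

text \<open>If \<open>l\<close> is the leading coefficient in degree \<open>d > 0\<close>, then \<open>l\<close> times the monic \<open>Upoly\<close> of degree \<open>d\<close>
  reduces to \<open>0\<close>, because \<open>d! * l\<close> does and \<open>Upoly / d!\<close> is integral. Subtract it.\<close>
lemma constant_in_R_aux:
  "degree b \<le> d \<Longrightarrow> tpoly b \<Longrightarrow> intval b \<Longrightarrow> (\<And>z. red (poly b (Th + of_nat z)) = c) \<Longrightarrow> finite_fps c"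
proof (induction d arbitrary: b)
  case 0
  then obtain a where b: "b = [:a:]" by (metis degree_eq_zeroE le_zero_eq)
  have a: "fint a" "red a = c" using 0(3,4) unfolding b intval_def by auto
  obtain j where "\<And>i. tate (of_nat p ^ j * coeff b i)" using 0(2) by (auto simp: tpoly_def)
  from this[of 0] have "tate (of_nat p ^ j * a)" by (simp add: b)
  \<comment> \<open>The precision \<open>Suc j\<close> leaves one factor \<open>p\<close> after
    \<open>p ^ j\<close> is cancelled.\<close>
  then obtain M where M: "\<And>n. n \<ge> M \<Longrightarrow> pint ((of_nat p ^ j * a) $ n / of_nat p ^ (Suc j))"
    using tateD by meson
  have "c $ n = 0" if "n \<ge> M" for n
  proof -
    have "(of_nat p ^ j * a) $ n = of_nat p ^ j * a $ n"
      by (simp flip: fps_of_nat)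
    hence "pint (a $ n / of_nat p)" using M[OF that] by simp
    thus ?thesis unfolding a(2)[symmetric] red_fps_nth using rd_eq_0_iff[OF fintD[OF a(1)]] by blast
  qed
  thus ?case unfolding finite_fps_def by blast
next
  case (Suc d)
  define l where "l = coeff b (Suc d)"
  note b1 = coeff_pcompose_shift[OF Suc.prems(1), folded shift_diff_def]
  \<comment> \<open>The values of \<open>b\<close> reduce to \<open>c\<close>, not to
    \<open>0\<close>; those of its first difference, which has smaller degree, do reduce to
    \<open>0\<close>.\<close>
  have "fint (of_nat (fact d) * coeff (shift_diff b) d) \<and> red (of_nat (fact d) * coeff (shift_diff b) d) = 0"
    by (rule fact_lead_coeff[OF b1(1) intval_shift_diff[OF Suc.prems(3)] red_shift_diff[OF Suc.prems(3,4)]])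
  moreover have "of_nat (fact d) * coeff (shift_diff b) d = of_nat (fact (Suc d)) * l"
    unfolding b1(2) fact_Suc of_nat_mult l_def by (simp only: of_nat_id mult_ac)
  ultimately have l: "fint (of_nat (fact (Suc d)) * l)" "red (of_nat (fact (Suc d)) * l) = 0" by simp_all
  define U where "U = Upoly 1 1 0 (Suc d)"
  define V where "V = Vpoly 1 1 0 (Suc d)"
  have V: "intval V" unfolding V_def by (rule intval_Vpoly) simp
  have UV: "poly U x = of_nat (fact (Suc d)) * poly V x" for x
  proof -
    have "of_nat (fact (Suc d)) * fps_const (1 / fact (Suc d)) = (1 :: rat fps)"
      by (simp del: fact_Suc flip: fps_of_nat)
    hence "of_nat (fact (Suc d)) * (fps_const (1 / fact (Suc d)) * poly U x) = poly U x"
      by (simp only: mult.assoc[symmetric] mult_1_left)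
    thus ?thesis unfolding V_def Vpoly_def poly_smult U_def by (rule sym)
  qed
  define b2 where "b2 = b - smult l U"
  have ev2: "poly b2 (Th + of_nat z) = poly b (Th + of_nat z) - of_nat (fact (Suc d)) * l * poly V (Th + of_nat z)" for z
    unfolding b2_def poly_diff poly_smult UV by (simp only: mult_ac)
  have fl: "fint (of_nat (fact (Suc d)) * l * poly V (Th + of_nat z))" for z
    by (intro fint_mult[OF l(1)] intvalD V)
  show ?case
  proof (rule Suc.IH)
    have "degree b2 \<le> Suc d" unfolding b2_def
      using Suc.prems(1) Upoly_monic[of "Suc d"] degree_smult_le[of l U] unfolding U_def
      by (intro degree_diff_le) (auto intro: le_trans)
    moreover have "coeff b2 (Suc d) = 0"
      using Upoly_monic[of "Suc d"] by (simp add: b2_def l_def U_def del: Upoly.simps)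
    ultimately show "degree b2 \<le> d"
      by (metis le_SucE leading_coeff_0_iff degree_0 zero_le)
    have "tpoly (smult l U)"
      using tpoly_mult[OF tpoly_coeff[OF Suc.prems(2)] tpolyI[OF tate_Upoly[OF tate_1]], of "Suc d" 1 0 "Suc d"]
      by (simp add: l_def U_def del: Upoly.simps)
    thus "tpoly b2" unfolding b2_def by (intro tpoly_diff Suc.prems)
    show "intval b2" unfolding intval_def ev2 by (intro allI fint_diff intvalD Suc.prems fl)
    show "red (poly b2 (Th + of_nat z)) = c" for z
      unfolding ev2 red_diff[OF intvalD[OF Suc.prems(3)] fl] red_mult[OF l(1) intvalD[OF V]] l(2) Suc.prems(4)
      by simp
  qed
qed

lemma constant_in_R:
  assumes "(\<lambda>z. c) \<in> R" shows "finite_fps c"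
proof -
  obtain b where b: "tpoly b" "intval b" "\<And>z. c = red (poly b (Th + of_nat z))"
    using assms unfolding R_def by blast
  show ?thesis by (rule constant_in_R_aux[OF order_refl b(1,2) b(3)[symmetric]])
qed

text \<open>The gaps between powers of \<open>p\<close> grow. With \<open>d\<close> the degree of
  \<open>c\<close>, only one product contributes to the coefficient of
  \<open>c * theta_series p\<close> at \<open>d + p ^ k\<close>, so nonzero coefficients occur
  arbitrarily far out.\<close>

lemma theta_irrational:
  fixes c :: "'p mod_ring fps"
  assumes "c \<noteq> 0" "finite_fps c" shows "\<not> finite_fps (c * theta_series p)"
proof
  assume "finite_fps (c * theta_series p)"
  then obtain M' where M': "\<And>n. n \<ge> M' \<Longrightarrow> (c * theta_series p) $ n = 0" by (auto simp: finite_fps_def)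
  obtain M where M: "\<And>n. n \<ge> M \<Longrightarrow> c $ n = 0" using assms(2) by (auto simp: finite_fps_def)
  define D where "D = {n. c $ n \<noteq> 0}"
  have "D \<subseteq> {..<M}" using M unfolding D_def by (metis (mono_tags) lessThan_iff mem_Collect_eq not_le subsetI)
  hence fD: "finite D" by (rule finite_subset) simp
  have D0: "D \<noteq> {}"
  proof
    assume "D = {}"
    hence "c = 0" by (intro fps_ext) (auto simp: D_def)
    thus False using assms(1) by blast
  qed
  define d where "d = Max D"
  have dD: "c $ d \<noteq> 0" using Max_in[OF fD D0] by (simp add: D_def d_def)
  have dmax: "c $ i = 0" if "i > d" for i
    using Max_ge[OF fD, of i] that by (force simp: D_def d_def)
  \<comment> \<open>Makes \<open>p ^ k\<close> exceed \<open>M'\<close>, and also \<open>d\<close>,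
    so that no other power of \<open>p\<close> lies between \<open>p ^ k\<close> and
    \<open>p ^ k + d\<close>.\<close>
  define k where "k = Suc (d + M')"
  have "k < p ^ k" using p_gt_1 by (simp add: power_gt_expt)
  hence pk: "p ^ k > d + M'" by (simp add: k_def)
  have "(c * theta_series p) $ (d + p ^ k) = (\<Sum>i=0..d + p ^ k. c $ i * theta_series p $ (d + p ^ k - i))"
    by (rule fps_mult_nth)
  also have "\<dots> = (\<Sum>i=0..d + p ^ k. if i = d then c $ d else 0)"
  proof (rule sum.cong)
    fix i assume "i \<in> {0..d + p ^ k}"
    show "c $ i * theta_series p $ (d + p ^ k - i) = (if i = d then c $ d else 0)"
    proof (cases i d rule: linorder_cases)
      case less
      have "\<not> (\<exists>n. d + p ^ k - i = p ^ n)"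
      proof
        assume "\<exists>n. d + p ^ k - i = p ^ n"
        then obtain n where n: "d + p ^ k - i = p ^ n" by blast
        have "p ^ k < p ^ n" using n less by linarith
        hence "k < n" by (rule power_less_imp_less_exp[OF p_gt_1])
        hence "p ^ Suc k \<le> p ^ n" using p_gt_1 by (intro power_increasing) auto
        moreover have "p ^ n < p ^ k + p ^ k" using n pk by linarith
        moreover have "p ^ k * 2 \<le> p ^ k * p" using p_gt_1 by (intro mult_left_mono) auto
        ultimately show False unfolding power_Suc2 by linarith
      qed
      thus ?thesis using less by (simp add: theta_series_nth)
    next
      case equal
      have "\<exists>n. p ^ k = p ^ n" by blast
      thus ?thesis using equal by (simp add: theta_series_nth)
    qed (simp add: dmax)
  qed simp
  also have "\<dots> = c $ d" by simp
  finally show False using M'[of "d + p ^ k"] dD pk by simp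
qed

text \<open>Among \<open>a\<close> consecutive numbers exactly one is a multiple of
  \<open>a\<close>. Summing shifts thus makes a constant out of a function concentrated on the
  multiples of \<open>a\<close>.\<close>

lemma sum_dvd_shift:
  fixes a :: nat and x :: "'b::comm_ring_1"
  assumes "a > 0"
  shows "(\<Sum>j<a. if a dvd z + j then x else 0) = x"
proof (induction z)
  case 0
  have "(\<Sum>j<a. if a dvd 0 + j then x else 0) = (\<Sum>j<a. if j = 0 then x else 0)"
    by (intro sum.cong) (auto dest: dvd_imp_le)
  thus ?case using assms by simp
next
  case (Suc z)
  define \<phi> where "\<phi> j = (if a dvd z + j then x else 0)" for j
  have "(\<Sum>j<Suc a. \<phi> j) = \<phi> 0 + (\<Sum>j<a. \<phi> (Suc j))" by (rule sum.lessThan_Suc_shift)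
  moreover have "(\<Sum>j<Suc a. \<phi> j) = (\<Sum>j<a. \<phi> j) + \<phi> a" by simp
  moreover have "\<phi> a = \<phi> 0" by (simp add: \<phi>_def)
  ultimately have "(\<Sum>j<a. \<phi> (Suc j)) = (\<Sum>j<a. \<phi> j)" by (simp add: add.commute)
  thus ?case using Suc by (simp add: \<phi>_def)
qed

text \<open>A nonzero function of minimal support, multiplied by its shifts, is supported on \<open>a\<nat>\<close>
  for some \<open>a\<close>. If it has a zero, then \<open>p dvd a\<close>, and the norm of such a function and the product of the
  norm with \<open>\<theta> + z\<close> show that \<open>\<theta>\<close> is rational.\<close>
lemma R_transfer:
  assumes f: "f \<in> R" "f 0 = 0" shows "f w = 0"
proof (rule ccontr)
  assume fw: "f w \<noteq> 0"
  obtain k where k: "k > 0" "\<And>z. f (z + p ^ k) = f z" using R_periodic[OF f(1)] by blast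
  define P where "P = p ^ k"
  have P0: "P > 0" using p_pos by (simp add: P_def)
  define supp where "supp g = {z. z < P \<and> g z \<noteq> 0}" for g :: "nat \<Rightarrow> 'p mod_ring fps"
  define F where "F g \<longleftrightarrow> g \<in> R \<and> (\<forall>z. g (z + P) = g z) \<and> g 0 \<noteq> 0" for g
  have per: "g (z + P * m) = g z" if "\<forall>z. g (z + P) = g z" for g :: "nat \<Rightarrow> 'p mod_ring fps" and z m
  proof (induction m)
    case (Suc m)
    have "z + P * Suc m = (z + P * m) + P" by simp
    thus ?case using Suc that by (simp only:)
  qed simp
  have permod: "g (z mod P) = g z" if "\<forall>z. g (z + P) = g z" for g :: "nat \<Rightarrow> 'p mod_ring fps" and z
    using per[OF that, of "z mod P" "z div P"] by simp
  \<comment> \<open>Moves the nonzero value to the branch \<open>0\<close>; by periodicity the zero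
    of \<open>f\<close> survives at another branch.\<close>
  define g0 where "g0 z = f (z + w)" for z
  have Fg0: "F g0" unfolding F_def g0_def
    using R_shift[OF f(1)] fw k(2) by (auto simp: P_def) (metis add.commute add.left_commute)
  obtain g where g: "F g" "\<And>g'. F g' \<Longrightarrow> card (supp g) \<le> card (supp g')"
    using ex_has_least_nat[of F g0 "\<lambda>g. card (supp g)"] Fg0 by blast
  have finsupp: "finite (supp g)" for g unfolding supp_def by simp
  have gR: "g \<in> R" and gper: "\<forall>z. g (z + P) = g z" and gz: "g 0 \<noteq> 0" using g(1) by (auto simp: F_def)
  \<comment> \<open>If the least support were everything, the support of \<open>g0\<close> would be
    everything too, but \<open>g0\<close> has a zero.\<close>
  have "\<exists>y. g y = 0"
  proof (rule ccontr)
    assume "\<nexists>y. g y = 0"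
    hence "supp g = {..<P}" by (auto simp: supp_def)
    hence "P \<le> card (supp g0)" using g(2)[OF Fg0] by simp
    moreover have "card (supp g0) < P"
    proof -
      define y where "y = (P * w - w) mod P"
      have "g0 (P * w - w) = f (P * w)" using P0 by (simp add: g0_def)
      also have "\<dots> = 0" using per[of f 0 w] k(2) f(2) by (simp add: P_def)
      finally have "g0 y = 0" using permod[of g0 "P * w - w"] Fg0 by (simp add: F_def y_def)
      hence "supp g0 \<subseteq> {..<P} - {y}" by (auto simp: supp_def)
      hence "card (supp g0) \<le> card ({..<P} - {y})" by (intro card_mono) auto
      moreover have "y < P" using P0 by (simp add: y_def)
      ultimately show ?thesis using P0 by simp
    qed
    ultimately show False by simp
  qed
  then obtain y where y: "g y = 0" by blast
  define A where "A = {z. g z \<noteq> 0}"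
  have A0: "0 \<in> A" using gz by (simp add: A_def)
  have Aper: "z + P * m \<in> A \<longleftrightarrow> z \<in> A" for z m by (simp add: A_def per[OF gper])
  \<comment> \<open>The product of \<open>g\<close> with its shift by \<open>h\<close> has no larger
    support and is still nonzero at \<open>0\<close>. Minimality makes the supports equal, so the
    support of \<open>g\<close> is closed under adding \<open>h\<close>.\<close>
  have Aadd: "a + h \<in> A" if a: "a \<in> A" and h: "h \<in> A" for a h
  proof -
    define g' where "g' z = g z * g (z + h)" for z
    have "F g'" unfolding F_def
    proof (intro conjI allI)
      show "g' \<in> R" unfolding g'_def by (intro R_mult R_shift gR)
      show "g' (z + P) = g' z" for z
        using gper[rule_format, of z] gper[rule_format, of "z + h"] by (simp add: g'_def add_ac)
      show "g' 0 \<noteq> 0" using gz h by (simp add: g'_def A_def)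
    qed
    from g(2)[OF this] have "card (supp g) \<le> card (supp g')" .
    moreover have "supp g' \<subseteq> supp g" by (auto simp: supp_def g'_def)
    ultimately have eq: "supp g' = supp g" using card_seteq[OF finsupp] by blast
    have "a mod P \<in> supp g" using a P0 permod[OF gper, of a] by (simp add: supp_def A_def)
    hence "g' (a mod P) \<noteq> 0" unfolding eq[symmetric] by (simp add: supp_def)
    hence "a mod P + h \<in> A" by (simp add: g'_def A_def)
    hence "(a mod P + h) + P * (a div P) \<in> A" by (simp only: Aper)
    moreover have "(a mod P + h) + P * (a div P) = a + h" by (simp add: algebra_simps)
    ultimately show ?thesis by simp
  qed
  have Amult: "m * a \<in> A" if "a \<in> A" for m a
    by (induction m) (auto simp: A0 intro: Aadd[OF that])
  \<comment> \<open>Up to the period, subtracting \<open>u\<close> is adding \<open>u\<close>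
    another \<open>P - 1\<close> times.\<close>
  have Adiff: "v - u \<in> A" if "u \<le> v" "u \<in> A" "v \<in> A" for u v
  proof -
    have "v + (P - 1) * u \<in> A" by (intro Aadd Amult that)
    moreover have "v + (P - 1) * u = (v - u) + P * u"
      using that(1) P0 by (cases P) (auto simp: algebra_simps)
    ultimately show ?thesis by (simp only: Aper)
  qed
  define a where "a = (LEAST a. a > 0 \<and> a \<in> A)"
  have PA: "P \<in> A" using Aper[of 0 1] A0 by simp
  have a: "a > 0" "a \<in> A" and amin: "\<And>z. z > 0 \<Longrightarrow> z \<in> A \<Longrightarrow> a \<le> z"
    using LeastI[of "\<lambda>a. a > 0 \<and> a \<in> A" P] PA P0 Least_le[of "\<lambda>a. a > 0 \<and> a \<in> A"]
    unfolding a_def by auto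
  have Aa: "z \<in> A \<longleftrightarrow> a dvd z" for z
  proof
    assume z: "z \<in> A"
    have "z - (z div a) * a \<in> A" by (intro Adiff z Amult a) simp
    hence "z mod a \<in> A" by (simp add: minus_div_mult_eq_mod)
    hence "z mod a = 0" using amin[of "z mod a"] a(1) by (metis mod_less_divisor not_gr_zero not_le)
    thus "a dvd z" by (rule mod_0_imp_dvd)
  next
    assume "a dvd z"
    then obtain m where "z = m * a" by (metis dvd_div_mult_self)
    thus "z \<in> A" using Amult[OF a(2)] by simp
  qed
  \<comment> \<open>\<open>a\<close> divides the period \<open>p ^ k\<close>, and
    \<open>a = 1\<close> is excluded by the zero \<open>y\<close>.\<close>
  have pa: "p dvd a"
  proof -
    have "a dvd p ^ k" using PA Aa by (simp add: P_def)
    then obtain i where i: "a = p ^ i" using divides_primepow_nat[OF prime_p] by blast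
    have "a \<noteq> 1" using y Aa[of y] by (auto simp: A_def)
    hence "i \<noteq> 0" using i by auto
    thus ?thesis using i by simp
  qed
  define H where "H = {h. h < P \<and> a dvd h}"
  have aP: "a dvd P" using PA Aa by simp
  have finH: "finite H" unfolding H_def by simp
  define c where "c = (\<Prod>h\<in>H. g h)"
  have c0: "c \<noteq> 0" unfolding c_def using finH by (auto simp: prod_zero_iff H_def Aa[symmetric] A_def)
  \<comment> \<open>The norm over all shifts by multiples of \<open>a\<close> within a period; such
    shifts are permuted by a further one, so the norm takes a single value \<open>c\<close> on the
    support.\<close>
  define N where "N z = (\<Prod>h\<in>H. g (z + h))" for z
  have NR: "N \<in> R" unfolding N_def by (intro R_prod finH R_shift gR)
  have N: "N z = (if a dvd z then c else 0)" for z
  proof (cases "a dvd z")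
    case False
    hence "g z = 0" using Aa by (auto simp: A_def)
    moreover have "0 \<in> H" using P0 by (simp add: H_def)
    ultimately show ?thesis using False finH unfolding N_def by (auto intro!: prod_zero bexI[of _ 0])
  next
    case True
    define \<pi> where "\<pi> h = (z + h) mod P" for h
    have inj: "inj_on \<pi> H"
    proof (rule inj_onI)
      fix h h' assume hh: "h \<in> H" "h' \<in> H" "\<pi> h = \<pi> h'"
      have "[z + h = z + h'] (mod P)" using hh(3) by (simp add: \<pi>_def cong_def)
      hence "[h = h'] (mod P)" by (simp add: cong_add_lcancel_nat)
      thus "h = h'" using hh(1,2) by (simp add: H_def cong_def)
    qed
    have "\<pi> ` H \<subseteq> H" using P0 True aP by (auto simp: \<pi>_def H_def dvd_mod)
    hence "bij_betw \<pi> H H" using inj finH by (simp add: bij_betw_def endo_inj_surj)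
    hence "(\<Prod>h\<in>H. g (\<pi> h)) = c" unfolding c_def by (rule prod.reindex_bij_betw)
    moreover have "g (\<pi> h) = g (z + h)" for h unfolding \<pi>_def by (rule permod[OF gper])
    ultimately show ?thesis using True by (simp add: N_def)
  qed
  have sumR: "finite_fps x" if "(\<lambda>z. if a dvd z then x else 0) \<in> R" for x
  proof -
    have "(\<lambda>z. \<Sum>j<a. if a dvd z + j then x else 0) \<in> R" by (intro R_sum R_shift[OF that]) simp
    thus ?thesis unfolding sum_dvd_shift[OF a(1)] by (rule constant_in_R)
  qed
  have "finite_fps c" using NR by (intro sumR) (simp add: N[abs_def])
  moreover have "finite_fps (c * theta_series p)"
  proof (rule sumR)
    \<comment> \<open>Where \<open>N\<close> does not vanish, \<open>z\<close> is a multiple of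
      \<open>a\<close> and hence of \<open>p\<close>, so the summand \<open>z\<close>
      disappears.\<close>
    have "N z * (theta_series p + of_nat z) = (if a dvd z then c * theta_series p else 0)" for z
    proof (cases "a dvd z")
      case True
      hence "p dvd z" using pa dvd_trans by blast
      then obtain m where "z = p * m" by blast
      hence "(of_nat z :: 'p mod_ring fps) = 0" by (simp add: of_nat_p_fps)
      thus ?thesis using True by (simp add: N)
    qed (simp add: N)
    moreover have "(\<lambda>z. N z * (theta_series p + of_nat z)) \<in> R" by (intro R_mult NR R_theta)
    ultimately show "(\<lambda>z. if a dvd z then c * theta_series p else 0) \<in> R" by simp
  qed
  ultimately show False using theta_irrational[OF c0] by blast
qed

end

section \<open>Linear independence of powers of the Artin--Hasse exponential\<close>

text \<open>Elimination without division keeps everything in \<open>L\<close>: a row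
  \<open>r\<close> with a nonzero entry at \<open>m\<close> removes the variable \<open>m\<close>
  from every row by cross multiplication. The given solution \<open>y\<close> in the large domain
  passes to the smaller system and keeps it nontrivially solvable.\<close>

lemma homogeneous_solution_in_subring:
  fixes L :: "'a::idom set"
  assumes L: "0 \<in> L" "1 \<in> L" "\<And>x y. x \<in> L \<Longrightarrow> y \<in> L \<Longrightarrow> x + y \<in> L"
      "\<And>x y. x \<in> L \<Longrightarrow> y \<in> L \<Longrightarrow> x - y \<in> L" "\<And>x y. x \<in> L \<Longrightarrow> y \<in> L \<Longrightarrow> x * y \<in> L"
    and "finite I"
  shows "(\<And>r i. r \<in> Rows \<Longrightarrow> i \<in> I \<Longrightarrow> r i \<in> L) \<Longrightarrow> (\<And>r. r \<in> Rows \<Longrightarrow> (\<Sum>i\<in>I. r i * y i) = 0) \<Longrightarrow>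
      \<exists>i\<in>I. y i \<noteq> 0 \<Longrightarrow>
      \<exists>Y. (\<forall>i\<in>I. Y i \<in> L) \<and> (\<exists>i\<in>I. Y i \<noteq> 0) \<and> (\<forall>r\<in>Rows. (\<Sum>i\<in>I. r i * Y i) = 0)"
  using \<open>finite I\<close>
proof (induction I arbitrary: Rows y rule: finite_induct)
  case empty thus ?case by simp
next
  case (insert m I Rows y)
  have sumL: "(\<Sum>i\<in>A. f i) \<in> L" if "\<And>i. i \<in> A \<Longrightarrow> f i \<in> L" for A and f :: "'b \<Rightarrow> 'a"
    using that by (induction A rule: infinite_finite_induct) (auto simp: L)
  have split: "(\<Sum>i\<in>insert m I. r i * w i) = r m * w m + (\<Sum>i\<in>I. r i * w i)" for r w :: "'b \<Rightarrow> 'a"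
    using insert.hyps by simp
  show ?case
  proof (cases "\<forall>r\<in>Rows. r m = 0")
    case True
    define Y where "Y i = (if i = m then 1 else 0 :: 'a)" for i
    have "(\<Sum>i\<in>insert m I. r i * Y i) = 0" if "r \<in> Rows" for r
    proof -
      have "(\<Sum>i\<in>I. r i * Y i) = 0" using insert.hyps by (intro sum.neutral) (auto simp: Y_def)
      thus ?thesis using True that by (simp only: split) simp
    qed
    thus ?thesis using L(1,2) by (intro exI[of _ Y]) (auto simp: Y_def)
  next
    case False
    then obtain r where r: "r \<in> Rows" "r m \<noteq> 0" by blast
    define t where "t s i = r m * s i - s m * r i" for s :: "'b \<Rightarrow> 'a" and i
    have rel: "(\<Sum>i\<in>I. s i * y i) = - (s m * y m)" if "s \<in> Rows" for s
      using insert.prems(2)[OF that] unfolding split by (simp add: eq_neg_iff_add_eq_0 add.commute)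
    have st: "(\<Sum>i\<in>I. t s i * w i) = r m * (\<Sum>i\<in>I. s i * w i) - s m * (\<Sum>i\<in>I. r i * w i)" for s w
      unfolding sum_distrib_left t_def by (simp add: algebra_simps sum_subtractf)
    have "\<exists>Y. (\<forall>i\<in>I. Y i \<in> L) \<and> (\<exists>i\<in>I. Y i \<noteq> 0) \<and> (\<forall>r\<in>t ` Rows. (\<Sum>i\<in>I. r i * Y i) = 0)"
    proof (rule insert.IH)
      fix u i assume "u \<in> t ` Rows" "i \<in> I"
      then obtain s where "s \<in> Rows" "u = t s" by blast
      thus "u i \<in> L" using insert.prems(1) r(1) \<open>i \<in> I\<close> by (auto simp: t_def intro!: L)
    next
      fix u assume "u \<in> t ` Rows"
      then obtain s where s: "s \<in> Rows" "u = t s" by blast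
      show "(\<Sum>i\<in>I. u i * y i) = 0" unfolding s(2) st rel[OF s(1)] rel[OF r(1)] by simp
    next
      \<comment> \<open>A solution concentrated on \<open>m\<close> is impossible because of the row
        \<open>r\<close>.\<close>
      show "\<exists>i\<in>I. y i \<noteq> 0"
      proof (rule ccontr)
        assume "\<not> (\<exists>i\<in>I. y i \<noteq> 0)"
        hence "r m * y m = 0" using rel[OF r(1)] by simp
        thus False using r(2) insert.prems(3) \<open>\<not> (\<exists>i\<in>I. y i \<noteq> 0)\<close> by auto
      qed
    qed
    then obtain Y where Y: "\<And>i. i \<in> I \<Longrightarrow> Y i \<in> L" "\<exists>i\<in>I. Y i \<noteq> 0"
      "\<And>s. s \<in> Rows \<Longrightarrow> (\<Sum>i\<in>I. t s i * Y i) = 0" by auto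
    define Y' where "Y' i = (if i = m then - (\<Sum>i\<in>I. r i * Y i) else r m * Y i)" for i
    have sY: "(\<Sum>i\<in>insert m I. s i * Y' i) = 0" if s: "s \<in> Rows" for s
    proof -
      have "(\<Sum>i\<in>I. s i * Y' i) = (\<Sum>i\<in>I. r m * (s i * Y i))"
        using insert.hyps by (intro sum.cong) (auto simp: Y'_def)
      also have "\<dots> = r m * (\<Sum>i\<in>I. s i * Y i)" by (simp add: sum_distrib_left)
      finally show ?thesis using Y(3)[OF s] unfolding split st by (simp add: Y'_def)
    qed
    have neg: "- x \<in> L" if "x \<in> L" for x using L(4)[OF L(1) that] by simp
    have "\<forall>i\<in>insert m I. Y' i \<in> L"
      using Y(1) insert.prems(1) r(1) by (auto simp: Y'_def intro!: neg sumL L(5))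
    moreover have "\<exists>i\<in>insert m I. Y' i \<noteq> 0"
      using Y(2) r(2) insert.hyps by (auto simp: Y'_def)
    ultimately show ?thesis using sY by blast
  qed
qed

section \<open>Projections onto residue classes of exponents\<close>

definition supp_dvd :: "nat \<Rightarrow> 'a::zero fps \<Rightarrow> bool" where
  "supp_dvd q h \<longleftrightarrow> (\<forall>n. \<not> q dvd n \<longrightarrow> h $ n = 0)"

definition fps_part :: "nat \<Rightarrow> nat \<Rightarrow> 'a::zero fps \<Rightarrow> 'a fps" where
  "fps_part q r f = Abs_fps (\<lambda>n. if n mod q = r then f $ n else 0)"

text \<open>A factor that is a series in \<open>X ^ q\<close> does not change exponents modulo
  \<open>q\<close>, so the projection is linear over such series.\<close>

lemma fps_part_mult:
  assumes "supp_dvd q h" shows "fps_part q r (f * h) = fps_part q r f * (h :: 'a::comm_ring_1 fps)"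
proof (rule fps_ext)
  fix n
  have "(if n mod q = r then f $ i * h $ (n - i) else 0) = (if i mod q = r then f $ i else 0) * h $ (n - i)"
    if "i \<in> {0..n}" for i
  proof (cases "q dvd n - i")
    case True
    then obtain t where "n - i = q * t" by blast
    hence "n = i + q * t" using that by simp
    hence "n mod q = i mod q" by simp
    thus ?thesis by simp
  next
    case False
    thus ?thesis using assms by (simp add: supp_dvd_def)
  qed
  hence "(\<Sum>i=0..n. if n mod q = r then f $ i * h $ (n - i) else 0) =
      (\<Sum>i=0..n. (if i mod q = r then f $ i else 0) * h $ (n - i))" by (rule sum.cong[OF refl])
  thus "fps_part q r (f * h) $ n = (fps_part q r f * h) $ n"
    by (cases "n mod q = r") (simp_all add: fps_part_def fps_mult_nth)
qed

lemma fps_part_sum: "fps_part q r (\<Sum>i\<in>A. f i) = (\<Sum>i\<in>A. fps_part q r (f i :: 'a::comm_ring_1 fps))"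
  by (rule fps_ext) (simp add: fps_part_def fps_sum_nth)

lemma fps_quotient_low_coeffs:
  fixes W e f :: "'a::comm_ring_1 fps"
  assumes W: "W * e = f" "e $ 0 = 1" and f: "\<And>n. n < s \<Longrightarrow> f $ n = 0"
  shows "n < s \<Longrightarrow> W $ n = 0" "W $ s = f $ s"
proof -
  have *: "W $ n = f $ n" if "\<And>i. i < n \<Longrightarrow> W $ i = 0" for n
  proof -
    have "f $ n = (\<Sum>i=0..n. W $ i * e $ (n - i))" unfolding W(1)[symmetric] fps_mult_nth ..
    also have "\<dots> = (\<Sum>i=0..n. if i = n then W $ n else 0)"
      by (intro sum.cong) (auto simp: W(2) that)
    finally show ?thesis by simp
  qed
  show 0: "W $ n = 0" if "n < s" for n
    using that
  proof (induction n rule: less_induct)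
    case (less n)
    thus ?case using *[of n] f[of n] by simp
  qed
  show "W $ s = f $ s" by (rule *) (rule 0)
qed

context char_p_base
begin

lemma of_nat_choose_prime_power:
  assumes "0 < i" "i < p ^ k" shows "p dvd (p ^ k choose i)"
proof (rule ccontr)
  assume "\<not> p dvd (p ^ k choose i)"
  hence cop: "coprime (p ^ k) (p ^ k choose i)" using prime_p by (simp add: prime_imp_coprime)
  have "p ^ k dvd i * (p ^ k choose i)"
    using times_binomial_minus1_eq[OF assms(1), of "p ^ k"] by simp
  hence "p ^ k dvd i" using cop by (simp add: coprime_dvd_mult_left_iff)
  thus False using assms by (auto dest: dvd_imp_le)
qed

text \<open>Modulo \<open>p\<close>, the binomials of \<open>q = p ^ k\<close> vanish except at both
  ends, so Vandermonde's identity makes the value periodic in \<open>m\<close> with period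
  \<open>q\<close>. Below \<open>q\<close>, only \<open>m = q - 1\<close> gives a nonzero value.
  This makes residue classes visible to the Euler operator.\<close>

lemma of_nat_choose_pred:
  "(of_nat (m choose (p ^ k - 1)) :: 'p mod_ring) = (if p ^ k dvd Suc m then 1 else 0)"
proof (induction m rule: less_induct)
  case (less m)
  define q where "q = p ^ k"
  have q: "q > 0" using p_pos by (simp add: q_def)
  show ?case
  proof (cases "m < q")
    case True
    show ?thesis
    proof (cases "m = q - 1")
      case False
      hence "Suc m < q" using True by simp
      hence "\<not> q dvd Suc m" using nat_dvd_not_less[of "Suc m" q] by simp
      moreover have eq: "m choose (q - 1) = 0" using True False by (intro binomial_eq_0) simp
      ultimately show ?thesis unfolding q_def[symmetric] eq by simp
    qed (use q in \<open>simp add: q_def[symmetric]\<close>)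
  next
    case False
    define m' where "m' = m - q"
    have m: "m = q + m'" using False by (simp add: m'_def)
    have "(\<Sum>i\<le>q - 1. (q choose i) * (m' choose (q - 1 - i))) = m choose (q - 1)"
      unfolding m by (rule vandermonde)
    hence "(of_nat (m choose (q - 1)) :: 'p mod_ring) =
       (\<Sum>i\<le>q - 1. of_nat (q choose i) * of_nat (m' choose (q - 1 - i)))"
      by (simp flip: of_nat_mult of_nat_sum)
    also have "\<dots> = (\<Sum>i\<le>q - 1. if i = 0 then of_nat (m' choose (q - 1)) else 0)"
    proof (rule sum.cong)
      fix i assume i: "i \<in> {..q - 1}"
      show "(of_nat (q choose i) * of_nat (m' choose (q - 1 - i)) :: 'p mod_ring)
          = (if i = 0 then of_nat (m' choose (q - 1)) else 0)"
      proof (cases "i = 0")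
        case False
        hence "p dvd (q choose i)" using i q unfolding q_def by (intro of_nat_choose_prime_power) auto
        hence "(of_nat (q choose i) :: 'p mod_ring) = 0"
          using of_nat_eq_0_iff_char_dvd[where 'a = "'p mod_ring"] card_p by simp
        thus ?thesis using False by simp
      qed simp
    qed simp
    also have "\<dots> = of_nat (m' choose (q - 1))" by simp
    also have "\<dots> = (if q dvd Suc m' then 1 else 0)"
      using less[of m'] q m unfolding q_def by simp
    also have "q dvd Suc m' \<longleftrightarrow> q dvd Suc m"
      unfolding m add_Suc_right[symmetric] by (rule dvd_add_triv_left_iff[symmetric])
    finally show ?thesis unfolding q_def .
  qed
qed

lemma tate_lift:
  assumes "finite_fps (c :: 'p mod_ring fps)" obtains c' where "tate c'" "red c' = c"
proof -
  \<comment> \<open>Zero has to be lifted to zero for the lift to remain a polynomial.\<close>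
  have "\<exists>i. c $ n = of_nat i \<and> (c $ n = 0 \<longrightarrow> i = 0)" for n
    using surj_of_nat_mod_ring[of "c $ n"] by (cases "c $ n = 0") (auto intro: exI[of _ 0])
  then obtain i where i: "\<And>n. c $ n = of_nat (i n)" "\<And>n. c $ n = 0 \<Longrightarrow> i n = 0" by metis
  define c' :: "rat fps" where "c' = Abs_fps (\<lambda>n. of_nat (i n))"
  have "fint c'" by (simp add: fint_def c'_def)
  moreover have "finite_fps c'" using assms i(2) unfolding finite_fps_def c'_def by fastforce
  ultimately have "tate c'" by (rule tate_finite)
  moreover have "red c' = c" by (rule fps_ext) (simp add: c'_def i(1))
  ultimately show ?thesis using that by blast
qed

text \<open>The converse of \<open>R_transfer\<close>: shifting carries a zero at \<open>z\<close>
  to all later branches, and one of these is identified with \<open>0\<close> by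
  periodicity.\<close>

lemma R_nonzero:
  assumes f: "f \<in> R" "f 0 \<noteq> 0" shows "f z \<noteq> 0"
proof
  assume "f z = 0"
  hence *: "f (w + z) = 0" for w using R_transfer[OF R_shift[OF f(1), of z], of w] by simp
  obtain k where k: "k > 0" "\<And>z. f (z + p ^ k) = f z" using R_periodic[OF f(1)] by blast
  have "f (p ^ k * m) = f 0" for m
  proof (induction m)
    case (Suc m)
    have "f (p ^ k * Suc m) = f (p ^ k * m + p ^ k)" by (simp add: add.commute)
    thus ?case using Suc k(2) by simp
  qed simp
  moreover have "f (p ^ k * z) = 0"
  proof -
    have "z \<le> p ^ k * z" using p_pos by simp
    hence "p ^ k * z = (p ^ k * z - z) + z" by simp
    thus ?thesis using * by metis
  qed
  ultimately show False using f(2) by simp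
qed

text \<open>A number with two digits: modulo \<open>p ^ (k - l)\<close> it determines
  \<open>s\<close>, which lies below that modulus, and what remains determines \<open>b\<close>
  modulo \<open>p ^ l\<close>.\<close>

lemma distinct_valuations:
  fixes s s' b b' :: nat
  assumes "l \<le> k" "s < p ^ (k - l)" "s' < p ^ (k - l)" "\<not> [b = b'] (mod p ^ l)"
  shows "(s + p ^ (k - l) * b) mod p ^ k \<noteq> (s' + p ^ (k - l) * b') mod p ^ k"
proof
  define z where "z = p ^ (k - l)"
  assume "(s + p ^ (k - l) * b) mod p ^ k = (s' + p ^ (k - l) * b') mod p ^ k"
  hence eq: "[s + z * b = s' + z * b'] (mod z * p ^ l)"
    using assms(1) by (simp add: cong_def z_def flip: power_add)
  hence "[s + z * b = s' + z * b'] (mod z)" by (rule cong_dvd_modulus_nat) simp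
  hence "s mod z = s' mod z" by (simp add: cong_def)
  hence "s = s'" using assms(2,3) by (simp add: z_def)
  hence "[z * b = z * b'] (mod z * p ^ l)" using eq by (simp add: cong_add_lcancel_nat)
  moreover have "z > 0" using p_pos by (simp add: z_def)
  ultimately have "[b = b'] (mod p ^ l)" by (simp add: cong_def)
  thus False using assms(4) by blast
qed

text \<open>The relation gives a homogeneous linear system over \<open>R\<close>, evaluated at the branch \<open>0\<close>. A solution
  in \<open>R\<close> is transported to the branch \<open>z = p ^ (k - l)\<close>, where the terms have different valuations
  modulo \<open>p ^ k\<close>.\<close>
lemma powers_independent:
  fixes c y h :: "'i \<Rightarrow> 'p mod_ring fps"
  assumes M: "finite M" "M \<noteq> {}" and l: "l \<le> k"
    and c: "\<And>m. m \<in> M \<Longrightarrow> finite_fps (c m)" "\<And>m. m \<in> M \<Longrightarrow> c m \<noteq> 0"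
      "\<And>m. m \<in> M \<Longrightarrow> subdegree (c m) < p ^ (k - l)"
    and b: "\<And>m m'. m \<in> M \<Longrightarrow> m' \<in> M \<Longrightarrow> m \<noteq> m' \<Longrightarrow> \<not> [b m = b m'] (mod p ^ l)"
    and y: "\<And>m. m \<in> M \<Longrightarrow> y m = Eb ^ b m * h m" "\<And>m. m \<in> M \<Longrightarrow> supp_dvd (p ^ k) (h m)"
      "\<And>m. m \<in> M \<Longrightarrow> y m \<noteq> 0"
  shows "(\<Sum>m\<in>M. c m * y m) \<noteq> 0"
proof
  assume rel: "(\<Sum>m\<in>M. c m * y m) = 0"
  define q where "q = p ^ k"
  have q: "q > 0" using p_pos by (simp add: q_def)
  \<comment> \<open>The binomial of order \<open>q - 1\<close> detects multiples of \<open>q\<close>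
    after adding \<open>1\<close>; the shift \<open>s = q - 1 - r\<close> turns this into detection
    of the residue \<open>r\<close>.\<close>
  have "\<exists>W. W \<in> R \<and> (\<forall>z n. (W z * Eb ^ b m) $ n = (if (n + z * b m) mod q = r then (c m * Eb ^ b m) $ n else 0))"
    if m: "m \<in> M" and r: "r < q" for m r
  proof -
    obtain c' where c': "tate c'" "red c' = c m" using tate_lift c(1)[OF m] by blast
    obtain W where W: "W \<in> R" "\<And>z n. (W z * Eb ^ b m) $ n =
        of_nat ((n + z * b m + (q - 1 - r)) choose (q - 1)) * (red c' * Eb ^ b m) $ n"
      using R_Vpoly[OF c'(1), of "b m" "q - 1 - r" "q - 1"] by blast
    have "q dvd Suc (x + (q - 1 - r)) \<longleftrightarrow> x mod q = r" for x
    proof -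
      have "Suc (x + (q - 1 - r)) = x + (q - r)" using r by simp
      moreover have "q dvd x + (q - r) \<longleftrightarrow> x mod q = r"
      proof
        assume "q dvd x + (q - r)"
        then obtain t where t: "x + (q - r) = q * t" by blast
        have "(x + q) mod q = (q * t + r) mod q" using t r by (metis add.assoc le_add_diff_inverse2 less_imp_le)
        thus "x mod q = r" using r by simp
      next
        assume "x mod q = r"
        hence "x = q * (x div q) + r" by (metis mult_div_mod_eq)
        hence "x + (q - r) = q * (x div q) + q" using r by linarith
        thus "q dvd x + (q - r)" by simp
      qed
      ultimately show ?thesis by (simp only:)
    qed
    hence "(of_nat ((x + (q - 1 - r)) choose (q - 1)) :: 'p mod_ring) = (if x mod q = r then 1 else 0)" for x
      using of_nat_choose_pred[of "x + (q - 1 - r)" k] unfolding q_def by simp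
    hence "(W z * Eb ^ b m) $ n = (if (n + z * b m) mod q = r then (c m * Eb ^ b m) $ n else 0)" for z n
      unfolding W(2) c'(2) by simp
    thus ?thesis using W(1) by blast
  qed
  then obtain W where WR: "\<And>m r. m \<in> M \<Longrightarrow> r < q \<Longrightarrow> W m r \<in> R"
    and W: "\<And>m r z n. m \<in> M \<Longrightarrow> r < q \<Longrightarrow>
      (W m r z * Eb ^ b m) $ n = (if (n + z * b m) mod q = r then (c m * Eb ^ b m) $ n else 0)"
    by metis
  \<comment> \<open>The given relation lives on the branch \<open>0\<close> only, so the system is
    formed from the values there.\<close>
  define L where "L = (\<lambda>f. f 0) ` R"
  have "\<exists>Y. (\<forall>m\<in>M. Y m \<in> L) \<and> (\<exists>m\<in>M. Y m \<noteq> 0) \<and>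
      (\<forall>\<rho>\<in>(\<lambda>r m. W m r 0) ` {..<q}. (\<Sum>m\<in>M. \<rho> m * Y m) = 0)"
  proof (rule homogeneous_solution_in_subring[where y = y])
    show "0 \<in> L" "1 \<in> L" unfolding L_def using R_0 R_1 by (auto intro: rev_image_eqI)
    show "u + v \<in> L" "u - v \<in> L" "u * v \<in> L" if "u \<in> L" "v \<in> L" for u v
      using that unfolding L_def by (auto intro: rev_image_eqI[OF R_add] rev_image_eqI[OF R_diff] rev_image_eqI[OF R_mult])
    show "\<rho> m \<in> L" if "\<rho> \<in> (\<lambda>r m. W m r 0) ` {..<q}" "m \<in> M" for \<rho> m
      using that WR unfolding L_def by auto
    show "\<exists>m\<in>M. y m \<noteq> 0" using M(2) y(3) by blast
    fix \<rho> assume "\<rho> \<in> (\<lambda>r m. W m r 0) ` {..<q}"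
    then obtain r where r: "r < q" "\<rho> = (\<lambda>m. W m r 0)" by blast
    \<comment> \<open>The factor \<open>h m\<close> is a series in \<open>X ^ q\<close> and passes
      through the projection. So the rows of the system are the projections of the given relation,
      with \<open>y\<close> as a solution.\<close>
    have "W m r 0 * y m = fps_part q r (c m * y m)" if m: "m \<in> M" for m
    proof -
      have "W m r 0 * Eb ^ b m = fps_part q r (c m * Eb ^ b m)"
        by (rule fps_ext) (simp add: W[OF m r(1)] fps_part_def)
      hence "W m r 0 * y m = fps_part q r (c m * Eb ^ b m) * h m"
        unfolding y(1)[OF m] by (simp only: mult.assoc[symmetric])
      also have "\<dots> = fps_part q r (c m * Eb ^ b m * h m)"
        using y(2)[OF m] by (subst fps_part_mult) (simp_all add: q_def)
      finally show ?thesis unfolding y(1)[OF m] by (simp only: mult.assoc)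
    qed
    hence "(\<Sum>m\<in>M. \<rho> m * y m) = (\<Sum>m\<in>M. fps_part q r (c m * y m))" unfolding r(2) by (intro sum.cong) auto
    also have "\<dots> = fps_part q r 0" unfolding fps_part_sum[symmetric] rel ..
    also have "\<dots> = 0" by (rule fps_ext) (simp add: fps_part_def)
    finally show "(\<Sum>m\<in>M. \<rho> m * y m) = 0" .
  qed (rule M(1))
  then obtain Y where Y: "\<And>m. m \<in> M \<Longrightarrow> Y m \<in> L" "\<exists>m\<in>M. Y m \<noteq> 0"
    "\<And>r. r < q \<Longrightarrow> (\<Sum>m\<in>M. W m r 0 * Y m) = 0" by auto
  have "\<exists>g. g \<in> R \<and> Y m = g 0" if "m \<in> M" for m using Y(1)[OF that] unfolding L_def by blast
  then obtain g where g: "\<And>m. m \<in> M \<Longrightarrow> g m \<in> R" "\<And>m. m \<in> M \<Longrightarrow> Y m = g m 0" by metis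
  define z where "z = p ^ (k - l)"
  have sum0: "(\<Sum>m\<in>M. W m r z * g m z) = 0" if r: "r < q" for r
  proof -
    have "(\<lambda>z. \<Sum>m\<in>M. W m r z * g m z) \<in> R"
      by (intro R_sum[OF M(1)] R_mult WR g r)
    moreover have "(\<Sum>m\<in>M. W m r 0 * g m 0) = 0"
    proof -
      have "(\<Sum>m\<in>M. W m r 0 * g m 0) = (\<Sum>m\<in>M. W m r 0 * Y m)"
        by (intro sum.cong refl) (simp add: g(2))
      thus ?thesis using Y(3)[OF r] by simp
    qed
    ultimately show ?thesis by (rule R_transfer)
  qed
  define M' where "M' = {m \<in> M. g m z \<noteq> 0}"
  have M': "finite M'" "M' \<noteq> {}"
  proof -
    show "finite M'" using M(1) by (simp add: M'_def)
    obtain m where "m \<in> M" "Y m \<noteq> 0" using Y(2) by blast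
    hence "m \<in> M'" using R_nonzero[OF g(1)] g(2) by (simp add: M'_def)
    thus "M' \<noteq> {}" by blast
  qed
  define s where "s m = subdegree (c m)" for m
  define u where "u m = s m + subdegree (g m z)" for m
  \<comment> \<open>\<open>u m\<close> is the lowest exponent possible in the term of
    \<open>m\<close>. For a term where it is least, \<open>r\<close> below is the row in which the
    lowest coefficient of \<open>W m0 r z\<close> is kept.\<close>
  obtain m0 where m0: "m0 \<in> M'" "\<And>m. m \<in> M' \<Longrightarrow> u m0 \<le> u m"
    using ex_is_arg_min_if_finite[OF M', of u] unfolding is_arg_min_linorder by blast
  have m0M: "m0 \<in> M" using m0(1) by (simp add: M'_def)
  define r where "r = (s m0 + z * b m0) mod q"
  have r: "r < q" using q by (simp add: r_def)
  \<comment> \<open>For \<open>m \<noteq> m0\<close> the lowest exponent \<open>s m\<close> is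
    displaced to another residue class than \<open>r\<close>, so its coefficient is killed and the
    term of \<open>m\<close> starts beyond \<open>u m\<close>.\<close>
  have Wm: "(\<forall>n. n < s m \<longrightarrow> W m r z $ n = 0) \<and> W m r z $ s m = (if m = m0 then c m $ s m else 0)"
    if m: "m \<in> M" for m
  proof -
    define F where "F = W m r z * Eb ^ b m"
    have Fn: "F $ n = (if (n + z * b m) mod q = r then (c m * Eb ^ b m) $ n else 0)" for n
      unfolding F_def by (rule W[OF m r])
    have E0: "(Eb ^ b m) $ 0 = 1" by (simp add: fps_nth_power_0)
    have low: "c m $ i = 0" if "i < s m" for i
      using that unfolding s_def by (rule nth_less_subdegree_zero)
    have cE: "(c m * Eb ^ b m) $ n = (if n = s m then c m $ s m else 0)" if "n \<le> s m" for n
    proof -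
      have "(c m * Eb ^ b m) $ n = (\<Sum>i=0..n. if i = n then c m $ n else 0)"
        unfolding fps_mult_nth
      proof (rule sum.cong)
        fix i assume "i \<in> {0..n}"
        show "c m $ i * (Eb ^ b m) $ (n - i) = (if i = n then c m $ n else 0)"
        proof (cases "i = n")
          case True thus ?thesis using E0 by simp
        next
          case False
          hence "c m $ i = 0" using low \<open>i \<in> {0..n}\<close> that by simp
          thus ?thesis using False by simp
        qed
      qed simp
      thus ?thesis using that low[of n] by (cases "n = s m") simp_all
    qed
    have F0: "F $ n = 0" if "n < s m" for n using Fn[of n] cE[of n] that by simp
    from fps_quotient_low_coeffs[OF F_def[symmetric] E0 F0]
    have *: "\<And>n. n < s m \<Longrightarrow> W m r z $ n = 0" "W m r z $ s m = F $ s m" by blast+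
    have "F $ s m = (if m = m0 then c m $ s m else 0)"
    proof (cases "m = m0")
      case True
      thus ?thesis using Fn[of "s m"] cE[of "s m"] by (simp add: r_def)
    next
      case False
      have "(s m + z * b m) mod q \<noteq> r"
        unfolding r_def q_def z_def s_def
        using distinct_valuations[OF l c(3) c(3) b] False m0M that by blast
      thus ?thesis using False Fn[of "s m"] by simp
    qed
    thus ?thesis using * by simp
  qed
  have coeff_term: "(W m r z * g m z) $ u m0 = (if m = m0 then c m $ s m * g m z $ subdegree (g m z) else 0)"
    if m: "m \<in> M" for m
  proof (cases "g m z = 0")
    case True
    hence "m \<noteq> m0" using m0(1) by (auto simp: M'_def)
    thus ?thesis using True by simp
  next
    case False
    hence um: "u m0 \<le> u m" using m m0(2) by (simp add: M'_def)
    have "(W m r z * g m z) $ u m0 = (\<Sum>i=0..u m0. if i = s m then (if m = m0 then c m $ s m * g m z $ subdegree (g m z) else 0) else 0)"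
      unfolding fps_mult_nth
    proof (rule sum.cong)
      fix i assume i: "i \<in> {0..u m0}"
      show "W m r z $ i * g m z $ (u m0 - i) = (if i = s m then (if m = m0 then c m $ s m * g m z $ subdegree (g m z) else 0) else 0)"
      proof (cases i "s m" rule: linorder_cases)
        case less thus ?thesis using Wm[OF m] by simp
      next
        case equal
        thus ?thesis using Wm[OF m] by (auto simp: u_def)
      next
        case greater
        hence "u m0 - i < subdegree (g m z)" using um i by (auto simp: u_def)
        hence "g m z $ (u m0 - i) = 0" by (rule nth_less_subdegree_zero)
        thus ?thesis using greater by simp
      qed
    qed simp
    thus ?thesis by (auto simp: u_def)
  qed
  have "(\<Sum>m\<in>M. W m r z * g m z) $ u m0 = (\<Sum>m\<in>M. if m = m0 then c m0 $ s m0 * g m0 z $ subdegree (g m0 z) else 0)"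
    unfolding fps_sum_nth by (intro sum.cong refl) (simp add: coeff_term)
  also have "\<dots> = c m0 $ s m0 * g m0 z $ subdegree (g m0 z)" using M(1) m0M by simp
  also have "\<dots> \<noteq> 0" using c(2)[OF m0M] m0(1) by (simp add: s_def M'_def)
  finally show False using sum0[OF r] by simp
qed

end

section \<open>Cyclotomic polynomials\<close>


definition ipev :: "int poly \<Rightarrow> complex \<Rightarrow> complex" where
  "ipev f z = poly (map_poly of_int f) z"

lemma ipev_add [simp]: "ipev (f + g) z = ipev f z + ipev g z"
  and ipev_diff [simp]: "ipev (f - g) z = ipev f z - ipev g z"
  and ipev_mult [simp]: "ipev (f * g) z = ipev f z * ipev g z"
  and ipev_power [simp]: "ipev (f ^ k) z = ipev f z ^ k"
  and ipev_smult [simp]: "ipev (smult c f) z = of_int c * ipev f z"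
  and ipev_pCons [simp]: "ipev (pCons c f) z = of_int c + z * ipev f z"
  and ipev_0 [simp]: "ipev 0 z = 0"
  and ipev_1 [simp]: "ipev 1 z = 1"
  by (simp_all add: ipev_def hom_distribs)

lemma ipev_monom [simp]: "ipev (monom 1 k) z = z ^ k"
  by (simp add: ipev_def map_poly_monom poly_monom)

lemma ipev_pcompose: "ipev (pcompose f g) z = ipev f (ipev g z)"
  by (induction f) (simp_all add: pcompose_pCons)

lemma add_power_prime:
  fixes x y :: "'a::comm_ring_1"
  assumes "prime q"
  shows "\<exists>s. (x + y) ^ q = x ^ q + y ^ q + of_nat q * s"
proof -
  define c where "c k = (q choose k) div q" for k
  have c: "q choose k = q * c k" if "0 < k" "k < q" for k
    using dvd_choose_prime[of k q] that assms by (auto simp: c_def)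
  have q: "q > 0" using assms prime_gt_0_nat by blast
  have "(x + y) ^ q = (\<Sum>k\<le>q. of_nat (q choose k) * x ^ k * y ^ (q - k))"
    by (rule binomial_ring)
  also have "{..q} = insert 0 (insert q {0<..<q})" using q by auto
  also have "(\<Sum>k\<in>\<dots>. of_nat (q choose k) * x ^ k * y ^ (q - k))
     = y ^ q + (x ^ q + (\<Sum>k\<in>{0<..<q}. of_nat (q choose k) * x ^ k * y ^ (q - k)))"
    using q by simp
  also have "(\<Sum>k\<in>{0<..<q}. of_nat (q choose k) * x ^ k * y ^ (q - k))
     = of_nat q * (\<Sum>k\<in>{0<..<q}. of_nat (c k) * x ^ k * y ^ (q - k))"
    unfolding sum_distrib_left by (intro sum.cong refl) (simp add: c mult.assoc)
  finally have "(x + y) ^ q = x ^ q + y ^ q + of_nat q * (\<Sum>k\<in>{0<..<q}. of_nat (c k) * x ^ k * y ^ (q - k))"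
    by (simp only: add_ac)
  thus ?thesis by blast
qed

text \<open>Frobenius modulo \<open>q\<close> for integer polynomials; Fermat's little theorem takes
  care of the coefficients.\<close>

lemma pcompose_monom_prime:
  fixes f :: "int poly"
  assumes q: "prime q"
  shows "\<exists>s. pcompose f (monom 1 q) = f ^ q + smult (int q) s"
proof (induction f)
  case 0
  have "q > 0" using q prime_gt_0_nat by blast
  thus ?case by (intro exI[of _ 0]) simp
next
  case (pCons a f)
  then obtain s where s: "pcompose f (monom 1 q) = f ^ q + smult (int q) s" by blast
  obtain t where t: "([:a:] + [:0, 1:] * f) ^ q = [:a:] ^ q + ([:0, 1:] * f) ^ q + of_nat q * t"
    using add_power_prime[OF q] by blast
  have "int q dvd a ^ q - a"
  proof -
    define m where "m = nat (a mod int q)"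
    have q0: "q > 0" using q prime_gt_0_nat by blast
    have m: "[a = int m] (mod int q)" using q0 by (simp add: m_def cong_def)
    have "[m ^ q = m] (mod q)"
    proof (cases "q dvd m")
      case True
      hence "q dvd m ^ q" using q0 dvd_power[of q m] dvd_trans by blast
      thus ?thesis using True by (metis cong_0_iff cong_sym cong_trans)
    next
      case False
      have "[m * m ^ (q - 1) = m * 1] (mod q)"
        by (rule cong_scalar_left[OF fermat_theorem[OF q False]])
      moreover have "m * m ^ (q - 1) = m ^ q" using q0 by (metis power_minus_mult mult.commute)
      ultimately show ?thesis by simp
    qed
    hence "[int m ^ q = int m] (mod int q)" by (simp flip: cong_int_iff of_nat_power)
    hence "[a ^ q = a] (mod int q)" using m by (meson cong_pow cong_sym cong_trans)
    thus ?thesis by (simp add: cong_iff_dvd_diff)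
  qed
  then obtain b where b: "a ^ q = a + int q * b" by (metis diff_add_cancel add.commute dvdE)
  have X: "[:0, 1:] ^ q = monom (1::int) q" by (metis monom_altdef smult_1_left)
  have C: "[:a:] ^ q = [:a ^ q:]" by (simp add: poly_const_pow)
  have N: "of_nat q * t = smult (int q) t" by (simp add: of_nat_poly)
  have "pCons a f = [:a:] + [:0, 1:] * f" by simp
  hence "pCons a f ^ q = [:a ^ q:] + monom 1 q * f ^ q + smult (int q) t"
    using t unfolding power_mult_distrib X C N by metis
  moreover have "pcompose (pCons a f) (monom 1 q) = [:a:] + monom 1 q * (f ^ q + smult (int q) s)"
    by (simp add: pcompose_pCons s)
  ultimately have "pcompose (pCons a f) (monom 1 q) =
     pCons a f ^ q + smult (int q) (monom 1 q * s - t - [:b:])"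
    by (simp add: b smult_diff_right smult_add_right algebra_simps)
  thus ?case by blast
qed

text \<open>Gauss' lemma: coprimality over the integers is coprimality over the rationals, where a
  Bezout identity is available.\<close>
lemma irreducible_dvd_or_bezout:
  fixes f g :: "int poly"
  assumes "irreducible f"
  shows "f dvd g \<or> (\<exists>u v r. r \<noteq> 0 \<and> u * f + v * g = [:r:])"
proof (cases "f dvd g")
  case False
  have "is_unit (gcd f g)"
  proof -
    have "gcd f g dvd f" by simp
    with assms have "is_unit (gcd f g) \<or> f dvd gcd f g"
      using irreducible_altdef by (metis dvd_mult_unit_iff' irreducibleD dvd_def mult.commute)
    thus ?thesis using False dvd_trans gcd_dvd2 by blast
  qed
  hence g1: "gcd f g = 1" by (metis is_unit_gcd coprime_iff_gcd_eq_1)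
  define F G where "F = (map_poly rat_of_int f)" and "G = (map_poly rat_of_int g)"
  have "gcd F G = 1" unfolding F_def G_def gcd_rat_to_gcd_int g1 by simp
  then obtain u v where uv: "u * F + v * G = 1"
    using bezout_coefficients_fst_snd[of F G] by metis
  obtain d u' where u': "rat_to_int_poly u = (d, u')" by force
  obtain e v' where v': "rat_to_int_poly v = (e, v')" by force
  have u: "u = smult (inverse (of_int d)) (map_poly of_int u')" "d > 0"
    using rat_to_int_poly[OF u'] by auto
  have v: "v = smult (inverse (of_int e)) (map_poly of_int v')" "e > 0"
    using rat_to_int_poly[OF v'] by auto
  have du: "smult (of_int d) u = map_poly of_int u'" and ev: "smult (of_int e) v = map_poly of_int v'"
    using u v by simp_all
  have "smult (of_int (d * e)) (u * F + v * G) =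
      smult (of_int e) (smult (of_int d) u * F) + smult (of_int d) (smult (of_int e) v * G)"
    by (simp add: smult_add_right mult.commute)
  also have "\<dots> = map_poly rat_of_int (smult e u' * f + smult d v' * g)"
    unfolding du ev F_def G_def by (simp add: hom_distribs)
  also have "smult (of_int (d * e)) (u * F + v * G) = map_poly rat_of_int [:d * e:]"
    unfolding uv one_pCons using u(2) v(2) by (simp del: pCons_one)
  finally have "[:d * e:] = smult e u' * f + smult d v' * g"
    by (metis of_int_poly_hom.injectivity)
  thus ?thesis using u(2) v(2) by (intro disjI2 exI[of _ "smult e u'"] exI[of _ "smult d v'"] exI[of _ "d * e"]) auto
qed auto

text \<open>The alternative to divisibility is a nonzero integer constant in the ideal of
  \<open>f\<close> and \<open>g\<close>, which cannot vanish at \<open>z\<close>.\<close>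

lemma irreducible_dvd_of_common_root:
  assumes "irreducible f" "ipev f z = 0" "ipev g z = 0"
  shows "f dvd g"
proof (rule ccontr)
  assume "\<not> f dvd g"
  then obtain u v r where r: "r \<noteq> 0" "u * f + v * g = [:r:]"
    using irreducible_dvd_or_bezout[OF assms(1)] by blast
  have "ipev (u * f + v * g) z = 0" using assms by simp
  thus False using r by simp
qed

text \<open>If \<open>f\<close> did not vanish at \<open>z ^ q\<close>, the derivative of \<open>X ^ n - 1\<close> there would put
  \<open>n\<close> into the ideal generated by \<open>q\<close> in \<open>\<int>[z]\<close>.\<close>
lemma prime_power_root:
  assumes f: "irreducible f" "lead_coeff f = 1" "f * h = monom 1 n - 1" "degree f > 0"
    and q: "prime q" "\<not> q dvd n" and z: "ipev f z = 0"
  shows "ipev f (z ^ q) = 0"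
proof (rule ccontr)
  assume nz: "ipev f (z ^ q) \<noteq> 0"
  have n: "n > 0" using q(2) by (cases n) auto
  have "ipev (f * h) z = 0" using z by simp
  hence zn: "z ^ n = 1" unfolding f(3) by simp
  have "ipev (f * h) (z ^ q) = 0" unfolding f(3) using zn
    by (simp add: mult.commute[of q] power_mult flip: power_mult) (metis power_mult power_one mult.commute)
  hence h0: "ipev h (z ^ q) = 0" using nz by simp
  have "pderiv (f * h) = monom (int n) (n - 1)" unfolding f(3) by (simp add: pderiv_diff pderiv_monom pderiv_1)
  hence "f * pderiv h + h * pderiv f = smult (int n) (monom 1 (n - 1))"
    by (simp add: pderiv_mult smult_monom)
  hence "ipev (f * pderiv h + h * pderiv f) (z ^ q) = ipev (smult (int n) (monom 1 (n - 1))) (z ^ q)" by simp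
  hence der: "ipev f (z ^ q) * ipev (pderiv h) (z ^ q) = of_nat n * (z ^ q) ^ (n - 1)"
    using h0 by simp
  obtain s where s: "pcompose f (monom 1 q) = f ^ q + smult (int q) s"
    using pcompose_monom_prime[OF q(1)] by blast
  have "ipev (pcompose f (monom 1 q)) z = ipev (f ^ q + smult (int q) s) z" by (simp only: s)
  hence fz: "ipev f (z ^ q) = of_nat q * ipev s z"
    using z q(1) prime_gt_0_nat[of q] by (simp add: ipev_pcompose)
  define T where "T = monom 1 q * s * pcompose (pderiv h) (monom 1 q)"
  have "(z ^ q) * (z ^ q) ^ (n - 1) = 1"
    using zn n by (metis power_Suc Suc_pred' power_commutes power_mult power_one mult.commute)
  \<comment> \<open>The extra factor \<open>z ^ q\<close> completes the power of this root of unity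
    to \<open>1\<close>, so that \<open>n\<close> itself remains.\<close>
  hence "of_nat n = z ^ q * (ipev f (z ^ q) * ipev (pderiv h) (z ^ q))"
    unfolding der by (simp add: mult.left_commute)
  also have "\<dots> = of_nat q * ipev T z"
    unfolding fz T_def by (simp add: ipev_pcompose)
  finally have "ipev ([:int n:] - smult (int q) T) z = 0" by simp
  then obtain W where W: "[:int n:] - smult (int q) T = f * W"
    using irreducible_dvd_of_common_root[OF f(1) z] by (meson dvdE)
  \<comment> \<open>Consider the highest coefficient of \<open>W\<close> not divisible by
    \<open>q\<close>. As \<open>f\<close> is monic, it survives modulo \<open>q\<close> in the
    coefficient \<open>d + m\<close> of \<open>f * W\<close>; but beyond degree \<open>0\<close> all
    coefficients of that product are divisible by \<open>q\<close>.\<close>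
  define J where "J = {j. \<not> int q dvd coeff W j}"
  have J0: "J \<noteq> {}"
  proof
    assume "J = {}"
    hence *: "int q dvd coeff W j" for j by (auto simp: J_def)
    have "int n = coeff (f * W) 0 + int q * coeff T 0" unfolding W[symmetric] by simp
    also have "int q dvd \<dots>" by (auto simp: coeff_mult *)
    finally show False using q(2) by simp
  qed
  have "finite J"
  proof (rule finite_subset)
    show "J \<subseteq> {..degree W}"
    proof
      fix j assume "j \<in> J"
      hence "coeff W j \<noteq> 0" by (auto simp: J_def)
      thus "j \<in> {..degree W}" using le_degree by simp
    qed
  qed simp
  define m where "m = Max J"
  have m: "m \<in> J" "\<And>j. j \<in> J \<Longrightarrow> j \<le> m" using J0 \<open>finite J\<close> by (auto simp: m_def)
  define d where "d = degree f"
  have "int q dvd coeff (f * W) (d + m)"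
  proof -
    have "coeff (f * W) (d + m) = - (int q * coeff T (d + m))"
      unfolding W[symmetric] using f(4) by (simp add: d_def coeff_pCons split: nat.split)
    thus ?thesis by simp
  qed
  moreover have "coeff (f * W) (d + m) = coeff W m + (\<Sum>i\<in>{..d + m} - {d}. coeff f i * coeff W (d + m - i))"
  proof -
    have "coeff (f * W) (d + m) = (\<Sum>i\<in>{..d + m}. coeff f i * coeff W (d + m - i))"
      by (simp add: coeff_mult)
    also have "\<dots> = coeff f d * coeff W (d + m - d) + (\<Sum>i\<in>{..d + m} - {d}. coeff f i * coeff W (d + m - i))"
      by (rule sum.remove) auto
    finally show ?thesis using f(2) by (simp add: d_def)
  qed
  moreover have "int q dvd (\<Sum>i\<in>{..d + m} - {d}. coeff f i * coeff W (d + m - i))"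
  proof (rule dvd_sum)
    fix i assume i: "i \<in> {..d + m} - {d}"
    show "int q dvd coeff f i * coeff W (d + m - i)"
    proof (cases "i < d")
      case True
      hence "\<not> d + m - i \<le> m" by simp
      hence "d + m - i \<notin> J" using m(2) by blast
      thus ?thesis by (simp add: J_def)
    next
      case False
      hence "coeff f i = 0" using i by (intro coeff_eq_0) (auto simp: d_def)
      thus ?thesis by simp
    qed
  qed
  ultimately have "int q dvd coeff W m" by (metis dvd_add_left_iff)
  thus False using m(1) by (simp add: J_def)
qed

text \<open>One prime factor of \<open>j\<close> is stripped at a time. The root changes on the way,
  so the induction is over arbitrary \<open>z\<close>.\<close>

lemma coprime_power_root:
  assumes f: "irreducible f" "lead_coeff f = 1" "f * h = monom 1 n - 1" "degree f > 0"
    and j: "coprime j n" "j > 0" and z: "ipev f z = 0"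
  shows "ipev f (z ^ j) = 0"
  using j z
proof (induction j arbitrary: z rule: less_induct)
  case (less j)
  show ?case
  proof (cases "j = 1")
    case False
    then obtain q where q: "prime q" "q dvd j" using prime_factor_nat by blast
    then obtain m where m: "j = q * m" by blast
    have q1: "q > 1" using q(1) prime_gt_1_nat by blast
    have m0: "m > 0" "m < j" using m less.prems(2) q1 by auto
    have "coprime m n" "coprime q n" using less.prems(1) m by auto
    have "\<not> q dvd n"
    proof
      assume "q dvd n"
      hence "is_unit q" using coprime_common_divisor[OF \<open>coprime q n\<close> dvd_refl] by blast
      thus False using q1 by simp
    qed
    from prime_power_root[OF f q(1) this less.prems(3)] have "ipev f (z ^ q) = 0" .
    from less.IH[OF m0(2) \<open>coprime m n\<close> m0(1) this] show ?thesis
      by (simp add: m power_mult)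
  qed (use less.prems in simp)
qed

text \<open>The degree counts the complex roots, which are simple because those of
  \<open>X ^ n - 1\<close> are. The hypothesis on \<open>d\<close> makes every root a primitive
  \<open>n\<close>-th root of unity, and the powers of one root with exponents prime to
  \<open>n\<close> are roots again.\<close>

lemma degree_eq_totient:
  fixes f h :: "int poly"
  assumes f: "irreducible f" "lead_coeff f = 1" "f * h = monom 1 n - 1" "n > 0"
    and prim: "\<And>d. 0 < d \<Longrightarrow> d < n \<Longrightarrow> \<not> f dvd monom 1 d - 1"
  shows "degree f = totient n"
proof -
  have deg: "degree f > 0"
  proof (rule ccontr)
    assume "\<not> degree f > 0"
    then obtain c where "f = [:c:]" by (metis degree_eq_zeroE not_gr_zero)
    hence "f = 1" using f(2) by simp
    thus False using f(1) by simp
  qed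
  define Z where "Z = {z. ipev f z = 0}"
  have zn: "z ^ n = 1" if "z \<in> Z" for z
  proof -
    have "ipev (f * h) z = 0" using that by (simp add: Z_def)
    thus ?thesis unfolding f(3) by simp
  qed
  have primitive: "z ^ d \<noteq> 1" if "z \<in> Z" "0 < d" "d < n" for z d
  proof
    assume "z ^ d = 1"
    hence "ipev (monom 1 d - 1) z = 0" by simp
    hence "f dvd monom 1 d - 1"
      using irreducible_dvd_of_common_root[OF f(1)] that(1) by (auto simp: Z_def)
    thus False using prim that by blast
  qed
  define F where "F = map_poly complex_of_int f"
  have F0: "F \<noteq> 0" using deg by (auto simp: F_def)
  have "rsquarefree F"
  proof (unfold rsquarefree_roots, intro allI notI)
    fix z assume *: "poly F z = 0 \<and> poly (pderiv F) z = 0"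
    define H where "H = map_poly complex_of_int h"
    have FH: "F * H = monom 1 n - 1"
      using arg_cong[OF f(3), of "map_poly complex_of_int"]
      by (simp add: F_def H_def hom_distribs map_poly_monom)
    have "poly (pderiv (F * H)) z = 0" using * by (simp add: pderiv_mult)
    hence "z ^ (n - 1) = 0" unfolding FH using f(4) by (simp add: pderiv_diff pderiv_monom poly_monom pderiv_1)
    hence "z = 0" by simp
    moreover have "z \<in> Z" using * by (simp add: Z_def ipev_def F_def)
    ultimately show False using zn[of z] f(4) by (simp add: power_0_left)
  qed
  from complex_poly_decompose_rsquarefree[OF this]
  have F: "smult (lead_coeff F) (\<Prod>z|poly F z = 0. [:-z, 1:]) = F" .
  have "degree F = degree (\<Prod>z|poly F z = 0. [:-z, 1:])"
    using F0 by (subst F[symmetric]) simp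
  also have "\<dots> = (\<Sum>z|poly F z = 0. degree [:-z, 1:])"
    by (rule degree_prod_eq_sum_degree) simp
  also have "\<dots> = card Z" by (simp add: Z_def ipev_def F_def)
  finally have card: "card Z = degree f" by (simp add: F_def)
  then obtain z where z: "z \<in> Z" using deg by fastforce
  have z0: "z \<noteq> 0" using zn[OF z] f(4) by (metis power_0_left neq0_conv zero_neq_one)
  have inj: "inj_on (\<lambda>j. z ^ j) {0<..n}"
  proof -
    have *: False if "i \<in> {0<..n}" "j \<in> {0<..n}" "i < j" "z ^ i = z ^ j" for i j
    proof -
      have "z ^ j = z ^ i * z ^ (j - i)" using that(3) by (simp flip: power_add)
      hence "z ^ (j - i) = 1" using that(4) z0 by simp
      moreover have "0 < j - i" "j - i < n" using that(1-3) by auto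
      ultimately show False using primitive[OF z] by blast
    qed
    show ?thesis by (rule inj_onI) (metis * linorder_neqE_nat)
  qed
  have roots: "(\<lambda>j. z ^ j) ` {0<..n} = {w. w ^ n = 1}"
  proof (rule card_subset_eq)
    show "finite {w::complex. w ^ n = 1}" using f(4) finite_roots_unity[of n] by simp
    show "(\<lambda>j. z ^ j) ` {0<..n} \<subseteq> {w. w ^ n = 1}"
      using zn[OF z] by (auto simp: mult.commute[of _ n] power_mult simp flip: power_mult) (metis power_mult power_one mult.commute)
    have "card ((\<lambda>j. z ^ j) ` {0<..n}) = n" using inj by (simp add: card_image)
    thus "card ((\<lambda>j. z ^ j) ` {0<..n}) = card {w::complex. w ^ n = 1}"
      using f(4) card_roots_unity_eq[of n] by simp
  qed
  have "Z = (\<lambda>j. z ^ j) ` totatives n"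
  proof (intro equalityI subsetI)
    fix w assume w: "w \<in> Z"
    hence "w \<in> {w. w ^ n = 1}" using zn by simp
    then obtain j where j: "j \<in> {0<..n}" "w = z ^ j" unfolding roots[symmetric] by blast
    define g where "g = gcd j n"
    have "coprime j n"
    proof (rule ccontr)
      assume "\<not> coprime j n"
      hence "g \<noteq> 1" by (simp add: g_def coprime_iff_gcd_eq_1)
      moreover have "g \<noteq> 0" using j by (auto simp: g_def)
      ultimately have g: "g > 1" by simp
      obtain a b where ab: "j = g * a" "n = g * b" unfolding g_def by (meson dvdE gcd_dvd1 gcd_dvd2)
      have "w ^ b = (z ^ n) ^ a" unfolding j(2) by (simp add: ab mult_ac flip: power_mult)
      hence "w ^ b = 1" using zn[OF z] by simp
      moreover have "0 < b" "b < n" using ab f(4) g by auto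
      ultimately show False using primitive[OF w] by blast
    qed
    thus "w \<in> (\<lambda>j. z ^ j) ` totatives n" using j by (auto simp: totatives_def)
  next
    fix w assume "w \<in> (\<lambda>j. z ^ j) ` totatives n"
    then obtain j where "coprime j n" "j > 0" "w = z ^ j" by (auto simp: totatives_def)
    thus "w \<in> Z" using coprime_power_root[OF f(1-3) deg] z by (auto simp: Z_def)
  qed
  hence "card Z = card (totatives n)"
    using inj by (metis card_image inj_on_subset totatives_subset)
  thus ?thesis using card by (simp add: totient_def)
qed

text \<open>The \<open>n\<close>-th cyclotomic polynomial, obtained as a factor of
  \<open>X ^ n - 1\<close> of least degree that vanishes modulo \<open>p\<close> at
  \<open>a\<close>. The cofactor does not vanish there modulo \<open>p\<close>, so \<open>f\<close>
  alone accounts for the divisibility of \<open>b ^ n - 1\<close> by \<open>p ^ N\<close>.\<close>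

lemma cyclotomic_factor:
  fixes a :: int and p n :: nat
  assumes p: "prime p" and n: "n > 0" "\<not> p dvd n"
    and a: "int p dvd a ^ n - 1" and ord: "\<And>d. 0 < d \<Longrightarrow> d < n \<Longrightarrow> \<not> int p dvd a ^ d - 1"
  obtains f :: "int poly" where "irreducible f" "lead_coeff f = 1" "degree f = totient n"
    "\<And>b N. [b = a] (mod int p) \<Longrightarrow> int p ^ N dvd b ^ n - 1 \<Longrightarrow> int p ^ N dvd poly f b"
proof -
  have pp: "prime (int p)" using p by simp
  define P where "P = monom 1 n - (1 :: int poly)"
  have P: "lead_coeff P = 1" "P \<noteq> 0"
  proof -
    have "coeff P n = 1" using n(1) by (simp add: P_def)
    moreover have "degree P = n"
    proof (rule antisym)
      show "degree P \<le> n" unfolding P_def by (rule degree_diff_le) (auto simp: degree_monom_le)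
      show "n \<le> degree P" by (rule le_degree) (simp add: \<open>coeff P n = 1\<close>)
    qed
    ultimately show "lead_coeff P = 1" by simp
    thus "P \<noteq> 0" by auto
  qed
  have Pa: "poly P b = b ^ n - 1" for b by (simp add: P_def poly_monom)
  define Q where "Q f \<longleftrightarrow> f dvd P \<and> int p dvd poly f a" for f
  have "Q P" using a by (simp add: Q_def Pa)
  then obtain f0 where f0: "Q f0" "\<And>g. degree g < degree f0 \<Longrightarrow> \<not> Q g"
    using ex_has_least_nat[of Q P degree] by (metis leD)
  obtain h0 where h0: "P = f0 * h0" using f0(1) unfolding Q_def by blast
  have "lead_coeff f0 * lead_coeff h0 = 1" using P(1) unfolding h0 by (simp add: lead_coeff_mult)
  hence lc: "lead_coeff f0 * lead_coeff f0 = 1" by (auto simp: zmult_eq_1_iff)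
  \<comment> \<open>The leading coefficient of a factor of the monic \<open>P\<close> is its own
    inverse, so scaling by it makes the factor monic.\<close>
  define f h where "f = smult (lead_coeff f0) f0" and "h = smult (lead_coeff f0) h0"
  have f1: "lead_coeff f = 1" using lc unfolding f_def lead_coeff_smult .
  have fh: "f * h = P" using lc by (simp add: f_def h_def h0)
  have fQ: "Q f"
  proof -
    have "f dvd P" using fh by (metis dvd_triv_left)
    thus ?thesis using f0(1) by (simp add: Q_def f_def)
  qed
  have min: "\<not> Q g" if "degree g < degree f" for g
    using f0(2) that degree_smult_le[of "lead_coeff f0" f0] unfolding f_def by fastforce
  have unit: "is_unit g" if gP: "g dvd P" "degree g = 0" for g
  proof -
    obtain c where c: "g = [:c:]" using gP(2) by (metis degree_eq_zeroE)
    obtain k where k: "P = g * k" using gP(1) by blast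
    have "lead_coeff g * lead_coeff k = 1" using P(1) unfolding k lead_coeff_mult .
    hence "c * lead_coeff k = 1" unfolding c by simp
    hence "is_unit c" by (metis dvd_triv_left)
    thus ?thesis unfolding c by (simp add: is_unit_const_poly_iff)
  qed
  have irr: "irreducible f"
  proof (rule irreducibleI)
    show "f \<noteq> 0" using f1 by auto
    show "\<not> is_unit f"
    proof
      assume "is_unit f"
      then obtain k where "1 = f * k" by blast
      hence "poly (f * k) a = poly 1 a" by simp
      hence "poly f a * poly k a = 1" by simp
      moreover have "int p dvd poly f a * poly k a" using fQ by (simp add: Q_def)
      ultimately show False using pp not_prime_unit by metis
    qed
    fix g k assume gk: "f = g * k"
    have "g dvd (g * k) * h" "k dvd (g * k) * h" by (intro dvd_mult2 dvd_triv_left dvd_triv_right)+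
    hence gP: "g dvd P" "k dvd P" unfolding gk[symmetric] fh by this+
    have "int p dvd poly g a * poly k a" using fQ gk by (simp add: Q_def)
    hence "int p dvd poly g a \<or> int p dvd poly k a" using pp by (simp add: prime_dvd_mult_iff)
    hence "Q g \<or> Q k" using gP by (auto simp: Q_def)
    moreover have "g \<noteq> 0" "k \<noteq> 0" using gk f1 by auto
    hence "degree f = degree g + degree k" using gk by (simp add: degree_mult_eq)
    ultimately have "degree k = 0 \<or> degree g = 0" using min[of g] min[of k] by linarith
    thus "is_unit g \<or> is_unit k" using unit gP by blast
  qed
  have "degree f = totient n"
  proof (rule degree_eq_totient[OF irr f1 fh[unfolded P_def] n(1)])
    fix d assume d: "0 < d" "d < n"
    show "\<not> f dvd monom 1 d - 1"
    proof
      assume "f dvd monom 1 d - 1"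
      then obtain k where "monom 1 d - 1 = f * k" by blast
      hence "poly (monom 1 d - 1) a = poly (f * k) a" by simp
      hence "a ^ d - 1 = poly f a * poly k a" by (simp add: poly_monom)
      hence "int p dvd a ^ d - 1" using fQ by (simp add: Q_def)
      thus False using ord d by blast
    qed
  qed
  moreover have "int p ^ N dvd poly f b" if b: "[b = a] (mod int p)" "int p ^ N dvd b ^ n - 1" for b N
  proof -
    have conga: "[poly g b = poly g a] (mod int p)" for g
      by (induction g) (auto intro!: cong_add cong_mult b(1))
    \<comment> \<open>Otherwise \<open>a\<close> would be a double root of \<open>X ^ n - 1\<close>
      modulo \<open>p\<close>, against the derivative \<open>n * a ^ (n - 1)\<close>.\<close>
    have "\<not> int p dvd poly h b"
    proof
      assume "int p dvd poly h b"
      hence ha: "int p dvd poly h a" using conga[of h] by (simp add: cong_dvd_iff)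
      have fa: "int p dvd poly f a" using fQ by (simp add: Q_def)
      have "poly (pderiv (f * h)) a = int n * a ^ (n - 1)"
        unfolding fh P_def by (simp add: pderiv_diff pderiv_monom poly_monom pderiv_1)
      hence "int n * a ^ (n - 1) = poly f a * poly (pderiv h) a + poly h a * poly (pderiv f) a"
        by (simp add: pderiv_mult)
      also have "int p dvd \<dots>" using ha fa by simp
      finally have "int p dvd a ^ (n - 1)" using pp n(2) by (simp add: prime_dvd_mult_iff)
      hence "int p dvd a" using pp prime_dvd_power by blast
      hence "int p dvd a ^ n" using n(1) dvd_power dvd_trans by blast
      hence "int p dvd a ^ n - (a ^ n - 1)" using a by (rule dvd_diff)
      hence "int p dvd 1" by simp
      thus False using pp not_prime_unit by blast
    qed
    hence "coprime (int p ^ N) (poly h b)"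
      using pp by (simp add: prime_imp_coprime coprime_power_left_iff)
    moreover have "int p ^ N dvd poly f b * poly h b"
      using b(2) unfolding Pa[symmetric] fh[symmetric] by simp
    ultimately show ?thesis by (simp add: coprime_dvd_mult_left_iff)
  qed
  ultimately show ?thesis using that irr f1 by blast
qed

section \<open>Bounding the transcendence degree from above\<close>

lemma is_subfieldD:
  assumes "is_subfield K"
  shows "0 \<in> K" "1 \<in> K" "x \<in> K \<Longrightarrow> y \<in> K \<Longrightarrow> x + y \<in> K" "x \<in> K \<Longrightarrow> y \<in> K \<Longrightarrow> x * y \<in> K"
    "x \<in> K \<Longrightarrow> - x \<in> K" "x \<in> K \<Longrightarrow> inverse x \<in> K"
    "x \<in> K \<Longrightarrow> y \<in> K \<Longrightarrow> x - y \<in> K" "x \<in> K \<Longrightarrow> y \<in> K \<Longrightarrow> x / y \<in> K"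
proof -
  show *: "0 \<in> K" "1 \<in> K" "x \<in> K \<Longrightarrow> y \<in> K \<Longrightarrow> x + y \<in> K" "x \<in> K \<Longrightarrow> y \<in> K \<Longrightarrow> x * y \<in> K"
    "x \<in> K \<Longrightarrow> - x \<in> K" "x \<in> K \<Longrightarrow> inverse x \<in> K" for x y
    using assms unfolding is_subfield_def by auto
  show "x \<in> K \<Longrightarrow> y \<in> K \<Longrightarrow> x - y \<in> K" using *(3)[of x "- y"] *(5)[of y] by simp
  show "x \<in> K \<Longrightarrow> y \<in> K \<Longrightarrow> x / y \<in> K" using *(4)[of x "inverse y"] *(6)[of y] by (simp add: divide_inverse)
qed

lemma is_subfield_sum:
  "is_subfield K \<Longrightarrow> (\<And>i. i \<in> A \<Longrightarrow> f i \<in> K) \<Longrightarrow> sum f A \<in> K"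
  by (induction A rule: infinite_finite_induct) (auto simp: is_subfieldD)

lemma is_subfield_prod:
  "is_subfield K \<Longrightarrow> (\<And>i. i \<in> A \<Longrightarrow> f i \<in> K) \<Longrightarrow> prod f A \<in> K"
  by (induction A rule: infinite_finite_induct) (auto simp: is_subfieldD)

lemma is_subfield_power: "is_subfield K \<Longrightarrow> x \<in> K \<Longrightarrow> x ^ n \<in> K"
  by (induction n) (auto simp: is_subfieldD)

lemma generated_subfield_is_subfield: "is_subfield (generated_subfield S)"
  unfolding generated_subfield_def is_subfield_def by auto

lemma generated_subfield_superset: "S \<subseteq> generated_subfield S"
  unfolding generated_subfield_def by auto

lemma generated_subfield_minimal: "is_subfield F \<Longrightarrow> S \<subseteq> F \<Longrightarrow> generated_subfield S \<subseteq> F"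
  unfolding generated_subfield_def by auto

text \<open>The linear span, built term by term so that closure properties follow by induction
  without coefficient families.\<close>

inductive_set kspan :: "'a::field set \<Rightarrow> 'a set \<Rightarrow> 'a set" for K B where
  kspan_0: "0 \<in> kspan K B"
| kspan_step: "k \<in> K \<Longrightarrow> b \<in> B \<Longrightarrow> x \<in> kspan K B \<Longrightarrow> k * b + x \<in> kspan K B"

lemma kspan_add: "x \<in> kspan K B \<Longrightarrow> y \<in> kspan K B \<Longrightarrow> x + y \<in> kspan K B"
  by (induction rule: kspan.induct) (auto simp: add.assoc intro: kspan.intros)

lemma kspan_mono: "x \<in> kspan K B \<Longrightarrow> B \<subseteq> B' \<Longrightarrow> x \<in> kspan K B'"
  by (induction rule: kspan.induct) (auto intro: kspan.intros)

lemma kspan_empty: "kspan K {} = {0}"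
  by (auto elim: kspan.cases intro: kspan.intros)

lemma kspan_scale:
  assumes "is_subfield K" "k \<in> K"
  shows "x \<in> kspan K B \<Longrightarrow> k * x \<in> kspan K B"
proof (induction rule: kspan.induct)
  case (kspan_step c b x)
  have "(k * c) * b + k * x \<in> kspan K B"
    using kspan_step assms by (auto intro: kspan.intros is_subfieldD)
  thus ?case by (simp add: algebra_simps)
qed (simp add: kspan.kspan_0)

lemma kspan_base: "is_subfield K \<Longrightarrow> b \<in> B \<Longrightarrow> b \<in> kspan K B"
  using kspan_step[OF _ _ kspan_0, of 1 K b B] by (simp add: is_subfieldD)

lemma kspan_diff:
  assumes "is_subfield K" "x \<in> kspan K B" "y \<in> kspan K B" shows "x - y \<in> kspan K B"
proof -
  have "-1 \<in> K" using is_subfieldD[OF assms(1)] by blast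
  from kspan_add[OF assms(2) kspan_scale[OF assms(1) this assms(3)]] show ?thesis by simp
qed

lemma kspan_mult:
  assumes K: "is_subfield K"
    and B: "\<And>b b'. b \<in> B \<Longrightarrow> b' \<in> B' \<Longrightarrow> b * b' \<in> kspan K B''"
    and x: "x \<in> kspan K B" and y: "y \<in> kspan K B'"
  shows "x * y \<in> kspan K B''"
proof -
  have 1: "b * y \<in> kspan K B''" if b: "b \<in> B" for b
    using y
  proof (induction rule: kspan.induct)
    case (kspan_step k c z)
    have "k * (b * c) + b * z \<in> kspan K B''"
      using kspan_step K B[OF b] by (auto intro: kspan_add kspan_scale)
    thus ?case by (simp add: algebra_simps)
  qed (simp add: kspan.kspan_0)
  show ?thesis using x
  proof (induction rule: kspan.induct)
    case (kspan_step k c z)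
    have "k * (c * y) + z * y \<in> kspan K B''"
      using kspan_step K 1 by (auto intro: kspan_add kspan_scale)
    thus ?case by (simp add: algebra_simps)
  qed (simp add: kspan.kspan_0)
qed

lemma kspan_insertE:
  assumes K: "is_subfield K" and x: "x \<in> kspan K (insert b B)"
  shows "\<exists>k\<in>K. x - k * b \<in> kspan K B"
  using x
proof (induction rule: kspan.induct)
  case kspan_0
  show ?case by (intro bexI[of _ 0]) (auto simp: kspan.kspan_0 is_subfieldD[OF K])
next
  case (kspan_step k c x)
  then obtain k' where k': "k' \<in> K" "x - k' * b \<in> kspan K B" by blast
  show ?case
  proof (cases "c = b")
    case True
    have "k * c + x - (k + k') * b = x - k' * b" by (simp add: True algebra_simps)
    thus ?thesis using k' kspan_step.hyps(1) is_subfieldD(3)[OF K] by metis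
  next
    case False
    have "k * c + (x - k' * b) \<in> kspan K B"
      using False kspan_step.hyps k' by (intro kspan.intros) auto
    thus ?thesis using k'(1) by (auto simp: algebra_simps)
  qed
qed

text \<open>Elimination: a vector with a nonzero component along \<open>b\<close> clears this
  component from the others, which then lie in the span of the remaining \<open>B\<close>.\<close>

lemma kspan_dependent:
  assumes K: "is_subfield K" and B: "finite B"
  shows "finite I \<Longrightarrow> card B < card I \<Longrightarrow> (\<And>i. i \<in> I \<Longrightarrow> w i \<in> kspan K B) \<Longrightarrow>
    \<exists>c. (\<forall>i. c i \<in> K) \<and> (\<exists>i\<in>I. c i \<noteq> 0) \<and> (\<Sum>i\<in>I. c i * w i) = 0"
  using B
proof (induction B arbitrary: I w rule: finite_induct)
  case empty
  hence "I \<noteq> {}" by auto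
  moreover have "\<And>i. i \<in> I \<Longrightarrow> w i = 0" using empty.prems(3) by (simp add: kspan_empty)
  ultimately show ?case
    by (intro exI[of _ "\<lambda>_. 1"]) (auto simp: is_subfieldD[OF K])
next
  case (insert b B I w)
  have "\<forall>i\<in>I. \<exists>k\<in>K. w i - k * b \<in> kspan K B"
    using kspan_insertE[OF K] insert.prems(3) by blast
  then obtain k where k: "\<And>i. i \<in> I \<Longrightarrow> k i \<in> K" "\<And>i. i \<in> I \<Longrightarrow> w i - k i * b \<in> kspan K B" by metis
  have cB: "card (insert b B) = Suc (card B)" using insert.hyps by simp
  show ?case
  proof (cases "\<forall>i\<in>I. k i = 0")
    case True
    show ?thesis
    proof (rule insert.IH[OF insert.prems(1)])
      show "card B < card I" using insert.prems(2) cB by simp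
      show "w i \<in> kspan K B" if "i \<in> I" for i using k(2)[OF that] True that by simp
    qed
  next
    case False
    then obtain m where m: "m \<in> I" "k m \<noteq> 0" by blast
    define J where "J = I - {m}"
    define w' where "w' i = w i - k i / k m * w m" for i
    have "\<exists>c. (\<forall>i. c i \<in> K) \<and> (\<exists>i\<in>J. c i \<noteq> 0) \<and> (\<Sum>i\<in>J. c i * w' i) = 0"
    proof (rule insert.IH)
      show "finite J" using insert.prems(1) by (simp add: J_def)
      show "card B < card J" using insert.prems(1,2) cB m(1) by (simp add: J_def)
      fix i assume "i \<in> J"
      hence i: "i \<in> I" by (simp add: J_def)
      have "(w i - k i * b) - k i / k m * (w m - k m * b) \<in> kspan K B"
        by (rule kspan_diff[OF K k(2)[OF i] kspan_scale[OF K is_subfieldD(8)[OF K k(1)[OF i] k(1)[OF m(1)]] k(2)[OF m(1)]]])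
      thus "w' i \<in> kspan K B" using m(2) by (simp add: w'_def algebra_simps)
    qed
    then obtain c where c: "\<And>i. c i \<in> K" "\<exists>i\<in>J. c i \<noteq> 0" "(\<Sum>i\<in>J. c i * w' i) = 0" by blast
    define s where "s = (\<Sum>i\<in>J. c i * (k i / k m))"
    have sK: "s \<in> K" unfolding s_def
      using k(1) c(1) m(1) by (intro is_subfield_sum[OF K]) (auto simp: J_def intro!: is_subfieldD[OF K])
    define c' where "c' i = (if i = m then - s else c i)" for i
    have "(\<Sum>i\<in>I. c' i * w i) = c' m * w m + (\<Sum>i\<in>J. c' i * w i)"
      unfolding J_def using insert.prems(1) m(1) by (rule sum.remove)
    also have "(\<Sum>i\<in>J. c' i * w i) = (\<Sum>i\<in>J. c i * w i)"
      by (intro sum.cong) (auto simp: J_def c'_def)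
    also have "c' m * w m + \<dots> = (\<Sum>i\<in>J. c i * w' i)"
      by (simp add: c'_def s_def w'_def algebra_simps sum_subtractf sum_distrib_left)
    finally have "(\<Sum>i\<in>I. c' i * w i) = 0" using c(3) by simp
    moreover have "\<forall>i. c' i \<in> K" using c(1) sK by (auto simp: c'_def intro: is_subfieldD[OF K])
    moreover have "\<exists>i\<in>I. c' i \<noteq> 0" using c(2) by (auto simp: c'_def J_def)
    ultimately show ?thesis by blast
  qed
qed

section \<open>Fields generated by \<open>m\<close> elements, and the counting argument\<close>

locale finitely_generated =
  fixes K :: "'a::field set" and m :: nat and e :: "nat \<Rightarrow> 'a"
  assumes K: "is_subfield K"
begin

definition emon :: "(nat \<Rightarrow> nat) \<Rightarrow> 'a" where "emon v = (\<Prod>i<m. e i ^ v i)"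
text \<open>Exponents are bounded separately, not by total degree, so that a plain power bounds the
  number of monomials.\<close>

definition mons :: "nat \<Rightarrow> 'a set" where "mons d = emon ` {v. \<forall>i<m. v i \<le> d}"
definition pols :: "nat \<Rightarrow> 'a set" where "pols d = kspan K (mons d)"

lemma mons_eq: "mons d = emon ` (PiE {..<m} (\<lambda>_. {..d}))"
proof
  show "mons d \<subseteq> emon ` (PiE {..<m} (\<lambda>_. {..d}))"
  proof
    fix x assume "x \<in> mons d"
    then obtain v where v: "\<forall>i<m. v i \<le> d" "x = emon v" by (auto simp: mons_def)
    have "x = emon (restrict v {..<m})" unfolding v(2) emon_def by (intro prod.cong) auto
    moreover have "restrict v {..<m} \<in> PiE {..<m} (\<lambda>_. {..d})" using v(1) by auto
    ultimately show "x \<in> emon ` (PiE {..<m} (\<lambda>_. {..d}))" by blast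
  qed
qed (auto simp: mons_def)

lemma finite_mons: "finite (mons d)"
  unfolding mons_eq by (intro finite_imageI finite_PiE) auto

lemma card_mons: "card (mons d) \<le> Suc d ^ m"
proof -
  have "card (mons d) \<le> card (PiE {..<m} (\<lambda>_. {..d}))"
    unfolding mons_eq by (intro card_image_le finite_PiE) auto
  thus ?thesis by (simp add: card_PiE)
qed

lemma pols_mono: "x \<in> pols d \<Longrightarrow> d \<le> d' \<Longrightarrow> x \<in> pols d'"
  unfolding pols_def by (erule kspan_mono) (auto simp: mons_def intro: le_trans)

lemma pols_add: "x \<in> pols d \<Longrightarrow> y \<in> pols d \<Longrightarrow> x + y \<in> pols d"
  unfolding pols_def by (rule kspan_add)

lemma pols_scale: "k \<in> K \<Longrightarrow> x \<in> pols d \<Longrightarrow> k * x \<in> pols d"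
  unfolding pols_def by (rule kspan_scale[OF K])

lemma pols_mult:
  assumes "x \<in> pols d" "y \<in> pols d'" shows "x * y \<in> pols (d + d')"
  using assms unfolding pols_def
proof (rule kspan_mult[OF K, rotated])
  fix b b' assume "b \<in> mons d" "b' \<in> mons d'"
  then obtain v v' where v: "\<forall>i<m. v i \<le> d" "b = emon v" "\<forall>i<m. v' i \<le> d'" "b' = emon v'"
    by (auto simp: mons_def)
  have "b * b' = emon (\<lambda>i. v i + v' i)" by (simp add: v emon_def power_add prod.distrib)
  hence "b * b' \<in> mons (d + d')" using v by (auto simp: mons_def intro!: add_mono)
  thus "b * b' \<in> kspan K (mons (d + d'))" by (rule kspan_base[OF K])
qed

lemma pols_1: "1 \<in> pols 0"
proof -
  have "1 = emon (\<lambda>_. 0)" by (simp add: emon_def)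
  hence "1 \<in> mons 0" by (auto simp: mons_def)
  thus ?thesis unfolding pols_def by (rule kspan_base[OF K])
qed

lemma pols_const: "k \<in> K \<Longrightarrow> k \<in> pols 0"
  using pols_scale[OF _ pols_1] by simp

lemma pols_power: "x \<in> pols d \<Longrightarrow> x ^ k \<in> pols (k * d)"
  by (induction k) (auto simp: pols_1 pols_mult)

lemma pols_prod: "finite A \<Longrightarrow> (\<And>i. i \<in> A \<Longrightarrow> f i \<in> pols d) \<Longrightarrow> prod f A \<in> pols (card A * d)"
  by (induction A rule: finite_induct) (auto simp: pols_1 pols_mult)

lemma pols_gen: "i < m \<Longrightarrow> e i \<in> pols 1"
proof -
  assume i: "i < m"
  have "emon (\<lambda>j. if j = i then 1 else 0) = (\<Prod>j<m. if j = i then e j else 1)"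
    unfolding emon_def by (intro prod.cong) auto
  also have "\<dots> = e i" using i by simp
  finally have "e i \<in> mons 1" unfolding mons_def
    by (intro image_eqI[of _ _ "\<lambda>j. if j = i then 1 else 0"]) auto
  thus ?thesis unfolding pols_def by (rule kspan_base[OF K])
qed

definition fracs :: "'a set" where
  "fracs = {x. \<exists>d u w. u \<in> pols d \<and> w \<in> pols d \<and> w \<noteq> 0 \<and> x = u / w}"

lemma fracsI: "u \<in> pols d \<Longrightarrow> w \<in> pols d' \<Longrightarrow> w \<noteq> 0 \<Longrightarrow> u / w \<in> fracs"
  unfolding fracs_def using pols_mono[of u d "max d d'"] pols_mono[of w d' "max d d'"]
  by (simp, metis max.cobounded1 max.cobounded2)

lemma fracs_subfield: "is_subfield fracs"
proof -
  have c: "u \<in> fracs" if "u \<in> pols d" for u d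
    using fracsI[OF that pols_1] by simp
  have m1: "-1 \<in> K" using is_subfieldD[OF K] by blast
  have "x + y \<in> fracs \<and> x * y \<in> fracs" if xy: "x \<in> fracs" "y \<in> fracs" for x y
  proof -
    obtain d u w where x: "u \<in> pols d" "w \<in> pols d" "w \<noteq> 0" "x = u / w" using xy by (auto simp: fracs_def)
    obtain d' u' w' where y: "u' \<in> pols d'" "w' \<in> pols d'" "w' \<noteq> 0" "y = u' / w'"
      using xy by (auto simp: fracs_def)
    have ww: "w * w' \<in> pols (d + d')" "w * w' \<noteq> 0" using x y by (auto intro: pols_mult)
    have "u * w' + u' * w \<in> pols (d + d')"
      using x y pols_mult[of u d w' d'] pols_mult[of u' d' w d] by (auto simp: add.commute intro: pols_add)
    hence "(u * w' + u' * w) / (w * w') \<in> fracs" by (rule fracsI[OF _ ww])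
    moreover have "(u * u') / (w * w') \<in> fracs" by (rule fracsI[OF pols_mult[OF x(1) y(1)] ww])
    ultimately show ?thesis using x y by (simp add: add_frac_eq)
  qed
  moreover have "- x \<in> fracs \<and> inverse x \<in> fracs" if xy: "x \<in> fracs" for x
  proof -
    obtain d u w where x: "u \<in> pols d" "w \<in> pols d" "w \<noteq> 0" "x = u / w" using xy by (auto simp: fracs_def)
    have "(-1 * u) / w \<in> fracs" by (rule fracsI[OF pols_scale[OF m1 x(1)] x(2,3)])
    moreover have "inverse x \<in> fracs"
    proof (cases "u = 0")
      case True thus ?thesis using x c[OF pols_const[OF is_subfieldD(1)[OF K]]] by simp
    next
      case False
      from fracsI[OF x(2,1) this] show ?thesis using x by simp
    qed
    ultimately show ?thesis using x by simp
  qed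
  moreover have "0 \<in> fracs" "1 \<in> fracs" using c pols_const is_subfieldD(1,2)[OF K] by blast+
  ultimately show ?thesis unfolding is_subfield_def by blast
qed

lemma fracs_base: "K \<subseteq> fracs" and fracs_gen: "i < m \<Longrightarrow> e i \<in> fracs"
proof -
  have c: "u \<in> fracs" if "u \<in> pols d" for u d
    using fracsI[OF that pols_1] by simp
  show "K \<subseteq> fracs" using c pols_const by blast
  show "i < m \<Longrightarrow> e i \<in> fracs" using c pols_gen by blast
qed

lemma common_denominator:
  assumes "finite S" "S \<subseteq> fracs"
  shows "\<exists>D d. D \<noteq> 0 \<and> D \<in> pols d \<and> (\<forall>s\<in>S. D * s \<in> pols d)"
  using assms
proof (induction S rule: finite_induct)
  case empty
  show ?case using pols_1 by (intro exI[of _ 1] exI[of _ 0]) auto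
next
  case (insert s S)
  then obtain D d where D: "D \<noteq> 0" "D \<in> pols d" "\<forall>s\<in>S. D * s \<in> pols d" by auto
  obtain d' u w where s: "u \<in> pols d'" "w \<in> pols d'" "w \<noteq> 0" "s = u / w"
    using insert.prems by (auto simp: fracs_def)
  have "D * w * s \<in> pols (d + d')" using pols_mult[OF D(2) s(1)] s by simp
  moreover have "D * w * t \<in> pols (d + d')" if "t \<in> S" for t
    using pols_mult[OF D(3)[rule_format, OF that] s(2)] by (simp add: mult_ac)
  ultimately show ?case using D s pols_mult[OF D(2) s(2)]
    by (intro exI[of _ "D * w"] exI[of _ "d + d'"]) auto
qed

text \<open>Counting: as \<open>N\<close> grows, there are \<open>N ^ card S\<close> monomials in \<open>S\<close> with exponents below \<open>N\<close>, but
  after clearing denominators they lie in a space whose dimension is \<open>O (N ^ m)\<close>.\<close>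
lemma monomial_relation:
  assumes S: "finite S" "S \<subseteq> fracs" "m < card S"
  shows "\<exists>N c. (\<forall>v. c v \<in> K) \<and> (\<exists>v\<in>PiE S (\<lambda>_. {..<N}). c v \<noteq> 0) \<and>
     (\<Sum>v\<in>PiE S (\<lambda>_. {..<N::nat}). c v * (\<Prod>s\<in>S. s ^ v s)) = 0"
proof -
  obtain D d where D: "D \<noteq> 0" "D \<in> pols d" "\<And>s. s \<in> S \<Longrightarrow> D * s \<in> pols d"
    using common_denominator[OF S(1,2)] by blast
  define n where "n = card S"
  \<comment> \<open>The dimension bound is \<open>Suc (n * d) ^ m * N ^ m\<close>. With
    \<open>N\<close> larger than its first factor it stays below \<open>N ^ Suc m\<close>, hence
    below the number \<open>N ^ n\<close> of monomials.\<close>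
  define N where "N = Suc (Suc (n * d) ^ m)"
  define V where "V = PiE S (\<lambda>_. {..<N})"
  \<comment> \<open>One power of \<open>D\<close> for all monomials: each \<open>s\<close> receives
    \<open>N\<close> factors, of which \<open>v s\<close> clear the denominator of
    \<open>s ^ v s\<close>.\<close>
  define w where "w v = D ^ (N * n) * (\<Prod>s\<in>S. s ^ v s)" for v
  have finV: "finite V" unfolding V_def using S(1) by (intro finite_PiE) auto
  have cardV: "card V = N ^ n" using S(1) by (simp add: V_def card_PiE n_def)
  have w: "w v \<in> kspan K (mons (n * (N * d)))" if v: "v \<in> V" for v
  proof -
    have "(\<Prod>s\<in>S. D ^ (N - v s) * (D * s) ^ v s) = (\<Prod>s\<in>S. D ^ N * s ^ v s)"
    proof (rule prod.cong)
      fix s assume "s \<in> S"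
      hence "v s \<le> N" using v by (force simp: V_def PiE_def Pi_def)
      hence "D ^ (N - v s) * D ^ v s = D ^ N" by (simp flip: power_add)
      thus "D ^ (N - v s) * (D * s) ^ v s = D ^ N * s ^ v s"
        by (simp add: power_mult_distrib mult.assoc[symmetric])
    qed simp
    also have "\<dots> = w v" by (simp add: w_def prod.distrib n_def power_mult)
    finally have eq: "w v = (\<Prod>s\<in>S. D ^ (N - v s) * (D * s) ^ v s)" ..
    have "(\<Prod>s\<in>S. D ^ (N - v s) * (D * s) ^ v s) \<in> pols (card S * (N * d))"
    proof (rule pols_prod[OF S(1)])
      fix s assume s: "s \<in> S"
      hence "v s \<le> N" using v by (force simp: V_def PiE_def Pi_def)
      hence "(N - v s) * d + v s * d = N * d" by (simp flip: add_mult_distrib)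
      thus "D ^ (N - v s) * (D * s) ^ v s \<in> pols (N * d)"
        using pols_mult[OF pols_power[OF D(2)] pols_power[OF D(3)[OF s]], of "N - v s" "v s"] by simp
    qed
    thus ?thesis by (simp add: eq pols_def n_def)
  qed
  have "card (mons (n * (N * d))) \<le> Suc (n * (N * d)) ^ m" by (rule card_mons)
  also have "\<dots> \<le> (Suc (n * d) * N) ^ m"
    by (intro power_mono) (auto simp: N_def algebra_simps)
  also have "\<dots> = Suc (n * d) ^ m * N ^ m" by (rule power_mult_distrib)
  also have "\<dots> < N * N ^ m" by (simp add: N_def)
  also have "\<dots> \<le> N ^ n" unfolding power_Suc[symmetric]
    using S(3) by (intro power_increasing) (auto simp: N_def n_def)
  finally have "card (mons (n * (N * d))) < card V" by (simp add: cardV)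
  from kspan_dependent[OF K finite_mons finV this, of w] w
  obtain c where c: "\<forall>v. c v \<in> K" "\<exists>v\<in>V. c v \<noteq> 0" "(\<Sum>v\<in>V. c v * w v) = 0" by blast
  have "(\<Sum>v\<in>V. c v * w v) = D ^ (N * n) * (\<Sum>v\<in>V. c v * (\<Prod>s\<in>S. s ^ v s))"
    unfolding w_def sum_distrib_left by (intro sum.cong) (simp_all add: mult_ac)
  hence "(\<Sum>v\<in>V. c v * (\<Prod>s\<in>S. s ^ v s)) = 0" using c(3) D(1) by simp
  thus ?thesis using c V_def by blast
qed

text \<open>Recodes the relation as a finitely supported polynomial. Functions in \<open>PiE\<close>
  are fixed outside \<open>S\<close>, so distinct exponent vectors give distinct monomials and no
  coefficients are merged.\<close>

lemma not_algebraically_independent: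
  assumes S: "finite S" "S \<subseteq> fracs" "m < card S"
  shows "\<not> algebraically_independent K S"
proof
  assume ind: "algebraically_independent K S"
  obtain N c where c: "\<And>v. c v \<in> K" "\<exists>v\<in>PiE S (\<lambda>_. {..<N}). c v \<noteq> 0"
     "(\<Sum>v\<in>PiE S (\<lambda>_. {..<N::nat}). c v * (\<Prod>s\<in>S. s ^ v s)) = 0"
    using monomial_relation[OF S] by blast
  define V where "V = PiE S (\<lambda>_. {..<N})"
  have finV: "finite V" unfolding V_def using S(1) by (intro finite_PiE) auto
  define mo where "mo v = Abs_poly_mapping (\<lambda>s. if s \<in> S then v s else (0::nat))" for v
  have lmo: "Poly_Mapping.lookup (mo v) = (\<lambda>s. if s \<in> S then v s else 0)" for v
    unfolding mo_def by (rule lookup_Abs_poly_mapping, rule finite_subset[OF _ S(1)]) auto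
  have kmo: "Poly_Mapping.keys (mo v) \<subseteq> S" for v
    by (auto simp: in_keys_iff lmo split: if_splits)
  have inj: "inj_on mo V"
  proof (rule inj_onI)
    fix v v' assume v: "v \<in> V" "v' \<in> V" "mo v = mo v'"
    have "v s = v' s" for s
    proof (cases "s \<in> S")
      case True thus ?thesis using fun_cong[OF arg_cong[OF v(3), of Poly_Mapping.lookup], of s] by (simp add: lmo)
    next
      case False thus ?thesis using v(1,2) by (auto simp: V_def PiE_def extensional_def)
    qed
    thus "v = v'" by blast
  qed
  define P where "P = (\<Sum>v\<in>V. Poly_Mapping.single (mo v) (c v))"
  have lP: "Poly_Mapping.lookup P \<mu> = (\<Sum>v\<in>V. if mo v = \<mu> then c v else 0)" for \<mu>
    unfolding P_def by (simp add: lookup_sum lookup_single when_def)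
  have lPm: "Poly_Mapping.lookup P (mo v) = c v" if "v \<in> V" for v
  proof -
    have "(\<Sum>u\<in>V. if mo u = mo v then c u else 0) = (\<Sum>u\<in>V. if u = v then c u else 0)"
      using that inj by (intro sum.cong) (auto simp: inj_on_def)
    thus ?thesis using that finV by (simp add: lP)
  qed
  have keysP: "Poly_Mapping.keys P \<subseteq> mo ` V"
  proof
    fix \<mu> assume "\<mu> \<in> Poly_Mapping.keys P"
    hence "(\<Sum>v\<in>V. if mo v = \<mu> then c v else 0) \<noteq> 0" by (simp add: in_keys_iff lP)
    then obtain v where "v \<in> V" "mo v = \<mu>"
      by (rule sum.not_neutral_contains_not_neutral) (auto split: if_splits)
    thus "\<mu> \<in> mo ` V" by blast
  qed
  have "P \<in> mpolys_over K S"
    unfolding mpolys_over_def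
  proof (intro CollectI conjI allI ballI)
    show "Poly_Mapping.lookup P \<mu> \<in> K" for \<mu>
      unfolding lP by (intro is_subfield_sum[OF K]) (auto simp: c(1) is_subfieldD[OF K])
    show "Poly_Mapping.keys \<mu> \<subseteq> S" if "\<mu> \<in> Poly_Mapping.keys P" for \<mu>
      using keysP that kmo by blast
  qed
  moreover have "mpoly_eval P = 0"
  proof -
    have "mpoly_eval P = (\<Sum>\<mu>\<in>mo ` V. Poly_Mapping.lookup P \<mu> *
        (\<Prod>s\<in>Poly_Mapping.keys \<mu>. s ^ Poly_Mapping.lookup \<mu> s))"
      unfolding mpoly_eval_def
      by (rule sum.mono_neutral_left) (use finV keysP in \<open>auto simp: in_keys_iff\<close>)
    also have "\<dots> = (\<Sum>v\<in>V. c v * (\<Prod>s\<in>Poly_Mapping.keys (mo v). s ^ Poly_Mapping.lookup (mo v) s))"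
      unfolding sum.reindex[OF inj] by (intro sum.cong) (auto simp: lPm)
    also have "\<dots> = (\<Sum>v\<in>V. c v * (\<Prod>s\<in>S. s ^ v s))"
    proof (intro sum.cong refl)
      fix v assume "v \<in> V"
      have "(\<Prod>s\<in>Poly_Mapping.keys (mo v). s ^ Poly_Mapping.lookup (mo v) s) = (\<Prod>s\<in>S. s ^ Poly_Mapping.lookup (mo v) s)"
        by (rule prod.mono_neutral_left) (use S(1) kmo in \<open>auto simp: in_keys_iff\<close>)
      also have "\<dots> = (\<Prod>s\<in>S. s ^ v s)" by (simp add: lmo)
      finally show "c v * (\<Prod>s\<in>Poly_Mapping.keys (mo v). s ^ Poly_Mapping.lookup (mo v) s) = c v * (\<Prod>s\<in>S. s ^ v s)" by simp
    qed
    finally show ?thesis using c(3) by (simp add: V_def)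
  qed
  ultimately have "P = 0" using ind unfolding algebraically_independent_def by blast
  hence "c v = 0" if "v \<in> V" for v using lPm[OF that] by simp
  thus False using c(2) V_def by blast
qed

lemma transcendence_degree_le:
  assumes "L \<subseteq> fracs" shows "transcendence_degree K L \<le> enat m"
  unfolding transcendence_degree_def
proof (rule SUP_least)
  fix S assume "S \<in> {S. S \<subseteq> L \<and> algebraically_independent K S}"
  hence S: "S \<subseteq> fracs" "algebraically_independent K S" using assms by auto
  have sub: "algebraically_independent K T" if "T \<subseteq> S" for T
    using S(2) that unfolding algebraically_independent_def mpolys_over_def by blast
  have "finite S \<and> card S \<le> m"
  proof (rule ccontr)
    assume *: "\<not> (finite S \<and> card S \<le> m)"
    \<comment> \<open>Independence passes to subsets, so \<open>m + 1\<close> elements suffice for a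
      contradiction, even if \<open>S\<close> is infinite.\<close>
    obtain T where T: "T \<subseteq> S" "finite T" "card T = Suc m"
    proof (cases "finite S")
      case True
      with * have "Suc m \<le> card S" by simp
      from obtain_subset_with_card_n[OF this] show ?thesis using that finite_subset True by metis
    next
      case False
      from infinite_arbitrarily_large[OF this] show ?thesis using that by blast
    qed
    show False using not_algebraically_independent[OF T(2)] T S(1) sub by auto
  qed
  thus "(if finite S then enat (card S) else \<infinity>) \<le> enat m" by simp
qed

end

section \<open>Rational functions and Artin--Hasse series\<close>

lemma fps_to_fls_mult: "fps_to_fls (f * g :: 'a::comm_ring_1 fps) = fps_to_fls f * fps_to_fls g"
  by (rule fls_times_fps_to_fls)

lemma fps_to_fls_sum: "fps_to_fls (\<Sum>i\<in>A. f i) = (\<Sum>i\<in>A. fps_to_fls (f i))"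
  by (induction A rule: infinite_finite_induct) simp_all

lemma fps_to_fls_prod: "fps_to_fls (\<Prod>i\<in>A. f i :: 'a::comm_ring_1 fps) = (\<Prod>i\<in>A. fps_to_fls (f i))"
  by (induction A rule: infinite_finite_induct) (simp_all add: fps_to_fls_mult)

lemma finite_fps_const: "finite_fps (fps_const c)"
  unfolding finite_fps_def by (intro exI[of _ 1]) auto

lemma finite_fps_X: "finite_fps fps_X"
  unfolding finite_fps_def by (intro exI[of _ 2]) (auto simp: fps_X_def)

lemma finite_fps_add:
  assumes "finite_fps f" "finite_fps g" shows "finite_fps (f + g :: 'a::comm_ring_1 fps)"
proof -
  obtain M M' where "\<forall>n\<ge>M. f $ n = 0" "\<forall>n\<ge>M'. g $ n = 0" using assms unfolding finite_fps_def by blast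
  thus ?thesis unfolding finite_fps_def by (intro exI[of _ "max M M'"]) auto
qed

lemma finite_fps_mult:
  assumes "finite_fps f" "finite_fps g" shows "finite_fps (f * g :: 'a::comm_ring_1 fps)"
proof -
  obtain M M' where M: "\<forall>n\<ge>M. f $ n = 0" "\<forall>n\<ge>M'. g $ n = 0" using assms unfolding finite_fps_def by blast
  have "(f * g) $ n = 0" if "n \<ge> M + M'" for n
    unfolding fps_mult_nth
  proof (rule sum.neutral, rule ballI)
    fix i assume "i \<in> {0..n}"
    show "f $ i * g $ (n - i) = 0"
    proof (cases "i \<ge> M")
      case False
      hence "n - i \<ge> M'" using that by simp
      thus ?thesis using M by simp
    qed (use M in simp)
  qed
  thus ?thesis unfolding finite_fps_def by blast
qed

lemma finite_fps_uminus: "finite_fps f \<Longrightarrow> finite_fps (- f :: 'a::comm_ring_1 fps)"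
  unfolding finite_fps_def by simp

lemma rational_functionsE:
  assumes "x \<in> (rational_functions :: 'a::field fls set)"
  obtains a b where "finite_fps a" "finite_fps b" "b \<noteq> 0" "x = fps_to_fls a / fps_to_fls b"
proof -
  define F where "F = {x :: 'a fls. \<exists>a b. finite_fps a \<and> finite_fps b \<and> b \<noteq> 0 \<and> x = fps_to_fls a / fps_to_fls b}"
  have fin1: "finite_fps (1 :: 'a fps)" using finite_fps_const[of "1 :: 'a"] by simp
  have fin0: "finite_fps (0 :: 'a fps)" using finite_fps_const[of "0 :: 'a"] by simp
  have FI: "fps_to_fls a / fps_to_fls b \<in> F" if "finite_fps a" "finite_fps b" "b \<noteq> 0" for a b
    using that unfolding F_def by blast
  have base: "fps_to_fls a \<in> F" if "finite_fps a" for a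
    using FI[OF that fin1] by simp
  have "is_subfield F"
    unfolding is_subfield_def
  proof (intro conjI ballI)
    show "0 \<in> F" "1 \<in> F" using base[OF fin0] base[OF fin1] by simp_all
  next
    fix x y assume "x \<in> F" "y \<in> F"
    then obtain a b c d where x: "finite_fps a" "finite_fps b" "b \<noteq> 0" "x = fps_to_fls a / fps_to_fls b"
      and y: "finite_fps c" "finite_fps d" "d \<noteq> 0" "y = fps_to_fls c / fps_to_fls d"
      unfolding F_def by blast
    have bd: "finite_fps (b * d)" "b * d \<noteq> 0" using x y by (auto intro: finite_fps_mult)
    have "fps_to_fls (a * d + c * b) / fps_to_fls (b * d) \<in> F"
      by (intro FI bd finite_fps_add finite_fps_mult x y)
    moreover have "fps_to_fls (a * d + c * b) / fps_to_fls (b * d) = x + y"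
      using x(3) y(3) by (simp add: x(4) y(4) fps_to_fls_mult add_frac_eq)
    ultimately show "x + y \<in> F" by simp
    have "fps_to_fls (a * c) / fps_to_fls (b * d) \<in> F"
      by (intro FI bd finite_fps_mult x y)
    thus "x * y \<in> F" by (simp add: x(4) y(4) fps_to_fls_mult)
  next
    fix x assume "x \<in> F"
    then obtain a b where x: "finite_fps a" "finite_fps b" "b \<noteq> 0" "x = fps_to_fls a / fps_to_fls b"
      unfolding F_def by blast
    have "fps_to_fls (- a) / fps_to_fls b \<in> F" by (intro FI finite_fps_uminus x)
    thus "- x \<in> F" by (simp add: x(4))
    show "inverse x \<in> F"
    proof (cases "a = 0")
      case True thus ?thesis using base[OF fin0] x by simp
    next
      case False
      have "fps_to_fls b / fps_to_fls a \<in> F" by (intro FI x False)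
      thus ?thesis by (simp add: x(4))
    qed
  qed
  moreover have "insert fls_X (range fls_const) \<subseteq> F"
    using base[OF finite_fps_X] base[OF finite_fps_const] by (auto simp: simp del: fps_const_to_fls simp flip: fps_const_to_fls)
  ultimately have "rational_functions \<subseteq> F"
    unfolding rational_functions_def by (rule generated_subfield_minimal)
  thus ?thesis using assms that unfolding F_def by blast
qed

lemma rational_functions_common_denominator:
  assumes "finite M" "\<And>m. m \<in> M \<Longrightarrow> C m \<in> (rational_functions :: 'a::field fls set)"
  shows "\<exists>D c. finite_fps D \<and> D \<noteq> 0 \<and> (\<forall>m\<in>M. finite_fps (c m) \<and> fps_to_fls D * C m = fps_to_fls (c m))"
  using assms
proof (induction M rule: finite_induct)
  case empty
  show ?case using finite_fps_const[of "1 :: 'a"] by (intro exI[of _ 1]) simp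
next
  case (insert x M)
  then obtain D c where D: "finite_fps D" "D \<noteq> 0" "\<And>m. m \<in> M \<Longrightarrow> finite_fps (c m)"
    "\<And>m. m \<in> M \<Longrightarrow> fps_to_fls D * C m = fps_to_fls (c m)" by auto
  obtain a b where ab: "finite_fps a" "finite_fps b" "b \<noteq> 0" "C x = fps_to_fls a / fps_to_fls b"
    using rational_functionsE insert.prems by (metis insertI1)
  define c' where "c' m = (if m = x then D * a else b * c m)" for m
  have "finite_fps (c' m) \<and> fps_to_fls (D * b) * C m = fps_to_fls (c' m)" if "m \<in> insert x M" for m
  proof (cases "m = x")
    case True
    thus ?thesis using ab D(1) by (simp add: c'_def finite_fps_mult fps_to_fls_mult)
  next
    case False
    hence m: "m \<in> M" using that by simp
    have "fps_to_fls (D * b) * C m = fps_to_fls b * (fps_to_fls D * C m)"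
      by (simp only: fps_to_fls_mult mult_ac)
    thus ?thesis using False D(3,4)[OF m] ab(2) by (simp add: c'_def finite_fps_mult fps_to_fls_mult)
  qed
  thus ?case using D(1,2) ab(2,3)
    by (intro exI[of _ "D * b"] exI[of _ c']) (auto intro: finite_fps_mult)
qed

section \<open>Powers of the reduced series with \<open>p\<close>-adic exponents\<close>

lemma supp_dvd_mult:
  assumes "supp_dvd q f" "supp_dvd q g" shows "supp_dvd q (f * g :: 'a::comm_ring_1 fps)"
  unfolding supp_dvd_def
proof (intro allI impI)
  fix n assume n: "\<not> q dvd n"
  show "(f * g) $ n = 0" unfolding fps_mult_nth
  proof (rule sum.neutral, rule ballI)
    fix i assume "i \<in> {0..n}"
    hence "i \<le> n" by simp
    hence "\<not> q dvd i \<or> \<not> q dvd n - i" using n by (metis dvd_diffD)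
    thus "f $ i * g $ (n - i) = 0" using assms by (auto simp: supp_dvd_def)
  qed
qed

lemma supp_dvd_1: "supp_dvd q (1 :: 'a::comm_ring_1 fps)"
  by (auto simp: supp_dvd_def)

context char_p_base
begin

text \<open>\<open>p_power y \<beta>\<close> says that \<open>y\<close> is the power of \<open>Eb\<close> whose exponent is the p-adic limit of \<open>\<beta>\<close>.\<close>
definition p_power :: "'p mod_ring fps \<Rightarrow> (nat \<Rightarrow> nat) \<Rightarrow> bool" where
  "p_power y \<beta> \<longleftrightarrow> (\<forall>N. \<exists>h. supp_dvd (p ^ Suc N) h \<and> h $ 0 = 1 \<and> y = Eb ^ \<beta> N * h)"

lemma p_power_1: "p_power 1 (\<lambda>_. 0)"
  unfolding p_power_def by (intro allI exI[of _ 1]) (simp add: supp_dvd_1)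

lemma p_power_mult:
  assumes "p_power y \<beta>" "p_power y' \<beta>'" shows "p_power (y * y') (\<lambda>N. \<beta> N + \<beta>' N)"
  unfolding p_power_def
proof
  fix N
  obtain h where h: "supp_dvd (p ^ Suc N) h" "h $ 0 = 1" "y = Eb ^ \<beta> N * h"
    using assms(1) unfolding p_power_def by blast
  obtain h' where h': "supp_dvd (p ^ Suc N) h'" "h' $ 0 = 1" "y' = Eb ^ \<beta>' N * h'"
    using assms(2) unfolding p_power_def by blast
  have "y * y' = Eb ^ (\<beta> N + \<beta>' N) * (h * h')" unfolding h(3) h'(3) power_add by (simp only: mult_ac)
  moreover have "supp_dvd (p ^ Suc N) (h * h')" by (intro supp_dvd_mult h h')
  moreover have "(h * h') $ 0 = 1" using h h' by simp
  ultimately show "\<exists>h. supp_dvd (p ^ Suc N) h \<and> h $ 0 = 1 \<and> y * y' = Eb ^ (\<beta> N + \<beta>' N) * h" by blast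
qed

lemma p_power_power: "p_power y \<beta> \<Longrightarrow> p_power (y ^ t) (\<lambda>N. t * \<beta> N)"
  by (induction t) (auto simp: p_power_1 dest: p_power_mult)

lemma p_power_prod:
  "finite A \<Longrightarrow> (\<And>i. i \<in> A \<Longrightarrow> p_power (y i) (\<beta> i)) \<Longrightarrow> p_power (\<Prod>i\<in>A. y i) (\<lambda>N. \<Sum>i\<in>A. \<beta> i N)"
  by (induction A rule: finite_induct) (auto simp: p_power_1 p_power_mult)

lemma p_power_nonzero: "p_power y \<beta> \<Longrightarrow> y $ 0 = 1"
  unfolding p_power_def by (metis fps_mult_nth_0 fps_nth_power_0 Eb_0 power_one mult_1)

text \<open>The exponents differ by a multiple of \<open>p ^ Suc N\<close>, and by Frobenius the
  corresponding power of \<open>Eb\<close> is a series in \<open>X ^ (p ^ Suc N)\<close>. All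
  correcting factors therefore agree with \<open>1\<close> below that exponent.\<close>

lemma p_power_unique_le:
  assumes "supp_dvd (p ^ Suc N) h" "h $ 0 = 1" "supp_dvd (p ^ Suc N) h'" "h' $ 0 = 1"
    and "\<beta> \<le> \<beta>'" "[\<beta> = \<beta>'] (mod p ^ Suc N)" "n < p ^ Suc N"
  shows "(Eb ^ \<beta> * h) $ n = (Eb ^ \<beta>' * h') $ n"
proof -
  have "p ^ Suc N dvd \<beta>' - \<beta>" using assms(5,6) by (metis cong_altdef_nat cong_sym)
  then obtain t where "\<beta>' - \<beta> = p ^ Suc N * t" by blast
  hence "\<beta>' = \<beta> + p ^ Suc N * t" using assms(5) by linarith
  hence t: "\<beta>' = \<beta> + t * p ^ Suc N" by (simp only: mult.commute)
  define g where "g = (Eb ^ t) ^ (p ^ Suc N) * h'"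
  have s: "supp_dvd (p ^ Suc N) ((Eb ^ t) ^ (p ^ Suc N))"
    unfolding supp_dvd_def by (simp only: frob_p_power) simp
  have g: "supp_dvd (p ^ Suc N) g" unfolding g_def by (intro supp_dvd_mult s assms)
  have g0: "g $ 0 = 1" unfolding g_def using assms(4) by (simp add: fps_nth_power_0)
  have gh: "h $ i = g $ i" if "i < p ^ Suc N" for i
  proof (cases "i = 0")
    case False
    hence "\<not> p ^ Suc N dvd i" using that by (auto dest: dvd_imp_le)
    thus ?thesis using g assms(1) by (simp add: supp_dvd_def)
  qed (use g0 assms(2) in simp)
  have "Eb ^ \<beta>' * h' = Eb ^ \<beta> * g"
    unfolding t power_add power_mult g_def by (simp only: mult.assoc)
  moreover have "(Eb ^ \<beta> * h) $ n = (Eb ^ \<beta> * g) $ n"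
    unfolding fps_mult_nth using assms(7) by (intro sum.cong refl) (simp add: gh)
  ultimately show ?thesis by simp
qed

lemma p_power_unique:
  assumes y: "p_power y \<beta>" "p_power y' \<beta>'" and cong: "\<And>N. [\<beta> N = \<beta>' N] (mod p ^ Suc N)"
  shows "y = y'"
proof (rule fps_ext)
  fix n
  obtain h where h: "supp_dvd (p ^ Suc n) h" "h $ 0 = 1" "y = Eb ^ \<beta> n * h"
    using y(1) unfolding p_power_def by blast
  obtain h' where h': "supp_dvd (p ^ Suc n) h'" "h' $ 0 = 1" "y' = Eb ^ \<beta>' n * h'"
    using y(2) unfolding p_power_def by blast
  have "n < p ^ n" using p_gt_1 by (simp add: power_gt_expt)
  also have "p ^ n \<le> p ^ Suc n" using p_pos by simp
  finally have n: "n < p ^ Suc n" .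
  show "y $ n = y' $ n"
  proof (cases "\<beta> n \<le> \<beta>' n")
    case True
    show ?thesis unfolding h(3) h'(3) by (rule p_power_unique_le[OF h(1,2) h'(1,2) True cong n])
  next
    case False
    hence le: "\<beta>' n \<le> \<beta> n" by simp
    show ?thesis unfolding h(3) h'(3)
      by (rule sym, rule p_power_unique_le[OF h'(1,2) h(1,2) le cong_sym[OF cong] n])
  qed
qed

lemma p_power_dilate: "p_power (dilate (of_nat c) Eb) (\<lambda>N. c ^ (p ^ N))"
  unfolding p_power_def
proof
  fix N
  obtain h where h: "dilate (of_nat c) Eb = Eb ^ (c ^ (p ^ N)) * h" "\<And>n. \<not> p ^ Suc N dvd n \<Longrightarrow> h $ n = 0"
    using dilated_Eb by blast
  have "(Eb ^ (c ^ (p ^ N)) * h) $ 0 = 1" unfolding h(1)[symmetric] by simp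
  hence "h $ 0 = 1" by (simp add: fps_nth_power_0)
  thus "\<exists>h. supp_dvd (p ^ Suc N) h \<and> h $ 0 = 1 \<and> dilate (of_nat c) Eb = Eb ^ c ^ p ^ N * h"
    using h unfolding supp_dvd_def by blast
qed

end

text \<open>\<open>f\<close> stands for the cyclotomic polynomial of order \<open>p - 1\<close>,
  selected so that \<open>f_root\<close> makes it vanish at the Teichmueller lift of
  \<open>g\<close> to any precision.\<close>

locale primitive_root_base = char_p_base p ty for p and ty :: "'p::prime_card itself" +
  fixes g :: nat and f :: "int poly"
  assumes g: "residue_primroot p g"
    and f: "irreducible f" "lead_coeff f = 1" "degree f = totient (p - 1)"
    and f_root: "\<And>b N. [b = int g] (mod int p) \<Longrightarrow> int p ^ N dvd b ^ (p - 1) - 1 \<Longrightarrow> int p ^ N dvd poly f b"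
begin

text \<open>The Teichmueller lift of \<open>g\<close> modulo \<open>p ^ Suc N\<close>; its
  \<open>j\<close>-th power is the exponent attached to \<open>es j\<close>.\<close>

definition a :: "nat \<Rightarrow> nat" where "a N = g ^ (p ^ N)"
definition es :: "nat \<Rightarrow> 'p mod_ring fps" where "es j = dilate (of_nat (g ^ j)) Eb"
definition e :: "nat \<Rightarrow> 'p mod_ring fls" where "e j = fps_to_fls (es j)"
abbreviation m :: nat where "m \<equiv> totient (p - 1)"

lemma m_pos: "m > 0" using p_gt_1 by simp

lemma coprime_g: "coprime g p"
  using g unfolding residue_primroot_def by (simp add: coprime_iff_gcd_eq_1 gcd.commute)

lemma p_power_es: "p_power (es j) (\<lambda>N. a N ^ j)"
proof -
  have "(g ^ j) ^ (p ^ N) = a N ^ j" for N by (simp add: a_def mult.commute flip: power_mult)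
  thus ?thesis using p_power_dilate[of "g ^ j"] unfolding es_def by simp
qed

lemma p_power_monomial: "p_power (\<Prod>i\<in>A. es i ^ v i) (\<lambda>N. \<Sum>i\<in>A. v i * a N ^ i)" if "finite A"
  by (intro p_power_prod p_power_power p_power_es that)

text \<open>Modulo \<open>p\<close>, \<open>a N\<close> is \<open>g\<close>; modulo
  \<open>p ^ Suc N\<close> its power with exponent \<open>p - 1\<close> is \<open>1\<close> by
  Euler's theorem. These are the two premises of \<open>f_root\<close>.\<close>

lemma f_a: "int (p ^ Suc N) dvd poly f (int (a N))"
proof -
  have "[g ^ (p ^ N) = g] (mod p)"
  proof (induction N)
    case (Suc N)
    have "[(g ^ (p ^ N)) ^ p = g ^ p] (mod p)" by (rule cong_pow[OF Suc])
    moreover have "[g ^ p = g] (mod p)"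
    proof -
      have "\<not> p dvd g" using coprime_g prime_p p_gt_1
        by (metis coprime_common_divisor dvd_refl nat_dvd_1_iff_1 less_irrefl)
      hence "[g * g ^ (p - 1) = g * 1] (mod p)" using fermat_theorem[OF prime_p] by (intro cong_scalar_left)
      moreover have "g * g ^ (p - 1) = g ^ p" using p_pos by (metis power_minus_mult mult.commute)
      ultimately show ?thesis by simp
    qed
    ultimately have "[(g ^ (p ^ N)) ^ p = g] (mod p)" by (rule cong_trans)
    thus ?case unfolding power_Suc2 power_mult .
  qed simp
  hence 1: "[int (a N) = int g] (mod int p)" unfolding a_def by (simp only: cong_int_iff)
  have "coprime g (p ^ Suc N)" using coprime_g by simp
  from euler_theorem[OF this] have "[g ^ (p ^ N * (p - 1)) = 1] (mod p ^ Suc N)"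
    unfolding totient_prime_power_Suc[OF prime_p] .
  hence "[a N ^ (p - 1) = 1] (mod p ^ Suc N)" unfolding a_def power_mult .
  hence "[int (a N ^ (p - 1)) = int 1] (mod int (p ^ Suc N))" by (simp only: cong_int_iff)
  hence "int p ^ Suc N dvd int (a N) ^ (p - 1) - 1" by (simp add: cong_iff_dvd_diff)
  from f_root[OF 1 this] show ?thesis by simp
qed

text \<open>Division with remainder by \<open>f\<close>, one degree at a time; it stays over the
  integers because \<open>f\<close> is monic.\<close>

lemma reduce_power: "\<exists>r. degree r < m \<and> f dvd monom 1 j - r"
proof (induction j)
  case 0
  show ?case using m_pos by (intro exI[of _ 1]) simp
next
  case (Suc j)
  then obtain r where r: "degree r < m" "f dvd monom 1 j - r" by blast
  define r' where "r' = pCons 0 r - smult (coeff (pCons 0 r) m) f"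
  have "coeff r' i = 0" if i: "i \<ge> m" for i
  proof (cases "i = m")
    case True
    thus ?thesis using f(2,3) by (simp add: r'_def)
  next
    case False
    hence "i > m" using i by simp
    hence "coeff f i = 0" "coeff (pCons 0 r) i = 0"
      using f(3) r(1) by (auto intro!: coeff_eq_0 simp: coeff_pCons split: nat.split)
    thus ?thesis by (simp add: r'_def)
  qed
  hence "degree r' < m" using m_pos by (intro degree_lessI) auto
  moreover have "monom 1 (Suc j) - r' = pCons 0 (monom 1 j - r) + smult (coeff (pCons 0 r) m) f"
    by (simp add: r'_def monom_Suc)
  moreover have "f dvd pCons 0 (monom 1 j - r) + smult (coeff (pCons 0 r) m) f"
  proof (intro dvd_add dvd_smult dvd_refl)
    have "pCons 0 (monom 1 j - r) = [:0, 1:] * (monom 1 j - r)" by simp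
    thus "f dvd pCons 0 (monom 1 j - r)" using r(2) by (metis dvd_mult)
  qed
  ultimately show ?case by metis
qed

lemma poly_sum_lt: "degree r < m \<Longrightarrow> poly r x = (\<Sum>i<m. coeff r i * x ^ i)" for x :: int
  unfolding poly_altdef by (intro sum.mono_neutral_left) (auto simp: coeff_eq_0)

text \<open>Negative coefficients of the reduced polynomial are moved to the left-hand side.\<close>
lemma es_relation: "\<exists>v w. es j * (\<Prod>i<m. es i ^ v i) = (\<Prod>i<m. es i ^ w i)"
proof -
  obtain r where r: "degree r < m" "f dvd monom 1 j - r" using reduce_power by blast
  define v w where "v i = nat (- coeff r i)" and "w i = nat (coeff r i)" for i
  have vw: "int (w i) - int (v i) = coeff r i" for i by (simp add: v_def w_def)
  have "es j * (\<Prod>i<m. es i ^ v i) = (\<Prod>i<m. es i ^ w i)"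
  proof (rule p_power_unique)
    show "p_power (es j * (\<Prod>i<m. es i ^ v i)) (\<lambda>N. a N ^ j + (\<Sum>i<m. v i * a N ^ i))"
      by (intro p_power_mult p_power_es p_power_monomial) simp
    show "p_power (\<Prod>i<m. es i ^ w i) (\<lambda>N. \<Sum>i<m. w i * a N ^ i)"
      by (intro p_power_monomial) simp
    fix N
    obtain k where k: "monom 1 j - r = f * k" using r(2) by blast
    have "poly (monom 1 j - r) (int (a N)) = poly f (int (a N)) * poly k (int (a N))"
      unfolding k by simp
    hence d: "int (p ^ Suc N) dvd int (a N) ^ j - poly r (int (a N))"
      using f_a[of N] by (simp add: poly_monom)
    have "poly r (int (a N)) = (\<Sum>i<m. (int (w i) - int (v i)) * int (a N) ^ i)"
      unfolding poly_sum_lt[OF r(1)] vw ..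
    also have "\<dots> = int (\<Sum>i<m. w i * a N ^ i) - int (\<Sum>i<m. v i * a N ^ i)"
      by (simp add: left_diff_distrib sum_subtractf)
    finally have pr: "poly r (int (a N)) = int (\<Sum>i<m. w i * a N ^ i) - int (\<Sum>i<m. v i * a N ^ i)" .
    have aj: "int (a N ^ j) = int (a N) ^ j" by simp
    have "int (a N ^ j + (\<Sum>i<m. v i * a N ^ i)) - int (\<Sum>i<m. w i * a N ^ i) =
        int (a N) ^ j - poly r (int (a N))"
      unfolding of_nat_add using aj pr by linarith
    hence "int (p ^ Suc N) dvd int (a N ^ j + (\<Sum>i<m. v i * a N ^ i)) - int (\<Sum>i<m. w i * a N ^ i)"
      using d by (simp only:)
    thus "[a N ^ j + (\<Sum>i<m. v i * a N ^ i) = (\<Sum>i<m. w i * a N ^ i)] (mod p ^ Suc N)"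
      by (simp only: cong_int_iff[symmetric] cong_iff_dvd_diff)
  qed
  thus ?thesis by blast
qed

section \<open>The field is generated by the first \<open>m\<close> series\<close>

lemma es_nonzero: "es j \<noteq> 0"
  using p_power_nonzero[OF p_power_es[of j]] by auto

sublocale fg: finitely_generated rational_functions m e
  by unfold_locales (simp add: rational_functions_def generated_subfield_is_subfield)

lemma e_in_fracs: "e j \<in> fg.fracs"
proof -
  obtain v w where vw: "es j * (\<Prod>i<m. es i ^ v i) = (\<Prod>i<m. es i ^ w i)" using es_relation by blast
  have "fps_to_fls (es j * (\<Prod>i<m. es i ^ v i)) = fps_to_fls (\<Prod>i<m. es i ^ w i)" unfolding vw ..
  hence "e j * (\<Prod>i<m. e i ^ v i) = (\<Prod>i<m. e i ^ w i)"
    by (simp add: fps_to_fls_mult fps_to_fls_prod fps_to_fls_power e_def)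
  moreover have "(\<Prod>i<m. e i ^ v i) \<noteq> 0" using es_nonzero by (simp add: e_def)
  ultimately have "e j = (\<Prod>i<m. e i ^ w i) / (\<Prod>i<m. e i ^ v i)" by (simp add: field_simps)
  moreover have "(\<Prod>i<m. e i ^ u i) \<in> fg.fracs" for u
    by (intro is_subfield_prod is_subfield_power fg.fracs_subfield fg.fracs_gen) simp
  ultimately show ?thesis using is_subfieldD(8)[OF fg.fracs_subfield] by simp
qed

lemma generator_eq_e:
  assumes "c \<noteq> (0 :: 'p mod_ring)"
  obtains j where "fps_to_fls (fps_compose (artin_hasse_bar p) (fps_const c * fps_X)) = e j"
proof -
  obtain i where i: "i < p" "c = of_nat i" using surj_of_nat_mod_ring[of c] card_p by blast
  have "i \<noteq> 0"
  proof
    assume "i = 0"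
    hence "c = 0" unfolding i(2) by simp
    thus False using assms by blast
  qed
  hence "i \<in> totatives p" using i(1) prime_p by (simp add: totatives_prime)
  then obtain j where j: "i = g ^ j mod p"
    using residue_primroot_is_generator[OF p_gt_1 g] by (auto simp: bij_betw_def)
  have "c = of_nat (g ^ j)" unfolding i(2) j
    using of_nat_mod_CHAR[where 'a = "'p mod_ring", of "g ^ j"] card_p by simp
  hence "fps_to_fls (fps_compose (artin_hasse_bar p) (fps_const c * fps_X)) = e j"
    unfolding dilate_eq_compose e_def es_def Eb_eq by simp
  thus ?thesis using that by blast
qed

lemma e_in_field: "e j \<in> artin_hasse_field p"
proof -
  have "\<not> p dvd g" using coprime_g p_gt_1
    by (metis coprime_common_divisor dvd_refl nat_dvd_1_iff_1 less_irrefl)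
  hence "(of_nat (g ^ j) :: 'p mod_ring) \<noteq> 0"
    using of_nat_eq_0_iff_char_dvd[where 'a = "'p mod_ring", of "g ^ j"] card_p prime_p
    by (metis prime_dvd_power semiring_char_mod_ring)
  moreover have "e j = fps_to_fls (fps_compose (artin_hasse_bar p) (fps_const (of_nat (g ^ j)) * fps_X))"
    unfolding dilate_eq_compose e_def es_def Eb_eq ..
  ultimately show ?thesis unfolding artin_hasse_field_def
    by (intro subsetD[OF generated_subfield_superset]) blast
qed

lemma field_subset_fracs: "artin_hasse_field p \<subseteq> fg.fracs"
  unfolding artin_hasse_field_def
proof (rule generated_subfield_minimal[OF fg.fracs_subfield])
  show "rational_functions \<union> {fps_to_fls (fps_compose (artin_hasse_bar p) (fps_const c * fps_X)) |c. c \<noteq> 0} \<subseteq> fg.fracs"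
    using fg.fracs_base generator_eq_e e_in_fracs by (auto, metis)
qed

text \<open>A Bezout identity puts a nonzero integer \<open>r\<close> into the ideal of
  \<open>f\<close> and \<open>\<kappa>\<close>. As \<open>f\<close> vanishes at \<open>a N\<close>
  modulo \<open>p ^ Suc N\<close>, divisibility of the value of \<open>\<kappa>\<close> by
  \<open>p ^ l\<close> would pass to \<open>r\<close>, for every \<open>N \<ge> l\<close>
  alike.\<close>

lemma exponents_separated:
  assumes "degree \<kappa> < m" "\<kappa> \<noteq> 0"
  shows "\<exists>l. \<forall>N\<ge>l. \<not> int (p ^ l) dvd poly \<kappa> (int (a N))"
proof -
  have "\<not> f dvd \<kappa>"
  proof
    assume "f dvd \<kappa>"
    hence "degree f \<le> degree \<kappa>" using assms(2) by (rule dvd_imp_degree_le)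
    thus False using assms(1) f(3) by simp
  qed
  then obtain u v r where r: "r \<noteq> 0" "u * f + v * \<kappa> = [:r:]"
    using irreducible_dvd_or_bezout[OF f(1), of \<kappa>] by blast
  define l where "l = nat \<bar>r\<bar>"
  have "\<not> int (p ^ l) dvd r"
  proof
    assume "int (p ^ l) dvd r"
    hence "int (p ^ l) \<le> \<bar>r\<bar>" using dvd_imp_le_int[OF r(1)] by fastforce
    moreover have "l < p ^ l" using p_gt_1 by (simp add: power_gt_expt)
    hence "int l < int (p ^ l)" by (simp only: of_nat_less_iff)
    moreover have "int l = \<bar>r\<bar>" by (simp add: l_def)
    ultimately show False by linarith
  qed
  moreover have "int (p ^ l) dvd r" if N: "N \<ge> l" "int (p ^ l) dvd poly \<kappa> (int (a N))" for N
  proof -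
    have "p ^ l dvd p ^ Suc N" using N(1) by (intro le_imp_power_dvd) simp
    hence "int (p ^ l) dvd poly f (int (a N))" using f_a[of N] dvd_trans by (metis int_dvd_int_iff)
    hence "int (p ^ l) dvd poly u (int (a N)) * poly f (int (a N)) + poly v (int (a N)) * poly \<kappa> (int (a N))"
      using N(2) by simp
    also have "\<dots> = poly (u * f + v * \<kappa>) (int (a N))" by simp
    also have "\<dots> = r" unfolding r(2) by simp
    finally show ?thesis .
  qed
  ultimately show ?thesis by blast
qed

text \<open>The quantitative form of the linear independence of the first \<open>m\<close> powers of
  the Teichmueller lift. The bound \<open>l0\<close> does not depend on \<open>N\<close>, so
  finitely many pairs can be separated at a common precision.\<close>

lemma exponents_separated_pair:
  assumes "\<exists>i<m. v i \<noteq> w i"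
  shows "\<exists>l0. \<forall>l\<ge>l0. \<forall>N\<ge>l. \<not> [(\<Sum>i<m. v i * a N ^ i) = (\<Sum>i<m. w i * a N ^ i)] (mod p ^ l)"
proof -
  define \<kappa> where "\<kappa> = (\<Sum>i<m. monom (int (v i) - int (w i)) i)"
  have co: "coeff \<kappa> i = (if i < m then int (v i) - int (w i) else 0)" for i
  proof -
    have "coeff \<kappa> i = (\<Sum>j<m. if j = i then int (v j) - int (w j) else 0)"
      by (simp add: \<kappa>_def coeff_sum)
    thus ?thesis by simp
  qed
  have "degree \<kappa> < m" using m_pos by (intro degree_lessI) (auto simp: co)
  moreover have "\<kappa> \<noteq> 0"
  proof
    assume "\<kappa> = 0"
    hence "coeff \<kappa> i = 0" for i by simp
    thus False using assms unfolding co by (metis eq_iff_diff_eq_0 of_nat_eq_iff)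
  qed
  ultimately obtain l0 where l0: "\<And>N. N \<ge> l0 \<Longrightarrow> \<not> int (p ^ l0) dvd poly \<kappa> (int (a N))"
    using exponents_separated by blast
  have "\<not> [(\<Sum>i<m. v i * a N ^ i) = (\<Sum>i<m. w i * a N ^ i)] (mod p ^ l)" if l: "l \<ge> l0" "N \<ge> l" for l N
  proof
    assume "[(\<Sum>i<m. v i * a N ^ i) = (\<Sum>i<m. w i * a N ^ i)] (mod p ^ l)"
    hence "int (p ^ l) dvd int (\<Sum>i<m. v i * a N ^ i) - int (\<Sum>i<m. w i * a N ^ i)"
      by (simp only: cong_int_iff[symmetric] cong_iff_dvd_diff)
    also have "\<dots> = (\<Sum>i<m. (int (v i) - int (w i)) * int (a N) ^ i)"
      by (simp add: left_diff_distrib sum_subtractf)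
    also have "\<dots> = poly \<kappa> (int (a N))"
      by (simp add: \<kappa>_def poly_sum poly_monom)
    finally have "int (p ^ l) dvd poly \<kappa> (int (a N))" .
    moreover have "int (p ^ l0) dvd int (p ^ l)" using l(1) by (simp add: le_imp_power_dvd)
    ultimately show False using l0[of N] l dvd_trans by (meson le_trans)
  qed
  thus ?thesis by blast
qed

lemma monomials_independent:
  fixes C :: "(nat \<Rightarrow> nat) \<Rightarrow> 'p mod_ring fls"
  assumes M: "finite M" "M \<noteq> {}"
    and dist: "\<And>v w. v \<in> M \<Longrightarrow> w \<in> M \<Longrightarrow> v \<noteq> w \<Longrightarrow> \<exists>i<m. v i \<noteq> w i"
    and C: "\<And>v. v \<in> M \<Longrightarrow> C v \<in> rational_functions" "\<And>v. v \<in> M \<Longrightarrow> C v \<noteq> 0"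
  shows "(\<Sum>v\<in>M. C v * (\<Prod>i<m. e i ^ v i)) \<noteq> 0"
proof
  assume rel: "(\<Sum>v\<in>M. C v * (\<Prod>i<m. e i ^ v i)) = 0"
  obtain D c where D: "finite_fps D" "D \<noteq> 0" "\<And>v. v \<in> M \<Longrightarrow> finite_fps (c v)"
    "\<And>v. v \<in> M \<Longrightarrow> fps_to_fls D * C v = fps_to_fls (c v)"
    using rational_functions_common_denominator[OF M(1), of C] C(1) by blast
  have c0: "c v \<noteq> 0" if v: "v \<in> M" for v
  proof
    assume "c v = 0"
    hence "fps_to_fls D * C v = 0" using D(4)[OF v] by simp
    thus False using D(2) C(2)[OF v] by simp
  qed
  define y where "y v = (\<Prod>i<m. es i ^ v i)" for v
  have "fps_to_fls (\<Sum>v\<in>M. c v * y v) = (\<Sum>v\<in>M. fps_to_fls D * (C v * (\<Prod>i<m. e i ^ v i)))"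
    unfolding fps_to_fls_sum
  proof (rule sum.cong)
    fix v assume v: "v \<in> M"
    have "fps_to_fls (y v) = (\<Prod>i<m. e i ^ v i)"
      by (simp add: y_def fps_to_fls_prod fps_to_fls_power e_def)
    thus "fps_to_fls (c v * y v) = fps_to_fls D * (C v * (\<Prod>i<m. e i ^ v i))"
      unfolding fps_to_fls_mult D(4)[OF v, symmetric] by (simp only: mult.assoc)
  qed simp
  also have "\<dots> = 0" unfolding sum_distrib_left[symmetric] rel by simp
  finally have sum0: "(\<Sum>v\<in>M. c v * y v) = 0" by (simp only: fps_to_fls_eq_0_iff)
  define b where "b N v = (\<Sum>i<m. v i * a N ^ i)" for N v
  have "\<exists>l0. \<forall>l\<ge>l0. \<forall>N\<ge>l. \<not> [b N v = b N w] (mod p ^ l)" if "v \<in> M" "w \<in> M" "v \<noteq> w" for v w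
    unfolding b_def by (rule exponents_separated_pair[OF dist[OF that]])
  then obtain l0 where l0: "\<And>v w l N. v \<in> M \<Longrightarrow> w \<in> M \<Longrightarrow> v \<noteq> w \<Longrightarrow> l \<ge> l0 v w \<Longrightarrow> N \<ge> l \<Longrightarrow> \<not> [b N v = b N w] (mod p ^ l)"
    by metis
  define l where "l = (\<Sum>v\<in>M. \<Sum>w\<in>M. l0 v w)"
  have l: "l0 v w \<le> l" if "v \<in> M" "w \<in> M" for v w
  proof -
    have "l0 v w \<le> (\<Sum>w\<in>M. l0 v w)" using that M(1) by (intro member_le_sum) auto
    also have "\<dots> \<le> l" unfolding l_def using that M(1) by (intro member_le_sum[of v M "\<lambda>v. \<Sum>w\<in>M. l0 v w"]) auto
    finally show ?thesis .
  qed
  define s where "s = (\<Sum>v\<in>M. subdegree (c v))"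
  \<comment> \<open>Room is needed twice: \<open>N \<ge> l\<close> for separating the exponents, and
    \<open>p ^ (Suc N - l)\<close> above \<open>s\<close> for the subdegrees.\<close>
  define N where "N = l + s"
  have ps: "subdegree (c v) < p ^ (Suc N - l)" if "v \<in> M" for v
  proof -
    have "subdegree (c v) \<le> s" unfolding s_def using that M(1) by (intro member_le_sum) auto
    also have "s < p ^ s" using p_gt_1 by (simp add: power_gt_expt)
    also have "\<dots> \<le> p ^ (Suc N - l)" using p_pos by (intro power_increasing) (auto simp: N_def)
    finally show ?thesis .
  qed
  have "p_power (y v) (\<lambda>N. b N v)" for v
    unfolding y_def b_def by (rule p_power_monomial) simp
  hence "\<exists>h. supp_dvd (p ^ Suc N) h \<and> y v = Eb ^ b N v * h" for v
    unfolding p_power_def by blast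
  then obtain h where h: "\<And>v. supp_dvd (p ^ Suc N) (h v)" "\<And>v. y v = Eb ^ b N v * h v" by metis
  have "(\<Sum>v\<in>M. c v * y v) \<noteq> 0"
  proof (rule powers_independent[OF M, of l "Suc N" c "b N" y h])
    show "l \<le> Suc N" by (simp add: N_def)
    show "\<not> [b N v = b N w] (mod p ^ l)" if "v \<in> M" "w \<in> M" "v \<noteq> w" for v w
      by (rule l0[OF that l[OF that(1,2)]]) (simp add: N_def)
    show "y v \<noteq> 0" for v unfolding y_def using es_nonzero by simp
  qed (use D(3) c0 ps h in blast)+
  thus False using sum0 by blast
qed

text \<open>Needed because variables are named by field elements and the degree counts them: equal
  generators would be merged. A coincidence is a relation with two terms, excluded by
  \<open>monomials_independent\<close>.\<close>

lemma inj_e: "inj_on e {..<m}"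
proof (rule inj_onI, rule ccontr)
  fix i j assume ij: "i \<in> {..<m}" "j \<in> {..<m}" "e i = e j" "i \<noteq> j"
  define u where "u k = (\<lambda>l. if l = k then 1 else 0 :: nat)" for k :: nat
  have uij: "u i \<noteq> u j" using ij(4) by (metis u_def zero_neq_one)
  have prod: "(\<Prod>l<m. e l ^ u k l) = e k" if "k < m" for k
  proof -
    have "(\<Prod>l<m. e l ^ u k l) = (\<Prod>l<m. if l = k then e l else 1)"
      by (intro prod.cong) (auto simp: u_def)
    thus ?thesis using that by simp
  qed
  define C :: "(nat \<Rightarrow> nat) \<Rightarrow> 'p mod_ring fls" where "C v = (if v = u i then 1 else -1)" for v
  have K: "is_subfield (rational_functions :: 'p mod_ring fls set)" by (rule fg.K)
  have "(\<Sum>v\<in>{u i, u j}. C v * (\<Prod>l<m. e l ^ v l)) \<noteq> 0"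
  proof (rule monomials_independent)
    show "\<exists>l<m. v l \<noteq> w l" if "v \<in> {u i, u j}" "w \<in> {u i, u j}" "v \<noteq> w" for v w
      using that ij(1,2,4) by (auto simp: u_def intro: exI[of _ i])
    show "C v \<in> rational_functions" for v using is_subfieldD[OF K] by (auto simp: C_def)
  qed (auto simp: C_def)
  moreover have "(\<Sum>v\<in>{u i, u j}. C v * (\<Prod>l<m. e l ^ v l)) =
      C (u i) * (\<Prod>l<m. e l ^ u i l) + C (u j) * (\<Prod>l<m. e l ^ u j l)"
    using uij by simp
  moreover have "\<dots> = e i - e j"
    unfolding prod[OF ij(1)[unfolded lessThan_iff]] prod[OF ij(2)[unfolded lessThan_iff]]
    using uij by (simp add: C_def)
  ultimately show False using ij(3) by simp
qed

lemma algebraically_independent_e: "algebraically_independent rational_functions (e ` {..<m})"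
  unfolding algebraically_independent_def
proof (intro ballI impI, rule ccontr)
  fix P assume P: "P \<in> mpolys_over rational_functions (e ` {..<m})" "mpoly_eval P = 0" "P \<noteq> 0"
  define S where "S = e ` {..<m}"
  define ex where "ex \<mu> = (\<lambda>i. if i < m then Poly_Mapping.lookup \<mu> (e i) else 0)" for \<mu> :: "'p mod_ring fls \<Rightarrow>\<^sub>0 nat"
  have keys: "Poly_Mapping.keys \<mu> \<subseteq> S" if "\<mu> \<in> Poly_Mapping.keys P" for \<mu>
    using P(1) that unfolding mpolys_over_def S_def by blast
  have ext: "\<mu> = \<nu>" if "\<mu> \<in> Poly_Mapping.keys P" "\<nu> \<in> Poly_Mapping.keys P" "\<And>i. i < m \<Longrightarrow> ex \<mu> i = ex \<nu> i" for \<mu> \<nu>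
  proof (rule poly_mapping_eqI)
    fix x
    show "Poly_Mapping.lookup \<mu> x = Poly_Mapping.lookup \<nu> x"
    proof (cases "x \<in> S")
      case True
      then obtain i where "i < m" "x = e i" unfolding S_def by blast
      thus ?thesis using that(3)[of i] by (simp add: ex_def)
    next
      case False
      hence "x \<notin> Poly_Mapping.keys \<mu>" "x \<notin> Poly_Mapping.keys \<nu>" using keys that by blast+
      thus ?thesis by (simp add: in_keys_iff)
    qed
  qed
  have inj: "inj_on ex (Poly_Mapping.keys P)" by (rule inj_onI) (auto intro: ext)
  define M where "M = ex ` Poly_Mapping.keys P"
  define C where "C v = Poly_Mapping.lookup P (the_inv_into (Poly_Mapping.keys P) ex v)" for v
  have Cex: "C (ex \<mu>) = Poly_Mapping.lookup P \<mu>" if "\<mu> \<in> Poly_Mapping.keys P" for \<mu>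
    unfolding C_def using that by (simp add: the_inv_into_f_f[OF inj])
  have "(\<Sum>v\<in>M. C v * (\<Prod>i<m. e i ^ v i)) \<noteq> 0"
  proof (rule monomials_independent)
    show "finite M" by (simp add: M_def)
    show "M \<noteq> {}" using P(3) by (simp add: M_def)
    show "\<exists>i<m. v i \<noteq> w i" if "v \<in> M" "w \<in> M" "v \<noteq> w" for v w
      using that ext unfolding M_def by blast
    show "C v \<in> rational_functions" if "v \<in> M" for v
      using that P(1) Cex unfolding M_def mpolys_over_def by auto
    show "C v \<noteq> 0" if "v \<in> M" for v
      using that Cex unfolding M_def by (auto simp: in_keys_iff)
  qed
  moreover have "(\<Sum>v\<in>M. C v * (\<Prod>i<m. e i ^ v i)) = mpoly_eval P"
    unfolding M_def sum.reindex[OF inj] mpoly_eval_def o_def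
  proof (rule sum.cong)
    fix \<mu> assume \<mu>: "\<mu> \<in> Poly_Mapping.keys P"
    have "(\<Prod>x\<in>Poly_Mapping.keys \<mu>. x ^ Poly_Mapping.lookup \<mu> x) = (\<Prod>x\<in>S. x ^ Poly_Mapping.lookup \<mu> x)"
      by (rule prod.mono_neutral_left) (use keys[OF \<mu>] in \<open>auto simp: S_def in_keys_iff\<close>)
    also have "\<dots> = (\<Prod>i<m. e i ^ Poly_Mapping.lookup \<mu> (e i))"
      unfolding S_def by (subst prod.reindex[OF inj_e]) simp
    also have "\<dots> = (\<Prod>i<m. e i ^ ex \<mu> i)" by (intro prod.cong) (auto simp: ex_def)
    finally show "C (ex \<mu>) * (\<Prod>i<m. e i ^ ex \<mu> i) =
       Poly_Mapping.lookup P \<mu> * (\<Prod>x\<in>Poly_Mapping.keys \<mu>. x ^ Poly_Mapping.lookup \<mu> x)"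
      by (simp add: Cex[OF \<mu>])
  qed simp
  ultimately show False using P(2) by simp
qed

lemma transcendence_degree_eq:
  "transcendence_degree rational_functions (artin_hasse_field p :: 'p mod_ring fls set) = enat m"
proof (rule antisym)
  show "transcendence_degree rational_functions (artin_hasse_field p :: 'p mod_ring fls set) \<le> enat m"
    by (rule fg.transcendence_degree_le[OF field_subset_fracs])
  define S where "S = e ` {..<m}"
  have S: "S \<in> {S. S \<subseteq> artin_hasse_field p \<and> algebraically_independent rational_functions S}"
    using e_in_field algebraically_independent_e by (auto simp: S_def)
  have "(if finite S then enat (card S) else \<infinity>) = enat m"
    unfolding S_def card_image[OF inj_e] by simp
  moreover have "(if finite S then enat (card S) else \<infinity>) 
      \<le> transcendence_degree rational_functions (artin_hasse_field p :: 'p mod_ring fls set)"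
    unfolding transcendence_degree_def by (rule SUP_upper[OF S, of "\<lambda>S. if finite S then enat (card S) else \<infinity>"])
  ultimately show "enat m \<le> transcendence_degree rational_functions (artin_hasse_field p :: 'p mod_ring fls set)"
    by simp
qed

end

theorem theorem1p4:
  fixes p :: nat
  assumes "prime p" and "CARD('p::prime_card) = p"
  shows "transcendence_degree rational_functions (artin_hasse_field p :: 'p mod_ring fls set)
           = enat (totient (p - 1))"
proof -
  have p1: "p > 1" using assms(1) by (rule prime_gt_1_nat)
  obtain g where g: "residue_primroot p g" using prime_primitive_root_exists[OF p1 assms(1)] by blast
  have ord: "ord p g = p - 1" using g assms(1) by (simp add: residue_primroot_def totient_prime)
  \<comment> \<open>That the order of \<open>g\<close> is exactly \<open>p - 1\<close> supplies both
    premises of \<open>cyclotomic_factor\<close> on powers of \<open>g\<close>.\<close>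
  have dvd_iff: "int p dvd int g ^ d - 1 \<longleftrightarrow> p - 1 dvd d" for d
  proof -
    have "int p dvd int g ^ d - 1 \<longleftrightarrow> [int (g ^ d) = int 1] (mod int p)"
      by (simp add: cong_iff_dvd_diff)
    also have "\<dots> \<longleftrightarrow> [g ^ d = 1] (mod p)" by (rule cong_int_iff)
    also have "\<dots> \<longleftrightarrow> p - 1 dvd d" unfolding ord_divides ord ..
    finally show ?thesis .
  qed
  have n: "p - 1 > 0" using p1 by simp
  have gn: "int p dvd int g ^ (p - 1) - 1" unfolding dvd_iff by simp
  have nd: "\<not> p dvd p - 1" using p1 by (auto dest: dvd_imp_le)
  have od: "\<not> int p dvd int g ^ d - 1" if "0 < d" "d < p - 1" for d
    unfolding dvd_iff using that by (auto dest: dvd_imp_le)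
  obtain f :: "int poly" where f: "irreducible f" "lead_coeff f = 1" "degree f = totient (p - 1)"
    "\<And>b N. [b = int g] (mod int p) \<Longrightarrow> int p ^ N dvd b ^ (p - 1) - 1 \<Longrightarrow> int p ^ N dvd poly f b"
  proof (rule cyclotomic_factor[OF assms(1) n nd gn od])
    fix f :: "int poly"
    assume "irreducible f" "lead_coeff f = 1" "degree f = totient (p - 1)"
      "\<And>b N. [b = int g] (mod int p) \<Longrightarrow> int p ^ N dvd b ^ (p - 1) - 1 \<Longrightarrow> int p ^ N dvd poly f b"
    thus thesis by (rule that)
  qed
  interpret primitive_root_base p "TYPE('p)" g f
    by unfold_locales (use assms g f in auto)
  show ?thesis by (rule transcendence_degree_eq)
qed

end
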